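(* Let $E=(E^0,E^1,r,s)$ be a (directed) graph and let $K$ be a field. Then the following are equivalent: (i) the graph $C^*$-algebra $C^*(E)$ is residually finite-dimensional; (ii) the Leavitt path algebra $L_K(E)$ is residually finite-dimensional; (iii) $E$ satisfies Bellier's graph conditions: $E$ has no infinite receivers, no cycle of $E$ has an exit, $E$ has no infinite backward chains, and every vertex of $E$ reaches a sink, a cycle, or an infinite emitter.
   Context: $E^0$ is the set of vertices, $E^1$ the set of edges, $r,s:E^1\to E^0$ the range and source maps. A path of length $n\ge 1$ is a word $e_1\cdots e_n$ with $r(e_i)=s(e_{i+1})$; it goes from $s(e_1)$ to $r(e_n)$. A vertex $v$ reaches a vertex $w$ if $v=w$ or there is a path of positive length from $v$ to $w$; $v$ reaches a cycle if it reaches a vertex lying on a cycle. A vertex $v$ is a sink if $s^{-1}(v)=\emptyset$, regular if $0<|s^{-1}(v)|<\infty$, an infinite emitter if $|s^{-1}(v)|=\infty$, and an infinite receiver if $|r^{-1}(v)|=\infty$. A cycle is a path $e_1\cdots e_n$, $n\ge1$, with $r(e_n)=s(e_1)$ and $s(e_1),\dots,s(e_n)$ distinct; an exit for it is an edge $f$ with $s(f)=r(e_i)$ and $f\ne e_{i+1}$ for some $i$ (indices cyclic). An infinite backward chain is an infinite sequence of distinct edges $e_1,e_2,\dots$ with $s(e_i)=r(e_{i+1})$ for all $i\ge1$. $L_K(E)$ is the universal $K$-algebra generated by pairwise orthogonal idempotents $p_v$ ($v\in E^0$) and elements $s_e,s_e^*$ ($e\in E^1$) with $p_{s(e)}s_e=s_ep_{r(e)}=s_e$,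 $p_{r(e)}s_e^*=s_e^*p_{s(e)}=s_e^*$, $s_e^*s_f=\delta_{e,f}p_{r(e)}$, and $p_v=\sum_{s(e)=v}s_es_e^*$ for every regular vertex $v$. $C^*(E)$ is the universal $C^*$-algebra generated by pairwise orthogonal projections $p_v$ and partial isometries $s_e$ with mutually orthogonal ranges satisfying $s_e^*s_e=p_{r(e)}$, $s_es_e^*\le p_{s(e)}$, and $p_v=\sum_{s(e)=v}s_es_e^*$ for every regular vertex $v$. A $K$-algebra $A$ is residually finite-dimensional (RFD) if for every $0\ne a\in A$ there are a finite-dimensional $K$-vector space $V$ and a $K$-algebra homomorphism $\pi:A\to\operatorname{End}_K(V)$ with $\pi(a)\ne0$. A $C^*$-algebra is RFD if its finite-dimensional $*$-representations separate points. *)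

theory Defs
  imports
    "Graph_Theory.Arc_Walk"
    "Jordan_Normal_Form.Schur_Decomposition"
    "HOL-Library.Poly_Mapping"
begin

section \<open>Graphs\<close>

text \<open>
  A directed graph is a \<^term>\<open>E :: ('v, 'e) pre_digraph\<close> satisfying \<^const>\<open>wf_digraph\<close>, with
  $E^0$ = \<^term>\<open>verts E\<close>, $E^1$ = \<^term>\<open>arcs E\<close>, $s$ = \<^term>\<open>tail E\<close>, $r$ = \<^term>\<open>head E\<close>.
  Both sets may be empty, or infinite of any cardinality; loops and parallel edges are allowed.
\<close>

definition sink :: "('v, 'e) pre_digraph \<Rightarrow> 'v \<Rightarrow> bool" where
  "sink E v \<longleftrightarrow> v \<in> verts E \<and> out_arcs E v = {}"

definition regular_vertex :: "('v, 'e) pre_digraph \<Rightarrow> 'v \<Rightarrow> bool" where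
  "regular_vertex E v \<longleftrightarrow> v \<in> verts E \<and> out_arcs E v \<noteq> {} \<and> finite (out_arcs E v)"

definition infinite_emitter :: "('v, 'e) pre_digraph \<Rightarrow> 'v \<Rightarrow> bool" where
  "infinite_emitter E v \<longleftrightarrow> v \<in> verts E \<and> infinite (out_arcs E v)"

definition infinite_receiver :: "('v, 'e) pre_digraph \<Rightarrow> 'v \<Rightarrow> bool" where
  "infinite_receiver E v \<longleftrightarrow> v \<in> verts E \<and> infinite (in_arcs E v)"

text \<open>
  Cycles are those of \<^const>\<open>pre_digraph.cycle\<close>: nonempty closed walks $e_1 \cdots e_n$ for which
  $r(e_1), \dots, r(e_n)$ (a cyclic shift of $s(e_1), \dots, s(e_n)$) are distinct; loops count.
\<close>

definition cycle_exit :: "('v, 'e) pre_digraph \<Rightarrow> 'e list \<Rightarrow> 'e \<Rightarrow> bool" where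
  "cycle_exit E p f \<longleftrightarrow> f \<in> arcs E \<and>
     (\<exists>i < length p. tail E f = head E (p ! i) \<and> f \<noteq> p ! (Suc i mod length p))"

definition on_cycle :: "('v, 'e) pre_digraph \<Rightarrow> 'v \<Rightarrow> bool" where
  "on_cycle E v \<longleftrightarrow> (\<exists>p. pre_digraph.cycle E p \<and> v \<in> tail E ` set p)"

definition infinite_backward_chain :: "('v, 'e) pre_digraph \<Rightarrow> (nat \<Rightarrow> 'e) \<Rightarrow> bool" where
  "infinite_backward_chain E e \<longleftrightarrow>
     range e \<subseteq> arcs E \<and> inj e \<and> (\<forall>i. tail E (e i) = head E (e (Suc i)))"

definition bellier_conditions :: "('v, 'e) pre_digraph \<Rightarrow> bool" where
  "bellier_conditions E \<longleftrightarrow>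
     (\<nexists>v. infinite_receiver E v) \<and>
     (\<nexists>p f. pre_digraph.cycle E p \<and> cycle_exit E p f) \<and>
     (\<nexists>e. infinite_backward_chain E e) \<and>
     (\<forall>v \<in> verts E. \<exists>w. v \<rightarrow>\<^sup>*\<^bsub>E\<^esub> w \<and> (sink E w \<or> on_cycle E w \<or> infinite_emitter E w))"


section \<open>Algebras without unit, ideals and quotients\<close>

text \<open>\<open>HOL-Algebra\<close>'s algebra records carry a unit, which graph algebras lack in general.\<close>

record ('k, 'a) nu_algebra = "'a partial_object" +
  alg_zero :: 'a
  alg_add :: "'a \<Rightarrow> 'a \<Rightarrow> 'a"
  alg_mult :: "'a \<Rightarrow> 'a \<Rightarrow> 'a"
  alg_scale :: "'k \<Rightarrow> 'a \<Rightarrow> 'a"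

record ('k, 'a) star_algebra = "('k, 'a) nu_algebra" +
  alg_star :: "'a \<Rightarrow> 'a"

record ('k, 'a) normed_star_algebra = "('k, 'a) star_algebra" +
  alg_norm :: "'a \<Rightarrow> real"

definition algebra_ideal :: "('k, 'a, 'm) nu_algebra_scheme \<Rightarrow> 'a set \<Rightarrow> bool" where
  "algebra_ideal A I \<longleftrightarrow>
     I \<subseteq> carrier A \<and> alg_zero A \<in> I \<and>
     (\<forall>x \<in> I. \<forall>y \<in> I. alg_add A x y \<in> I) \<and>
     (\<forall>c. \<forall>x \<in> I. alg_scale A c x \<in> I) \<and>
     (\<forall>a \<in> carrier A. \<forall>x \<in> I. alg_mult A a x \<in> I \<and> alg_mult A x a \<in> I)"

definition ideal_generated :: "('k, 'a, 'm) nu_algebra_scheme \<Rightarrow> 'a set \<Rightarrow> 'a set" where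
  "ideal_generated A R = \<Inter> {I. algebra_ideal A I \<and> R \<subseteq> I}"

definition alg_coset :: "('k, 'a, 'm) nu_algebra_scheme \<Rightarrow> 'a set \<Rightarrow> 'a \<Rightarrow> 'a set" where
  "alg_coset A I a = alg_add A a ` I"

definition quotient_algebra ::
    "('k, 'a, 'm) nu_algebra_scheme \<Rightarrow> 'a set \<Rightarrow> ('k, 'a set) nu_algebra" where
  "quotient_algebra A I =
    \<lparr> carrier = alg_coset A I ` carrier A,
      alg_zero = alg_coset A I (alg_zero A),
      alg_add = (\<lambda>X Y. \<Union>x \<in> X. \<Union>y \<in> Y. alg_coset A I (alg_add A x y)),
      alg_mult = (\<lambda>X Y. \<Union>x \<in> X. \<Union>y \<in> Y. alg_coset A I (alg_mult A x y)),
      alg_scale = (\<lambda>c X. \<Union>x \<in> X. alg_coset A I (alg_scale A c x)) \<rparr>"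


section \<open>Residual finite-dimensionality\<close>

text \<open>
  A finite-dimensional vector space over $K$ is taken to be $K^n$ for some $n$, so that its
  endomorphism algebra is the algebra of $n \times n$ matrices; likewise a finite-dimensional
  Hilbert space is $\mathbb{C}^n$, with \<^const>\<open>mat_adjoint\<close> as the adjoint. Neither
  representations nor algebras are required to be unital, and $n = 0$ is allowed.
\<close>

definition fin_dim_rep ::
    "('k::field, 'a, 'm) nu_algebra_scheme \<Rightarrow> nat \<Rightarrow> ('a \<Rightarrow> 'k mat) \<Rightarrow> bool" where
  "fin_dim_rep A n \<pi> \<longleftrightarrow>
     (\<forall>a \<in> carrier A. \<pi> a \<in> carrier_mat n n) \<and>
     (\<forall>a \<in> carrier A. \<forall>b \<in> carrier A. \<pi> (alg_add A a b) = \<pi> a + \<pi> b) \<and>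
     (\<forall>a \<in> carrier A. \<forall>b \<in> carrier A. \<pi> (alg_mult A a b) = \<pi> a * \<pi> b) \<and>
     (\<forall>c. \<forall>a \<in> carrier A. \<pi> (alg_scale A c a) = c \<cdot>\<^sub>m \<pi> a)"

definition rfd_algebra :: "('k::field, 'a, 'm) nu_algebra_scheme \<Rightarrow> bool" where
  "rfd_algebra A \<longleftrightarrow>
     (\<forall>a \<in> carrier A. a \<noteq> alg_zero A \<longrightarrow> (\<exists>n \<pi>. fin_dim_rep A n \<pi> \<and> \<pi> a \<noteq> 0\<^sub>m n n))"

definition fin_dim_star_rep ::
    "(complex, 'a, 'm) star_algebra_scheme \<Rightarrow> nat \<Rightarrow> ('a \<Rightarrow> complex mat) \<Rightarrow> bool" where
  "fin_dim_star_rep A n \<pi> \<longleftrightarrow>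
     fin_dim_rep A n \<pi> \<and> (\<forall>a \<in> carrier A. \<pi> (alg_star A a) = mat_adjoint (\<pi> a))"

definition rfd_cstar_algebra :: "(complex, 'a, 'm) normed_star_algebra_scheme \<Rightarrow> bool" where
  "rfd_cstar_algebra A \<longleftrightarrow>
     (\<forall>a \<in> carrier A. \<forall>b \<in> carrier A. a \<noteq> b \<longrightarrow>
        (\<exists>n \<pi>. fin_dim_star_rep A n \<pi> \<and> \<pi> a \<noteq> \<pi> b))"


section \<open>The free algebra on the generators of a graph\<close>

datatype 'x free_monoid = Word (letters: "'x list")

text \<open>
  Words form the free monoid under concatenation, written additively because the convolution
  product on \<^typ>\<open>'x free_monoid \<Rightarrow>\<^sub>0 'k\<close> is built from \<^class>\<open>monoid_add\<close>. Thus
  \<^typ>\<open>'x free_monoid \<Rightarrow>\<^sub>0 'k\<close> is the unital free algebra, and the free algebra without unit on a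
  set of letters consists of the elements supported on nonempty words in these letters.
\<close>

instantiation free_monoid :: (type) monoid_add
begin

definition zero_free_monoid :: "'a free_monoid" where
  "0 = Word []"

definition plus_free_monoid :: "'a free_monoid \<Rightarrow> 'a free_monoid \<Rightarrow> 'a free_monoid" where
  "u + w = Word (letters u @ letters w)"

instance
  by standard (simp_all add: zero_free_monoid_def plus_free_monoid_def)

end

definition free_algebra :: "'x set \<Rightarrow> ('k::field, 'x free_monoid \<Rightarrow>\<^sub>0 'k) nu_algebra" where
  "free_algebra X =
    \<lparr> carrier = {a. \<forall>w \<in> Poly_Mapping.keys a. w \<noteq> 0 \<and> set (letters w) \<subseteq> X},
      alg_zero = 0,
      alg_add = (+),
      alg_mult = (*),
      alg_scale = (\<lambda>c a. Poly_Mapping.single 0 c * a) \<rparr>"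

text \<open>The letters \<open>Vert v\<close>, \<open>Edge e\<close>, \<open>Ghost e\<close> stand for $p_v$, $s_e$, $s_e^*$.\<close>

datatype ('v, 'e) graph_gen = Vert 'v | Edge 'e | Ghost 'e

type_synonym ('v, 'e, 'k) graph_free = "('v, 'e) graph_gen free_monoid \<Rightarrow>\<^sub>0 'k"

definition graph_gens :: "('v, 'e) pre_digraph \<Rightarrow> ('v, 'e) graph_gen set" where
  "graph_gens E = Vert ` verts E \<union> Edge ` arcs E \<union> Ghost ` arcs E"

definition gen_p :: "'v \<Rightarrow> ('v, 'e, 'k::field) graph_free" where
  "gen_p v = Poly_Mapping.single (Word [Vert v]) 1"

definition gen_s :: "'e \<Rightarrow> ('v, 'e, 'k::field) graph_free" where
  "gen_s e = Poly_Mapping.single (Word [Edge e]) 1"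

definition gen_s_star :: "'e \<Rightarrow> ('v, 'e, 'k::field) graph_free" where
  "gen_s_star e = Poly_Mapping.single (Word [Ghost e]) 1"


section \<open>Leavitt path algebras\<close>

definition leavitt_relations :: "('v, 'e) pre_digraph \<Rightarrow> ('v, 'e, 'k::field) graph_free set" where
  "leavitt_relations E =
     {gen_p v * gen_p w - (if v = w then gen_p v else 0) | v w. v \<in> verts E \<and> w \<in> verts E} \<union>
     {gen_p (tail E e) * gen_s e - gen_s e | e. e \<in> arcs E} \<union>
     {gen_s e * gen_p (head E e) - gen_s e | e. e \<in> arcs E} \<union>
     {gen_p (head E e) * gen_s_star e - gen_s_star e | e. e \<in> arcs E} \<union>
     {gen_s_star e * gen_p (tail E e) - gen_s_star e | e. e \<in> arcs E} \<union>
     {gen_s_star e * gen_s f - (if e = f then gen_p (head E e) else 0)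
        | e f. e \<in> arcs E \<and> f \<in> arcs E} \<union>
     {gen_p v - (\<Sum>e \<in> out_arcs E v. gen_s e * gen_s_star e) | v. regular_vertex E v}"

definition leavitt_path_algebra ::
    "('v, 'e) pre_digraph \<Rightarrow> ('k::field, ('v, 'e, 'k) graph_free set) nu_algebra" where
  "leavitt_path_algebra E =
     quotient_algebra (free_algebra (graph_gens E))
       (ideal_generated (free_algebra (graph_gens E)) (leavitt_relations E))"


section \<open>Graph C*-algebras\<close>

text \<open>
  The involution on the free complex algebra is conjugate-linear, reverses words, fixes each
  \<open>Vert v\<close> and exchanges \<open>Edge e\<close> and \<open>Ghost e\<close>; that is, we use the free *-algebra generated by
  self-adjoint elements $p_v$ and elements $s_e$.
\<close>

fun star_gen :: "('v, 'e) graph_gen \<Rightarrow> ('v, 'e) graph_gen" where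
  "star_gen (Vert v) = Vert v"
| "star_gen (Edge e) = Ghost e"
| "star_gen (Ghost e) = Edge e"

definition star_word :: "('v, 'e) graph_gen free_monoid \<Rightarrow> ('v, 'e) graph_gen free_monoid" where
  "star_word w = Word (rev (map star_gen (letters w)))"

definition star_free :: "('v, 'e, complex) graph_free \<Rightarrow> ('v, 'e, complex) graph_free" where
  "star_free a =
     (\<Sum>w \<in> Poly_Mapping.keys a. Poly_Mapping.single (star_word w) (cnj (Poly_Mapping.lookup a w)))"

definition free_star_algebra ::
    "('v, 'e) pre_digraph \<Rightarrow> (complex, ('v, 'e, complex) graph_free) star_algebra" where
  "free_star_algebra E = nu_algebra.extend (free_algebra (graph_gens E)) \<lparr> alg_star = star_free \<rparr>"

text \<open>
  In order: the $p_v$ are pairwise orthogonal projections (self-adjointness is built into the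
  involution), the $s_e$ are partial isometries, their range projections $s_e s_e^*$ are mutually
  orthogonal, $s_e^* s_e = p_{r(e)}$, $s_e s_e^* \le p_{s(e)}$, and the relation at regular
  vertices. For projections, $q \le p$ means $p q = q$.
\<close>

definition cuntz_krieger_relations ::
    "('v, 'e) pre_digraph \<Rightarrow> ('v, 'e, complex) graph_free set" where
  "cuntz_krieger_relations E =
     {gen_p v * gen_p w - (if v = w then gen_p v else 0) | v w. v \<in> verts E \<and> w \<in> verts E} \<union>
     {gen_s e * gen_s_star e * gen_s e - gen_s e | e. e \<in> arcs E} \<union>
     {(gen_s e * gen_s_star e) * (gen_s f * gen_s_star f)
        | e f. e \<in> arcs E \<and> f \<in> arcs E \<and> e \<noteq> f} \<union>
     {gen_s_star e * gen_s e - gen_p (head E e) | e. e \<in> arcs E} \<union>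
     {gen_p (tail E e) * (gen_s e * gen_s_star e) - gen_s e * gen_s_star e | e. e \<in> arcs E} \<union>
     {gen_p v - (\<Sum>e \<in> out_arcs E v. gen_s e * gen_s_star e) | v. regular_vertex E v}"

definition cstar_seminorm :: "(complex, 'a, 'm) star_algebra_scheme \<Rightarrow> ('a \<Rightarrow> real) \<Rightarrow> bool" where
  "cstar_seminorm A \<rho> \<longleftrightarrow>
     (\<forall>a \<in> carrier A. 0 \<le> \<rho> a) \<and>
     (\<forall>a \<in> carrier A. \<forall>b \<in> carrier A. \<rho> (alg_add A a b) \<le> \<rho> a + \<rho> b) \<and>
     (\<forall>c. \<forall>a \<in> carrier A. \<rho> (alg_scale A c a) = cmod c * \<rho> a) \<and>
     (\<forall>a \<in> carrier A. \<forall>b \<in> carrier A. \<rho> (alg_mult A a b) \<le> \<rho> a * \<rho> b) \<and>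
     (\<forall>a \<in> carrier A. \<rho> (alg_mult A (alg_star A a) a) = (\<rho> a)\<^sup>2)"

definition cuntz_krieger_seminorms ::
    "('v, 'e) pre_digraph \<Rightarrow> (('v, 'e, complex) graph_free \<Rightarrow> real) set" where
  "cuntz_krieger_seminorms E =
     {\<rho>. cstar_seminorm (free_star_algebra E) \<rho> \<and> (\<forall>x \<in> cuntz_krieger_relations E. \<rho> x = 0)}"


lemma carrier_free_star_algebra [simp]:
  "carrier (free_star_algebra E) = carrier (free_algebra (graph_gens E))"
  by (simp add: free_star_algebra_def nu_algebra.defs)

lemma free_star_algebra_simps [simp]:
  "alg_zero (free_star_algebra E) = 0"
  "alg_add (free_star_algebra E) = (+)"
  "alg_mult (free_star_algebra E) = (*)"
  "alg_scale (free_star_algebra E) c a = Poly_Mapping.single 0 c * a"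
  "alg_star (free_star_algebra E) = star_free"
  by (simp_all add: free_star_algebra_def nu_algebra.defs free_algebra_def)

lemma in_carrier_free_algebra:
  "a \<in> carrier (free_algebra X) \<longleftrightarrow> (\<forall>w \<in> Poly_Mapping.keys a. w \<noteq> 0 \<and> set (letters w) \<subseteq> X)"
  by (simp add: free_algebra_def)

lemma zero_in_carrier: "0 \<in> carrier (free_algebra X)"
  by (simp add: in_carrier_free_algebra)

lemma add_in_carrier:
  assumes "a \<in> carrier (free_algebra X)" "b \<in> carrier (free_algebra X)"
  shows "a + b \<in> carrier (free_algebra X)"
  using assms Poly_Mapping.keys_add[of a b] unfolding in_carrier_free_algebra by blast

lemma diff_in_carrier:
  assumes "a \<in> carrier (free_algebra X)" "b \<in> carrier (free_algebra X)"
  shows "a - b \<in> carrier (free_algebra X)"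
  using assms Poly_Mapping.keys_diff[of a b] unfolding in_carrier_free_algebra by blast

lemma mult_in_carrier:
  assumes "a \<in> carrier (free_algebra X)" "b \<in> carrier (free_algebra X)"
  shows "a * b \<in> carrier (free_algebra X)"
  unfolding in_carrier_free_algebra
proof
  fix w assume "w \<in> Poly_Mapping.keys (a * b)"
  then obtain u v where "w = u + v" "u \<in> Poly_Mapping.keys a" "v \<in> Poly_Mapping.keys b"
    using Poly_Mapping.keys_mult[of a b] by blast
  with assms show "w \<noteq> 0 \<and> set (letters w) \<subseteq> X"
    unfolding in_carrier_free_algebra
    by (cases u; cases v) (fastforce simp: zero_free_monoid_def plus_free_monoid_def)
qed

lemma sum_in_carrier:
  "(\<And>i. i \<in> I \<Longrightarrow> f i \<in> carrier (free_algebra X)) \<Longrightarrow> sum f I \<in> carrier (free_algebra X)"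
  by (induction I rule: infinite_finite_induct) (auto simp: zero_in_carrier add_in_carrier)

lemma single_in_carrier:
  "w \<noteq> 0 \<Longrightarrow> set (letters w) \<subseteq> X \<Longrightarrow> Poly_Mapping.single w c \<in> carrier (free_algebra X)"
  by (simp add: in_carrier_free_algebra)

lemma gen_in_carrier:
  "v \<in> verts E \<Longrightarrow> gen_p v \<in> carrier (free_algebra (graph_gens E))"
  "e \<in> arcs E \<Longrightarrow> gen_s e \<in> carrier (free_algebra (graph_gens E))"
  "e \<in> arcs E \<Longrightarrow> gen_s_star e \<in> carrier (free_algebra (graph_gens E))"
  by (auto simp: gen_p_def gen_s_def gen_s_star_def graph_gens_def zero_free_monoid_def
      intro!: single_in_carrier)

lemma leavitt_relations_in_carrier:
  assumes "wf_digraph E"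
  shows "leavitt_relations E \<subseteq> carrier (free_algebra (graph_gens E))"
  using assms unfolding leavitt_relations_def regular_vertex_def out_arcs_def
  by (auto simp: wf_digraph.tail_in_verts wf_digraph.head_in_verts
      intro!: diff_in_carrier mult_in_carrier gen_in_carrier sum_in_carrier zero_in_carrier)

lemma cuntz_krieger_relations_in_carrier:
  assumes "wf_digraph E"
  shows "cuntz_krieger_relations E \<subseteq> carrier (free_algebra (graph_gens E))"
  using assms unfolding cuntz_krieger_relations_def regular_vertex_def out_arcs_def
  by (auto simp: wf_digraph.tail_in_verts wf_digraph.head_in_verts
      intro!: diff_in_carrier mult_in_carrier gen_in_carrier sum_in_carrier zero_in_carrier)

lemma star_free_single: "star_free (Poly_Mapping.single w c) = Poly_Mapping.single (star_word w) (cnj c)"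
  by (simp add: star_free_def)

lemma zero_in_cuntz_krieger_seminorms: "(\<lambda>_. 0) \<in> cuntz_krieger_seminorms E"
  by (simp add: cuntz_krieger_seminorms_def cstar_seminorm_def)

lemma single_word_bounded:
  fixes E :: "('v, 'e) pre_digraph"
  assumes E: "wf_digraph E" and \<rho>: "\<rho> \<in> cuntz_krieger_seminorms E"
    and "xs \<noteq> []" "set xs \<subseteq> graph_gens E"
  shows "\<rho> (Poly_Mapping.single (Word xs) 1) \<le> 1"
proof -
  let ?F = "carrier (free_algebra (graph_gens E))"
  have sn: "cstar_seminorm (free_star_algebra E) \<rho>"
    and rel: "\<And>x. x \<in> cuntz_krieger_relations E \<Longrightarrow> \<rho> x = 0"
    using \<rho> by (auto simp: cuntz_krieger_seminorms_def)
  have pos: "\<And>a. a \<in> ?F \<Longrightarrow> 0 \<le> \<rho> a"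
    and add: "\<And>a b. a \<in> ?F \<Longrightarrow> b \<in> ?F \<Longrightarrow> \<rho> (a + b) \<le> \<rho> a + \<rho> b"
    and mult: "\<And>a b. a \<in> ?F \<Longrightarrow> b \<in> ?F \<Longrightarrow> \<rho> (a * b) \<le> \<rho> a * \<rho> b"
    and star: "\<And>a. a \<in> ?F \<Longrightarrow> \<rho> (star_free a * a) = (\<rho> a)\<^sup>2"
    using sn by (auto simp: cstar_seminorm_def)
  have le: "\<rho> a \<le> \<rho> b" if "a - b \<in> cuntz_krieger_relations E" "b \<in> ?F" for a b
    using add[of "a - b" b] rel[OF that(1)] that cuntz_krieger_relations_in_carrier[OF E] by auto
  have gen:
    "v \<in> verts E \<Longrightarrow> (gen_p v :: ('v, 'e, complex) graph_free) \<in> ?F"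
    "e \<in> arcs E \<Longrightarrow> (gen_s e :: ('v, 'e, complex) graph_free) \<in> ?F"
    "e \<in> arcs E \<Longrightarrow> (gen_s_star e :: ('v, 'e, complex) graph_free) \<in> ?F" for v e
    by (simp_all add: gen_in_carrier)
  have p: "\<rho> (gen_p v) \<le> 1" if v: "v \<in> verts E" for v
  proof -
    have "gen_p v * gen_p v - gen_p v \<in> cuntz_krieger_relations E"
      using v unfolding cuntz_krieger_relations_def by (intro UnI1) auto
    then have "\<rho> (gen_p v * gen_p v) \<le> \<rho> (gen_p v)"
      by (rule le) (rule gen(1)[OF v])
    moreover have "star_free (gen_p v :: ('v, 'e, complex) graph_free) = gen_p v"
      by (simp add: gen_p_def star_free_single star_word_def)
    ultimately have "(\<rho> (gen_p v))\<^sup>2 \<le> \<rho> (gen_p v)"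
      using star[OF gen(1)[OF v]] by simp
    then show ?thesis
      using pos[OF gen(1)[OF v]] by (cases "\<rho> (gen_p v) = 0") (auto simp: power2_eq_square)
  qed
  have s: "\<rho> (gen_s e) \<le> 1" if e: "e \<in> arcs E" for e
  proof -
    have r: "head E e \<in> verts E" using E e by (simp add: wf_digraph.head_in_verts)
    have "gen_s_star e * gen_s e - gen_p (head E e) \<in> cuntz_krieger_relations E"
      using e unfolding cuntz_krieger_relations_def by blast
    then have "\<rho> (gen_s_star e * gen_s e) \<le> \<rho> (gen_p (head E e))"
      by (rule le) (rule gen(1)[OF r])
    moreover have "star_free (gen_s e :: ('v, 'e, complex) graph_free) = gen_s_star e"
      by (simp add: gen_s_def gen_s_star_def star_free_single star_word_def)
    ultimately have "(\<rho> (gen_s e))\<^sup>2 \<le> 1"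
      using star[OF gen(2)[OF e]] p[OF r] by simp
    then show ?thesis by (simp add: power2_le_iff_abs_le abs_square_le_1)
  qed
  have t: "\<rho> (gen_s_star e) \<le> 1" if e: "e \<in> arcs E" for e
  proof -
    have "star_free (gen_s_star e :: ('v, 'e, complex) graph_free) = gen_s e"
      by (simp add: gen_s_def gen_s_star_def star_free_single star_word_def)
    then have "(\<rho> (gen_s_star e))\<^sup>2 \<le> \<rho> (gen_s e) * \<rho> (gen_s_star e)"
      using star[OF gen(3)[OF e]] mult[OF gen(2,3)[OF e]] by simp
    then show ?thesis
      using pos[OF gen(3)[OF e]] s[OF e]
      by (cases "\<rho> (gen_s_star e) = 0") (auto simp: power2_eq_square)
  qed
  have letter: "\<rho> (Poly_Mapping.single (Word [x]) 1) \<le> 1" if "x \<in> graph_gens E" for x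
    using that p s t by (auto simp: graph_gens_def gen_p_def gen_s_def gen_s_star_def)
  show ?thesis
    using assms(3,4)
  proof (induction xs rule: list_nonempty_induct)
    case (single x)
    then show ?case by (simp add: letter)
  next
    case (cons x xs)
    let ?a = "Poly_Mapping.single (Word [x]) (1::complex)"
      and ?b = "Poly_Mapping.single (Word xs) (1::complex)"
    have ab: "?a \<in> ?F" "?b \<in> ?F"
      using cons by (auto intro!: single_in_carrier simp: zero_free_monoid_def)
    have "Poly_Mapping.single (Word (x # xs)) 1 = ?a * ?b"
      by (simp add: Poly_Mapping.mult_single plus_free_monoid_def)
    then have "\<rho> (Poly_Mapping.single (Word (x # xs)) 1) \<le> \<rho> ?a * \<rho> ?b"
      using mult[OF ab] by simp
    also have "\<dots> \<le> 1"
      using letter[of x] cons pos[OF ab(1)] pos[OF ab(2)] by (simp add: mult_le_one)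
    finally show ?case .
  qed
qed

lemma cuntz_krieger_seminorms_bounded:
  assumes "wf_digraph E" and "a \<in> carrier (free_algebra (graph_gens E))"
  shows "bdd_above ((\<lambda>\<rho>. \<rho> a) ` cuntz_krieger_seminorms E)"
proof (rule bdd_aboveI2)
  fix \<rho> assume \<rho>: "\<rho> \<in> cuntz_krieger_seminorms E"
  let ?F = "carrier (free_algebra (graph_gens E))"
  have sn: "cstar_seminorm (free_star_algebra E) \<rho>"
    using \<rho> by (simp add: cuntz_krieger_seminorms_def)
  have add: "\<And>a b. a \<in> ?F \<Longrightarrow> b \<in> ?F \<Longrightarrow> \<rho> (a + b) \<le> \<rho> a + \<rho> b"
    and scale: "\<And>c a. a \<in> ?F \<Longrightarrow> \<rho> (Poly_Mapping.single 0 c * a) = cmod c * \<rho> a"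
    using sn by (auto simp: cstar_seminorm_def)
  have zero: "\<rho> 0 = 0"
    using scale[OF zero_in_carrier, of 0] by simp
  have w: "Poly_Mapping.single w c \<in> ?F" "\<rho> (Poly_Mapping.single w c) \<le> cmod c"
    if "w \<in> Poly_Mapping.keys a" for w c
  proof -
    obtain xs where xs: "w = Word xs" by (cases w)
    have *: "xs \<noteq> []" "set xs \<subseteq> graph_gens E"
      using that assms(2) xs by (fastforce simp: in_carrier_free_algebra zero_free_monoid_def)+
    have in_F: "Poly_Mapping.single w d \<in> ?F" for d
      using * xs by (auto intro!: single_in_carrier simp: zero_free_monoid_def)
    then show "Poly_Mapping.single w c \<in> ?F" .
    have "Poly_Mapping.single w c = Poly_Mapping.single 0 c * Poly_Mapping.single w 1"
      by (simp add: Poly_Mapping.mult_single)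
    then have "\<rho> (Poly_Mapping.single w c) = cmod c * \<rho> (Poly_Mapping.single w 1)"
      using scale[OF in_F] by metis
    then show "\<rho> (Poly_Mapping.single w c) \<le> cmod c"
      using single_word_bounded[OF assms(1) \<rho> *] xs by (simp add: mult_left_le)
  qed
  have *: "\<rho> (\<Sum>w\<in>S. Poly_Mapping.single w (Poly_Mapping.lookup a w)) \<le> (\<Sum>w\<in>S. cmod (Poly_Mapping.lookup a w))"
    if "finite S" "S \<subseteq> Poly_Mapping.keys a" for S
    using that
  proof (induction S)
    case empty
    then show ?case by (simp add: zero)
  next
    case (insert u S)
    have "(\<Sum>w\<in>S. Poly_Mapping.single w (Poly_Mapping.lookup a w)) \<in> ?F"
      using insert.prems by (intro sum_in_carrier w) auto
    then show ?case
      using insert add[OF w(1)[of u "Poly_Mapping.lookup a u"]] w(2)[of u "Poly_Mapping.lookup a u"]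
      by (smt (verit) insert_subset sum.insert)
  qed
  have "a = (\<Sum>w\<in>Poly_Mapping.keys a. Poly_Mapping.single w (Poly_Mapping.lookup a w))"
    by (rule poly_mapping_eqI)
      (auto simp: Poly_Mapping.lookup_sum Poly_Mapping.lookup_single when_def in_keys_iff)
  then show "\<rho> a \<le> (\<Sum>w\<in>Poly_Mapping.keys a. cmod (Poly_Mapping.lookup a w))"
    using *[OF Poly_Mapping.finite_keys subset_refl] by simp
qed

text \<open>
  A C*-seminorm that kills the relations is the same thing as (the norm pulled back from) a
  C*-algebra generated by a Cuntz-Krieger $E$-family, namely the Hausdorff completion. So the
  seminorm below is the supremum of $\|\pi(a)\|$ over all Cuntz-Krieger $E$-families, and its
  Hausdorff completion is the universal C*-algebra. The supremum is over a nonempty set that is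
  bounded above (\<open>cuntz_krieger_seminorms_bounded\<close>) and is itself a member of that set
  (\<open>universal_seminorm_in_cuntz_krieger_seminorms\<close>).
\<close>

definition universal_seminorm ::
    "('v, 'e) pre_digraph \<Rightarrow> ('v, 'e, complex) graph_free \<Rightarrow> real" where
  "universal_seminorm E a = (SUP \<rho> \<in> cuntz_krieger_seminorms E. \<rho> a)"

lemma star_free_in_carrier:
  assumes "a \<in> carrier (free_algebra (graph_gens E))"
  shows "star_free a \<in> carrier (free_algebra (graph_gens E))"
proof -
  have "star_word w \<noteq> 0 \<and> set (letters (star_word w)) \<subseteq> graph_gens E" if "w \<in> Poly_Mapping.keys a" for w
  proof -
    have w: "w \<noteq> 0" "set (letters w) \<subseteq> graph_gens E"
      using assms that by (auto simp: in_carrier_free_algebra)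
    have "star_gen x \<in> graph_gens E" if "x \<in> graph_gens E" for x
      using that by (cases x) (auto simp: graph_gens_def)
    then show ?thesis
      using w by (cases w) (auto simp: star_word_def zero_free_monoid_def)
  qed
  then show ?thesis
    unfolding star_free_def by (intro sum_in_carrier single_in_carrier) auto
qed

lemma universal_seminorm_upper:
  assumes "wf_digraph E" "a \<in> carrier (free_algebra (graph_gens E))" "\<rho> \<in> cuntz_krieger_seminorms E"
  shows "\<rho> a \<le> universal_seminorm E a"
  unfolding universal_seminorm_def
  using cuntz_krieger_seminorms_bounded[OF assms(1,2)] assms(3) by (rule cSUP_upper2) simp

lemma universal_seminorm_least:
  assumes "\<And>\<rho>. \<rho> \<in> cuntz_krieger_seminorms E \<Longrightarrow> \<rho> a \<le> c"
  shows "universal_seminorm E a \<le> c"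
  unfolding universal_seminorm_def
  using zero_in_cuntz_krieger_seminorms assms by (intro cSUP_least) auto

lemma universal_seminorm_in_cuntz_krieger_seminorms:
  assumes E: "wf_digraph E"
  shows "universal_seminorm E \<in> cuntz_krieger_seminorms E"
proof -
  let ?F = "carrier (free_algebra (graph_gens E)) :: ('a, 'b, complex) graph_free set"
  let ?N = "universal_seminorm E"
  have sn: "cstar_seminorm (free_star_algebra E) \<rho>" if "\<rho> \<in> cuntz_krieger_seminorms E" for \<rho>
    using that by (simp add: cuntz_krieger_seminorms_def)
  note up = universal_seminorm_upper[OF E] and least = universal_seminorm_least
  have pos: "0 \<le> ?N a" if "a \<in> ?F" for a
    using up[OF that zero_in_cuntz_krieger_seminorms] .
  have scale_in: "Poly_Mapping.single 0 c * a \<in> ?F" if "a \<in> ?F" for c a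
    unfolding in_carrier_free_algebra
  proof
    fix w assume "w \<in> Poly_Mapping.keys (Poly_Mapping.single 0 c * a)"
    then have "w \<in> Poly_Mapping.keys a"
      using Poly_Mapping.keys_mult[of "Poly_Mapping.single 0 c" a] by (auto split: if_splits)
    then show "w \<noteq> 0 \<and> set (letters w) \<subseteq> graph_gens E"
      using that by (auto simp: in_carrier_free_algebra)
  qed
  have add: "?N (a + b) \<le> ?N a + ?N b" if "a \<in> ?F" "b \<in> ?F" for a b
  proof (rule least)
    fix \<rho> assume \<rho>: "\<rho> \<in> cuntz_krieger_seminorms E"
    have "\<rho> (a + b) \<le> \<rho> a + \<rho> b"
      using sn[OF \<rho>] that by (simp add: cstar_seminorm_def)
    then show "\<rho> (a + b) \<le> ?N a + ?N b"
      using up[OF that(1) \<rho>] up[OF that(2) \<rho>] by linarith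
  qed
  have mult: "?N (a * b) \<le> ?N a * ?N b" if "a \<in> ?F" "b \<in> ?F" for a b
  proof (rule least)
    fix \<rho> assume \<rho>: "\<rho> \<in> cuntz_krieger_seminorms E"
    have "\<rho> (a * b) \<le> \<rho> a * \<rho> b" "0 \<le> \<rho> b"
      using sn[OF \<rho>] that by (auto simp: cstar_seminorm_def)
    then show "\<rho> (a * b) \<le> ?N a * ?N b"
      using mult_mono[OF up[OF that(1) \<rho>] up[OF that(2) \<rho>]] pos[OF that(1)] by linarith
  qed
  have scale: "?N (Poly_Mapping.single 0 c * a) = cmod c * ?N a" if "a \<in> ?F" for c a
  proof (rule antisym)
    have eq: "\<rho> (Poly_Mapping.single 0 c * a) = cmod c * \<rho> a" if "\<rho> \<in> cuntz_krieger_seminorms E" for \<rho>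
      using sn[OF that] \<open>a \<in> ?F\<close> by (simp add: cstar_seminorm_def)
    show "?N (Poly_Mapping.single 0 c * a) \<le> cmod c * ?N a"
      by (rule least) (simp add: eq up that mult_left_mono)
    show "cmod c * ?N a \<le> ?N (Poly_Mapping.single 0 c * a)"
    proof (cases "c = 0")
      case True
      then show ?thesis using pos[OF zero_in_carrier] by simp
    next
      case False
      have "?N a \<le> ?N (Poly_Mapping.single 0 c * a) / cmod c"
      proof (rule least)
        fix \<rho> assume "\<rho> \<in> cuntz_krieger_seminorms E"
        then show "\<rho> a \<le> ?N (Poly_Mapping.single 0 c * a) / cmod c"
          using up[OF scale_in[OF that], of \<rho> c] False by (simp add: eq field_simps)
      qed
      then show ?thesis using False by (simp add: field_simps)
    qed
  qed
  have star: "?N (star_free a * a) = (?N a)\<^sup>2" if "a \<in> ?F" for a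
  proof (rule antisym)
    have eq: "\<rho> (star_free a * a) = (\<rho> a)\<^sup>2" "0 \<le> \<rho> a" if "\<rho> \<in> cuntz_krieger_seminorms E" for \<rho>
      using sn[OF that] \<open>a \<in> ?F\<close> by (simp_all add: cstar_seminorm_def)
    have saa: "star_free a * a \<in> ?F"
      using that by (intro mult_in_carrier star_free_in_carrier)
    show "?N (star_free a * a) \<le> (?N a)\<^sup>2"
      by (rule least) (simp add: eq up that power_mono)
    have "?N a \<le> sqrt (?N (star_free a * a))"
    proof (rule least)
      fix \<rho> assume \<rho>: "\<rho> \<in> cuntz_krieger_seminorms E"
      then show "\<rho> a \<le> sqrt (?N (star_free a * a))"
        using up[OF saa \<rho>] by (simp add: eq real_le_rsqrt)
    qed
    then show "(?N a)\<^sup>2 \<le> ?N (star_free a * a)"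
      using pos[OF that] pos[OF saa] by (metis power_mono real_sqrt_pow2)
  qed
  have rel: "?N x = 0" if "x \<in> cuntz_krieger_relations E" for x
  proof (rule antisym)
    show "?N x \<le> 0"
      using that by (intro least) (simp add: cuntz_krieger_seminorms_def)
    show "0 \<le> ?N x"
      using that cuntz_krieger_relations_in_carrier[OF E] by (intro pos) auto
  qed
  show ?thesis
    by (simp add: cuntz_krieger_seminorms_def cstar_seminorm_def pos add mult scale star rel)
qed

definition cauchy_algebra ::
    "('v, 'e) pre_digraph \<Rightarrow> (complex, nat \<Rightarrow> ('v, 'e, complex) graph_free) star_algebra" where
  "cauchy_algebra E =
    (let F = free_star_algebra E in
    \<lparr> carrier = {X. (\<forall>n. X n \<in> carrier F) \<and>
         (\<forall>\<epsilon> > 0. \<exists>N. \<forall>m \<ge> N. \<forall>n \<ge> N. universal_seminorm E (X m - X n) < \<epsilon>)},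
      alg_zero = (\<lambda>n. alg_zero F),
      alg_add = (\<lambda>X Y n. alg_add F (X n) (Y n)),
      alg_mult = (\<lambda>X Y n. alg_mult F (X n) (Y n)),
      alg_scale = (\<lambda>c X n. alg_scale F c (X n)),
      alg_star = (\<lambda>X n. alg_star F (X n)) \<rparr>)"

definition null_sequences ::
    "('v, 'e) pre_digraph \<Rightarrow> (nat \<Rightarrow> ('v, 'e, complex) graph_free) set" where
  "null_sequences E =
     {X \<in> carrier (cauchy_algebra E). (\<lambda>n. universal_seminorm E (X n)) \<longlonglongrightarrow> 0}"

definition graph_cstar_algebra ::
    "('v, 'e) pre_digraph \<Rightarrow>
     (complex, (nat \<Rightarrow> ('v, 'e, complex) graph_free) set) normed_star_algebra" where
  "graph_cstar_algebra E =
    (let C = cauchy_algebra E; N = null_sequences E in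
     nu_algebra.extend (quotient_algebra C N)
      \<lparr> alg_star = (\<lambda>X. \<Union>x \<in> X. alg_coset C N (alg_star C x)),
        alg_norm = (\<lambda>X. THE r. \<forall>x \<in> X. (\<lambda>n. universal_seminorm E (x n)) \<longlonglongrightarrow> r) \<rparr>)"

end

theory Submission
  imports Defs "HOL-Analysis.L2_Norm" "HOL-Library.Function_Algebras" "HOL-Library.Sublist"
begin

text \<open>
  Necessity: in a finite-dimensional representation, infinitely many paths with common range \<open>w\<close>,
  none a prefix of another, give infinitely many matrices with $A_i B_j = \delta_{ij} p_w$, which forces
  $p_w = 0$; an infinite receiver, a cycle with an exit and an infinite backward chain each provide such
  paths. If \<open>v\<close> reaches no sink, cycle or infinite emitter, the relation at regular vertices
  produces infinitely many distinct vertices with nonzero projections as soon as $p_v \neq 0$. On the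
  other hand $p_v \neq 0$ in both algebras, because both act on functions of boundary paths.

  Sufficiency: a partial action of the graph on a set gives representations of both algebras. The paths
  ending at a non-regular vertex \<open>w\<close>, or the paths ending at a vertex \<open>w\<close> on a cycle \<open>c\<close> modulo
  $\mu c^k \sim \mu$, form finite sets under the graph conditions. Every element of the algebra is a
  combination of finitely many normal forms, each of whose coefficients is a matrix coefficient of one of
  these finite actions, so they separate the Leavitt path algebra. Moreover the number of normal forms
  of level \<open>M\<close> over a fixed finite set of edges is polynomial in \<open>M\<close>. A spectral radius argument
  then shows that these finite-dimensional representations compute the universal C*-seminorm.
\<close>

section \<open>Linear extension of functions on a basis\<close>

text \<open>The universal seminorm is a bare supremum without a concrete model. Lower bounds for it
  come from operator norms on finitely supported functions; the upper bound comes from adding up the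
  norms of the terms of a normal form, which loses a factor equal to the number of terms. For high
  powers this loss is harmless because the count is quadratic in the word length, and that is where
  the absence of exits enters: after its first repeated edge a path is determined by its length
  alone, so a finite set of edges carries boundedly many paths of each length.

  Two obstacles shape the normal forms. If a vertex emits infinitely many edges, or some edge
  outside the finite set F, words ending there cannot all be pushed to a common level; the
  projections p_w minus the sum of s_e s_e^* over F are what remains, and they are tested on paths
  that stop at w or leave F. And a closed path d acts on a finite set only by wrapping around, so a
  word is seen faithfully only while it is shorter than d; hence d is a power of a cycle chosen
  after the length bound M.\<close>

definition lin_ext :: "('m \<Rightarrow> 'k::field) \<Rightarrow> ('m \<Rightarrow>\<^sub>0 'k) \<Rightarrow> 'k" where
  "lin_ext \<phi> a = (\<Sum>w\<in>Poly_Mapping.keys a. Poly_Mapping.lookup a w * \<phi> w)"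

lemma lin_ext_superset:
  "finite S \<Longrightarrow> Poly_Mapping.keys a \<subseteq> S \<Longrightarrow> lin_ext \<phi> a = (\<Sum>w\<in>S. Poly_Mapping.lookup a w * \<phi> w)"
  unfolding lin_ext_def by (rule sum.mono_neutral_left) (auto simp: in_keys_iff)

lemma lin_ext_zero [simp]: "lin_ext \<phi> 0 = 0"
  by (simp add: lin_ext_def)

lemma lin_ext_add: "lin_ext \<phi> (a + b) = lin_ext \<phi> a + lin_ext \<phi> b"
proof -
  let ?S = "Poly_Mapping.keys a \<union> Poly_Mapping.keys b"
  have "Poly_Mapping.keys (a + b) \<subseteq> ?S" by (rule Poly_Mapping.keys_add)
  then show ?thesis
    by (simp add: lin_ext_superset[of ?S] lookup_add distrib_right sum.distrib)
qed

lemma lin_ext_single [simp]: "lin_ext \<phi> (Poly_Mapping.single w c) = c * \<phi> w"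
  by (simp add: lin_ext_def)

lemma lin_ext_sum: "lin_ext \<phi> (\<Sum>i\<in>I. a i) = (\<Sum>i\<in>I. lin_ext \<phi> (a i))"
  by (induction I rule: infinite_finite_induct) (simp_all add: lin_ext_add)

lemma lin_ext_uminus: "lin_ext \<phi> (- a) = - lin_ext \<phi> a"
  using lin_ext_add[of \<phi> a "- a"] by (simp add: eq_neg_iff_add_eq_0 add.commute)

lemma lin_ext_diff: "lin_ext \<phi> (a - b) = lin_ext \<phi> a - lin_ext \<phi> b"
  using lin_ext_add[of \<phi> a "- b"] by (simp add: lin_ext_uminus)

lemma lin_ext_fun_mult: "lin_ext (\<lambda>w. c * \<phi> w) a = c * lin_ext \<phi> a"
  by (simp add: lin_ext_def sum_distrib_left mult_ac)

lemma lin_ext_fun_sum: "lin_ext (\<lambda>w. \<Sum>i\<in>I. \<phi> i w) a = (\<Sum>i\<in>I. lin_ext (\<phi> i) a)"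
  unfolding lin_ext_def by (simp add: sum_distrib_left) (rule sum.swap)

lemma poly_mapping_sum_single:
  fixes a :: "'m \<Rightarrow>\<^sub>0 'k::comm_monoid_add"
  shows "(\<Sum>w\<in>Poly_Mapping.keys a. Poly_Mapping.single w (Poly_Mapping.lookup a w)) = a"
  by (rule poly_mapping_eqI)
    (auto simp: Poly_Mapping.lookup_sum Poly_Mapping.lookup_single when_def in_keys_iff)

lemma poly_mapping_single_induct [case_names single add]:
  fixes a :: "'m \<Rightarrow>\<^sub>0 'k::comm_monoid_add"
  assumes "\<And>w c. P (Poly_Mapping.single w c)" and "\<And>a b. P a \<Longrightarrow> P b \<Longrightarrow> P (a + b)"
  shows "P a"
proof -
  have "P (\<Sum>w\<in>S. Poly_Mapping.single w (Poly_Mapping.lookup a w))" for S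
  proof (induction S rule: infinite_finite_induct)
    case (infinite S)
    then show ?case using assms(1)[of undefined 0] by simp
  next
    case empty
    then show ?case using assms(1)[of undefined 0] by simp
  next
    case (insert x F)
    then show ?case by (simp add: assms)
  qed
  then show ?thesis by (metis poly_mapping_sum_single)
qed

lemma lin_ext_mult:
  fixes a b :: "'m::monoid_add \<Rightarrow>\<^sub>0 'k::field"
  shows "lin_ext \<phi> (a * b) = lin_ext (\<lambda>u. lin_ext (\<lambda>v. \<phi> (u + v)) b) a"
proof (induction a rule: poly_mapping_single_induct)
  case (single u c)
  show ?case
  proof (induction b rule: poly_mapping_single_induct)
    case (single v d)
    then show ?case by (simp add: Poly_Mapping.mult_single)
  next
    case (add a b)
    then show ?case by (simp add: distrib_left lin_ext_add)
  qed
next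
  case (add a a')
  then show ?case by (simp add: distrib_right lin_ext_add)
qed

lemma lin_ext_scale:
  fixes a :: "'m::monoid_add \<Rightarrow>\<^sub>0 'k::field"
  shows "lin_ext \<phi> (Poly_Mapping.single 0 c * a) = c * lin_ext \<phi> a"
  by (simp add: lin_ext_mult)


section \<open>Scalars in the free algebra\<close>

lemma single_zero_minus_one [simp]:
  "Poly_Mapping.single (0::'m::monoid_add) (- 1::'k::field) * a = - a"
  unfolding single_uminus single_one by simp

lemma scale_in_carrier:
  assumes "a \<in> carrier (free_algebra X)"
  shows "Poly_Mapping.single 0 c * a \<in> carrier (free_algebra X)"
  unfolding in_carrier_free_algebra
proof
  fix w assume "w \<in> Poly_Mapping.keys (Poly_Mapping.single 0 c * a)"
  then have "w \<in> Poly_Mapping.keys a"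
    using Poly_Mapping.keys_mult[of "Poly_Mapping.single 0 c" a] by (auto split: if_splits)
  then show "w \<noteq> 0 \<and> set (letters w) \<subseteq> X"
    using assms by (auto simp: in_carrier_free_algebra)
qed

lemma uminus_in_carrier: "a \<in> carrier (free_algebra X) \<Longrightarrow> - a \<in> carrier (free_algebra X)"
  by (simp add: in_carrier_free_algebra)

lemma free_algebra_simps [simp]:
  "alg_zero (free_algebra X) = 0"
  "alg_add (free_algebra X) = (+)"
  "alg_mult (free_algebra X) = (*)"
  "alg_scale (free_algebra X) c a = Poly_Mapping.single 0 c * a"
  by (simp_all add: free_algebra_def)

section \<open>The involution on the free algebra\<close>

lemma star_gen_star_gen [simp]: "star_gen (star_gen x) = x"
  by (cases x) auto

lemma star_word_star_word [simp]: "star_word (star_word w) = w"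
  by (cases w) (simp add: star_word_def rev_map comp_def)

lemma star_word_add: "star_word (u + w) = star_word w + star_word u"
  by (simp add: star_word_def plus_free_monoid_def)

lemma star_word_eq_iff: "star_word u = w \<longleftrightarrow> u = star_word w"
  by auto

lemma lookup_star_free: "Poly_Mapping.lookup (star_free a) w = cnj (Poly_Mapping.lookup a (star_word w))"
  by (auto simp: star_free_def Poly_Mapping.lookup_sum Poly_Mapping.lookup_single when_def star_word_eq_iff
      in_keys_iff)

lemma star_free_add: "star_free (a + b) = star_free a + star_free b"
  by (rule poly_mapping_eqI) (simp add: lookup_star_free lookup_add)

lemma star_free_diff: "star_free (a - b) = star_free a - star_free b"
  by (rule poly_mapping_eqI) (simp add: lookup_star_free lookup_minus)

lemma star_free_star_free [simp]: "star_free (star_free a) = a"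
  by (rule poly_mapping_eqI) (simp add: lookup_star_free)

lemma star_free_mult: "star_free (a * b) = star_free b * star_free a"
proof (induction a rule: poly_mapping_single_induct)
  case (single u c)
  show ?case
  proof (induction b rule: poly_mapping_single_induct)
    case (single v d)
    then show ?case by (simp add: Poly_Mapping.mult_single star_free_single star_word_add mult.commute)
  next
    case (add a b)
    then show ?case by (simp add: distrib_left distrib_right star_free_add)
  qed
next
  case (add a a')
  then show ?case by (simp add: distrib_left distrib_right star_free_add)
qed

lemma lin_ext_star_free:
  "lin_ext \<phi> (star_free a) = cnj (lin_ext (\<lambda>w. cnj (\<phi> (star_word w))) a)"
  by (induction a rule: poly_mapping_single_induct)
    (simp_all add: star_free_single star_free_add lin_ext_add)

section \<open>Quotients of algebras\<close>

text \<open>The record operations are identified with those of the ring class, so that cosets can be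
  handled by ordinary ring rewriting. The type is an arbitrary ring because the locale is
  instantiated both with the free algebra and with sequences in it under pointwise
  operations.\<close>

locale quotient_alg =
  fixes A :: "('k::field, 'a::ring, 'm) nu_algebra_scheme" and I :: "'a set"
  assumes zero: "alg_zero A = 0"
    and add: "alg_add A = (+)"
    and mult: "alg_mult A = (*)"
    and ideal: "algebra_ideal A I"
    and zero_closed: "0 \<in> carrier A"
    and add_closed: "x \<in> carrier A \<Longrightarrow> y \<in> carrier A \<Longrightarrow> x + y \<in> carrier A"
    and mult_closed: "x \<in> carrier A \<Longrightarrow> y \<in> carrier A \<Longrightarrow> x * y \<in> carrier A"
    and scale_closed: "x \<in> carrier A \<Longrightarrow> alg_scale A c x \<in> carrier A"
    and scale_diff: "alg_scale A c (x - y) = alg_scale A c x - alg_scale A c y"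
    and scale_minus_one: "alg_scale A (- 1) x = - x"
begin

lemma uminus_closed: "x \<in> carrier A \<Longrightarrow> - x \<in> carrier A"
  using scale_closed[of x "- 1"] by (simp add: scale_minus_one)

lemma diff_closed: "x \<in> carrier A \<Longrightarrow> y \<in> carrier A \<Longrightarrow> x - y \<in> carrier A"
  using add_closed[of x "- y"] by (simp add: uminus_closed)

lemma
  shows I_carrier: "x \<in> I \<Longrightarrow> x \<in> carrier A"
    and I_zero: "0 \<in> I"
    and I_add: "x \<in> I \<Longrightarrow> y \<in> I \<Longrightarrow> x + y \<in> I"
    and I_scale: "x \<in> I \<Longrightarrow> alg_scale A c x \<in> I"
    and I_mult_left: "a \<in> carrier A \<Longrightarrow> x \<in> I \<Longrightarrow> a * x \<in> I"
    and I_mult_right: "a \<in> carrier A \<Longrightarrow> x \<in> I \<Longrightarrow> x * a \<in> I"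
  using ideal by (auto simp: algebra_ideal_def zero add mult)

lemma I_uminus: "x \<in> I \<Longrightarrow> - x \<in> I"
  using I_scale[of x "- 1"] by (simp add: scale_minus_one)

lemma I_diff: "x \<in> I \<Longrightarrow> y \<in> I \<Longrightarrow> x - y \<in> I"
  using I_add[of x "- y"] by (simp add: I_uminus)

lemma I_sum: "(\<And>i. i \<in> S \<Longrightarrow> f i \<in> I) \<Longrightarrow> sum f S \<in> I"
  by (induction S rule: infinite_finite_induct) (auto simp: I_zero I_add)

abbreviation "cs \<equiv> alg_coset A I"

lemma in_coset_iff: "y \<in> cs x \<longleftrightarrow> y - x \<in> I"
  by (auto simp: alg_coset_def add image_iff intro: bexI[of _ "y - x"])

lemma coset_self: "x \<in> cs x"
  by (simp add: in_coset_iff I_zero)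

lemma coset_eq_iff: "cs x = cs y \<longleftrightarrow> x - y \<in> I"
proof
  assume "cs x = cs y"
  then show "x - y \<in> I" using coset_self[of x] by (simp add: in_coset_iff)
next
  assume *: "x - y \<in> I"
  have "z - x \<in> I \<longleftrightarrow> z - y \<in> I" for z
    using I_add[of "z - x" "x - y"] I_diff[of "z - y" "x - y"] * by (auto simp: algebra_simps)
  then show "cs x = cs y" by (auto simp: in_coset_iff)
qed

lemma coset_carrier: "x \<in> carrier A \<Longrightarrow> y \<in> cs x \<Longrightarrow> y \<in> carrier A"
  using add_closed[of x "y - x"] I_carrier by (simp add: in_coset_iff)

text \<open>The quotient operations are unions over all representatives; once every representative
  gives the same coset, the union collapses because a coset is never empty.\<close>

lemma UN_coset:
  assumes "\<And>x'. x' \<in> cs x \<Longrightarrow> f x' - f x \<in> I"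
  shows "(\<Union>x'\<in>cs x. cs (f x')) = cs (f x)"
proof -
  have "cs (f x') = cs (f x)" if "x' \<in> cs x" for x'
    using assms[OF that] by (simp only: coset_eq_iff)
  moreover have "cs x \<noteq> {}" using coset_self[of x] by blast
  ultimately show ?thesis by (simp cong: SUP_cong)
qed

lemma UN_UN_coset:
  assumes "\<And>x' y'. x' \<in> cs x \<Longrightarrow> y' \<in> cs y \<Longrightarrow> f x' y' - f x y \<in> I"
  shows "(\<Union>x'\<in>cs x. \<Union>y'\<in>cs y. cs (f x' y')) = cs (f x y)"
proof -
  have "cs (f x' y') = cs (f x y)" if "x' \<in> cs x" "y' \<in> cs y" for x' y'
    using assms[OF that] by (simp only: coset_eq_iff)
  moreover have "cs x \<noteq> {}" "cs y \<noteq> {}" using coset_self by blast+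
  ultimately show ?thesis by (simp cong: SUP_cong)
qed

abbreviation "Q \<equiv> quotient_algebra A I"

lemma carrier_quotient: "carrier Q = cs ` carrier A"
  by (simp add: quotient_algebra_def)

lemma quotient_zero: "alg_zero Q = cs 0"
  by (simp add: quotient_algebra_def zero)

lemma quotient_add: "alg_add Q (cs x) (cs y) = cs (x + y)"
proof -
  have "(x' + y') - (x + y) \<in> I" if "x' \<in> cs x" "y' \<in> cs y" for x' y'
    using I_add[of "x' - x" "y' - y"] that by (simp add: in_coset_iff algebra_simps)
  then show ?thesis by (simp add: quotient_algebra_def add UN_UN_coset)
qed

lemma quotient_mult:
  assumes "x \<in> carrier A" "y \<in> carrier A"
  shows "alg_mult Q (cs x) (cs y) = cs (x * y)"
proof -
  have "x' * y' - x * y \<in> I" if "x' \<in> cs x" "y' \<in> cs y" for x' y'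
  proof -
    have "(x' - x) * y' + x * (y' - y) \<in> I"
      using that assms coset_carrier[OF assms(2) that(2)]
      by (intro I_add I_mult_left I_mult_right) (auto simp: in_coset_iff)
    then show ?thesis by (simp add: algebra_simps)
  qed
  then show ?thesis by (simp add: quotient_algebra_def mult UN_UN_coset)
qed

lemma quotient_scale: "alg_scale Q c (cs x) = cs (alg_scale A c x)"
proof -
  have "alg_scale A c x' - alg_scale A c x \<in> I" if "x' \<in> cs x" for x'
    using that I_scale[of "x' - x" c] by (simp add: in_coset_iff scale_diff)
  then show ?thesis by (simp add: quotient_algebra_def UN_coset)
qed

lemma fin_dim_rep_pullback:
  assumes "fin_dim_rep Q n \<pi>"
  shows "fin_dim_rep A n (\<lambda>x. \<pi> (cs x))" and "x \<in> I \<Longrightarrow> \<pi> (cs x) = 0\<^sub>m n n"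
proof -
  show "fin_dim_rep A n (\<lambda>x. \<pi> (cs x))"
    unfolding fin_dim_rep_def
  proof (intro conjI ballI allI)
    fix a b assume a: "a \<in> carrier A" and b: "b \<in> carrier A"
    have q: "cs a \<in> carrier Q" "cs b \<in> carrier Q"
      using a b by (auto simp: carrier_quotient)
    show "\<pi> (cs a) \<in> carrier_mat n n"
      using assms q by (simp add: fin_dim_rep_def)
    show "\<pi> (cs (alg_add A a b)) = \<pi> (cs a) + \<pi> (cs b)"
      using assms q unfolding fin_dim_rep_def by (metis quotient_add add)
    show "\<pi> (cs (alg_mult A a b)) = \<pi> (cs a) * \<pi> (cs b)"
      using assms q a b unfolding fin_dim_rep_def by (metis quotient_mult mult)
  next
    fix a c assume a: "a \<in> carrier A"
    then have q: "cs a \<in> carrier Q" by (auto simp: carrier_quotient)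
    show "\<pi> (cs (alg_scale A c a)) = c \<cdot>\<^sub>m \<pi> (cs a)"
      using assms q unfolding fin_dim_rep_def by (metis quotient_scale)
  qed
  assume x: "x \<in> I"
  have z: "cs 0 \<in> carrier Q" using zero_closed by (auto simp: carrier_quotient)
  have m: "\<pi> (cs 0) \<in> carrier_mat n n" using assms z by (simp add: fin_dim_rep_def)
  \<comment> \<open>Preservation of zero is not among the axioms of \<open>fin_dim_rep\<close>; it
    is extracted from 0 + 0 = 0, entry by entry.\<close>
  have "\<pi> (cs 0) = \<pi> (cs 0) + \<pi> (cs 0)"
    using assms z unfolding fin_dim_rep_def by (metis quotient_add add_0)
  then have "\<pi> (cs 0) $$ (i, j) = 0" if "i < n" "j < n" for i j
    using m that index_add_mat(1)[of i "\<pi> (cs 0)" j "\<pi> (cs 0)"]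
    by (metis add_cancel_right_right carrier_matD)
  then have "\<pi> (cs 0) = 0\<^sub>m n n"
    using m by (intro eq_matI) auto
  moreover have "cs x = cs 0" using x by (simp add: coset_eq_iff)
  ultimately show "\<pi> (cs x) = 0\<^sub>m n n" by simp
qed

definition coset_rep :: "'a set \<Rightarrow> 'a" where
  "coset_rep X = (SOME x. x \<in> X)"

lemma coset_rep: "coset_rep (cs x) - x \<in> I"
  unfolding coset_rep_def using someI[of "\<lambda>y. y \<in> cs x", OF coset_self] by (simp add: in_coset_iff)

lemma coset_rep_carrier: "x \<in> carrier A \<Longrightarrow> coset_rep (cs x) \<in> carrier A"
  using coset_rep[of x] coset_carrier by (simp add: in_coset_iff)

lemma fin_dim_rep_diff:
  assumes "fin_dim_rep A n \<phi>" "x \<in> carrier A" "y \<in> carrier A" "\<phi> (x - y) = 0\<^sub>m n n"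
  shows "\<phi> x = \<phi> y"
proof -
  have "\<phi> ((x - y) + y) = \<phi> (x - y) + \<phi> y"
    using assms diff_closed[of x y] unfolding fin_dim_rep_def add by blast
  then show ?thesis using assms by (simp add: fin_dim_rep_def)
qed

lemma fin_dim_rep_descend:
  assumes \<phi>: "fin_dim_rep A n \<phi>" and I: "\<And>x. x \<in> I \<Longrightarrow> \<phi> x = 0\<^sub>m n n"
  shows "fin_dim_rep Q n (\<lambda>X. \<phi> (coset_rep X))"
    and "x \<in> carrier A \<Longrightarrow> \<phi> (coset_rep (cs x)) = \<phi> x"
proof -
  have eq: "\<phi> (coset_rep (cs x)) = \<phi> x" if "x \<in> carrier A" for x
    using that fin_dim_rep_diff[OF \<phi> coset_rep_carrier] I[OF coset_rep] by blast
  then show "x \<in> carrier A \<Longrightarrow> \<phi> (coset_rep (cs x)) = \<phi> x" .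
  show "fin_dim_rep Q n (\<lambda>X. \<phi> (coset_rep X))"
    using \<phi> by (auto simp: fin_dim_rep_def carrier_quotient quotient_add quotient_mult quotient_scale
        eq add_closed mult_closed scale_closed add mult)
qed

end

section \<open>The ideal of Leavitt relations\<close>

abbreviation leavitt_ideal :: "('v, 'e) pre_digraph \<Rightarrow> ('v, 'e, 'k::field) graph_free set" where
  "leavitt_ideal E \<equiv> ideal_generated (free_algebra (graph_gens E)) (leavitt_relations E)"

lemma algebra_ideal_free_algebra:
  "algebra_ideal (free_algebra X) I \<longleftrightarrow>
     I \<subseteq> carrier (free_algebra X) \<and> 0 \<in> I \<and> (\<forall>x \<in> I. \<forall>y \<in> I. x + y \<in> I) \<and>
     (\<forall>c. \<forall>x \<in> I. Poly_Mapping.single 0 c * x \<in> I) \<and>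
     (\<forall>a \<in> carrier (free_algebra X). \<forall>x \<in> I. a * x \<in> I \<and> x * a \<in> I)"
  by (simp add: algebra_ideal_def)

lemma algebra_ideal_carrier: "algebra_ideal (free_algebra X) (carrier (free_algebra X))"
  by (auto simp: algebra_ideal_free_algebra zero_in_carrier add_in_carrier mult_in_carrier scale_in_carrier)

lemma algebra_ideal_ideal_generated:
  assumes "R \<subseteq> carrier (free_algebra X)"
  shows "algebra_ideal (free_algebra X) (ideal_generated (free_algebra X) R)"
proof -
  have "ideal_generated (free_algebra X) R \<subseteq> carrier (free_algebra X)"
    using assms algebra_ideal_carrier by (auto simp: ideal_generated_def)
  then show ?thesis
    unfolding algebra_ideal_free_algebra by (auto simp: ideal_generated_def algebra_ideal_free_algebra)
qed

lemma ideal_generated_least: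
  "algebra_ideal A J \<Longrightarrow> R \<subseteq> J \<Longrightarrow> ideal_generated A R \<subseteq> J"
  by (auto simp: ideal_generated_def)

lemma ideal_generated_superset: "R \<subseteq> ideal_generated A R"
  by (auto simp: ideal_generated_def)

lemma quotient_alg_leavitt:
  assumes "wf_digraph E"
  shows "quotient_alg (free_algebra (graph_gens E)) (leavitt_ideal E)"
  by (rule quotient_alg.intro)
    (simp_all add: zero_in_carrier add_in_carrier mult_in_carrier scale_in_carrier right_diff_distrib
      algebra_ideal_ideal_generated[OF leavitt_relations_in_carrier[OF assms]])

lemma letters_plus [simp]: "letters (u + w) = letters u @ letters w"
  by (simp add: plus_free_monoid_def)

lemma letters_star_word: "letters (star_word w) = rev (map star_gen (letters w))"
  by (simp add: star_word_def)

lemma letters_eq_Nil_iff [simp]: "letters w = [] \<longleftrightarrow> w = 0"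
  by (cases w) (simp add: zero_free_monoid_def)

lemma lin_ext_cong: "(\<And>w. w \<in> Poly_Mapping.keys a \<Longrightarrow> \<phi> w = \<psi> w) \<Longrightarrow> lin_ext \<phi> a = lin_ext \<psi> a"
  by (simp add: lin_ext_def)

section \<open>Branching systems\<close>

text \<open>
  The letter \<open>Edge e\<close> acts on functions on \<open>X\<close> by transport along the partial injection
  \<open>cons e\<close>, and \<open>Ghost e\<close> by transport along its inverse. \<open>step x\<close> is the partial map along
  which the letter \<open>x\<close> pulls functions back, i.e. the inverse of its action on points.
\<close>

locale branching =
  fixes E :: "('v, 'e) pre_digraph" and X :: "'x set" and src :: "'x \<Rightarrow> 'v" and cons :: "'e \<Rightarrow> 'x \<Rightarrow> 'x"
  assumes wf: "wf_digraph E"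
    and cons_closed: "e \<in> arcs E \<Longrightarrow> x \<in> X \<Longrightarrow> src x = head E e \<Longrightarrow> cons e x \<in> X"
    and src_cons: "e \<in> arcs E \<Longrightarrow> x \<in> X \<Longrightarrow> src x = head E e \<Longrightarrow> src (cons e x) = tail E e"
    and cons_inject: "e \<in> arcs E \<Longrightarrow> x \<in> X \<Longrightarrow> src x = head E e \<Longrightarrow>
      e' \<in> arcs E \<Longrightarrow> x' \<in> X \<Longrightarrow> src x' = head E e' \<Longrightarrow> cons e x = cons e' x' \<Longrightarrow> e = e' \<and> x = x'"
    and cons_cases: "x \<in> X \<Longrightarrow> regular_vertex E (src x) \<Longrightarrow>
      \<exists>e \<in> arcs E. \<exists>y \<in> X. src y = head E e \<and> x = cons e y"
begin

definition valid :: "'e \<Rightarrow> 'x \<Rightarrow> bool" where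
  "valid e z \<longleftrightarrow> e \<in> arcs E \<and> z \<in> X \<and> src z = head E e"

lemma valid_inject: "valid e z \<Longrightarrow> valid e' z' \<Longrightarrow> cons e z = cons e' z' \<longleftrightarrow> e = e' \<and> z = z'"
  using cons_inject[of e z e' z'] by (auto simp: valid_def)

fun step :: "('v, 'e) graph_gen \<Rightarrow> 'x \<Rightarrow> 'x option" where
  "step (Vert v) y = (if y \<in> X \<and> src y = v then Some y else None)"
| "step (Edge e) y = (if \<exists>z. valid e z \<and> y = cons e z then Some (THE z. valid e z \<and> y = cons e z) else None)"
| "step (Ghost e) y = (if valid e y then Some (cons e y) else None)"

lemma step_Edge_iff: "step (Edge e) y = Some z \<longleftrightarrow> valid e z \<and> y = cons e z"
proof -
  have "(THE z. valid e z \<and> y = cons e z) = z" if "valid e z" "y = cons e z" for z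
    using that valid_inject by (intro the_equality) auto
  then show ?thesis by auto
qed

declare step.simps(2) [simp del]

lemma step_cons: "valid e z \<Longrightarrow> step (Edge e) (cons e z) = Some z"
  by (simp add: step_Edge_iff)

text \<open>Each letter acts as a partial bijection and \<open>star_gen\<close> selects its inverse.
  This is the source of the adjoint relation and of the injectivity of \<open>run\<close>.\<close>

lemma step_star_gen: "step (star_gen l) y = Some z \<longleftrightarrow> step l z = Some y"
  by (cases l) (auto simp: step_Edge_iff split: if_splits)

lemma step_in: "step l y = Some z \<Longrightarrow> y \<in> X \<and> z \<in> X"
  by (cases l) (auto simp: step_Edge_iff valid_def cons_closed split: if_splits)

primrec run :: "('v, 'e) graph_gen list \<Rightarrow> 'x \<Rightarrow> 'x option" where
  "run [] y = Some y"
| "run (l # ls) y = Option.bind (step l y) (run ls)"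

lemma run_append: "run (xs @ ys) y = Option.bind (run xs y) (run ys)"
  by (induction xs arbitrary: y) (auto split: Option.bind_split)

lemma run_star: "run (rev (map star_gen xs)) y = Some z \<longleftrightarrow> run xs z = Some y"
proof (induction xs arbitrary: y z)
  case Nil
  then show ?case by auto
next
  case (Cons l xs)
  then show ?case
    by (auto simp: run_append bind_eq_Some_conv step_star_gen)
qed

lemma run_in: "run ls y = Some z \<Longrightarrow> ls \<noteq> [] \<Longrightarrow> y \<in> X \<and> z \<in> X"
proof (induction ls arbitrary: y)
  case (Cons l ls)
  then show ?case by (cases ls) (auto simp: bind_eq_Some_conv dest: step_in)
qed simp

text \<open>Functions are pulled back along \<open>step\<close>, so reading a word from left to
  right, starting at \<open>y\<close>, yields a left action. A word that leaves the domain
  contributes the default 0.\<close>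

definition Op :: "('v, 'e, 'k::field) graph_free \<Rightarrow> ('x \<Rightarrow> 'k) \<Rightarrow> 'x \<Rightarrow> 'k" where
  "Op a f y = lin_ext (\<lambda>w. case run (letters w) y of None \<Rightarrow> 0 | Some x \<Rightarrow> f x) a"

lemma Op_zero [simp]: "Op 0 f y = 0"
  and Op_add: "Op (a + b) f y = Op a f y + Op b f y"
  and Op_diff: "Op (a - b) f y = Op a f y - Op b f y"
  and Op_scale: "Op (Poly_Mapping.single 0 c * a) f y = c * Op a f y"
  and Op_sum: "Op (\<Sum>i\<in>S. g i) f y = (\<Sum>i\<in>S. Op (g i) f y)"
  by (simp_all add: Op_def lin_ext_add lin_ext_diff lin_ext_scale lin_ext_sum)

lemma Op_single: "Op (Poly_Mapping.single w c) f y =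
    c * (case run (letters w) y of None \<Rightarrow> 0 | Some x \<Rightarrow> f x)"
  by (simp add: Op_def)

lemma Op_zero_fun [simp]: "Op a (\<lambda>_. 0) y = 0"
  by (auto simp: Op_def lin_ext_def split: option.splits intro!: sum.neutral)

lemma Op_fun_scale: "Op a (\<lambda>x. c * f x) y = c * Op a f y"
  by (auto simp: Op_def simp flip: lin_ext_fun_mult intro!: lin_ext_cong split: option.splits)

lemma Op_mult: "Op (a * b) f y = Op a (Op b f) y"
proof -
  have "lin_ext (\<lambda>v. case run (letters (u + v)) y of None \<Rightarrow> 0 | Some x \<Rightarrow> f x) b =
      (case run (letters u) y of None \<Rightarrow> 0 | Some z \<Rightarrow> Op b f z)" for u
    by (cases "run (letters u) y") (simp_all add: run_append Op_def lin_ext_def)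
  then show ?thesis by (simp add: Op_def[of "a * b"] Op_def[of a] lin_ext_mult)
qed

lemma Op_gen_p: "Op (gen_p v) f y = (if y \<in> X \<and> src y = v then f y else 0)"
  by (simp add: gen_p_def Op_single)

lemma Op_gen_s: "Op (gen_s e) f y = (case step (Edge e) y of None \<Rightarrow> 0 | Some z \<Rightarrow> f z)"
  by (auto simp: gen_s_def Op_single split: Option.bind_split option.split)

lemma Op_gen_s_star: "Op (gen_s_star e) f y = (if valid e y then f (cons e y) else 0)"
  by (simp add: gen_s_star_def Op_single)

lemma Op_range_projection:
  "Op (gen_s e * gen_s_star e) f y = (if \<exists>z. valid e z \<and> y = cons e z then f y else 0)"
  by (auto simp: Op_mult Op_gen_s Op_gen_s_star step_Edge_iff step.simps(2)[of e y, THEN arg_cong, of "\<lambda>x. x = None"]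
      split: option.split if_splits)

lemma Op_leavitt_relations:
  assumes "r \<in> leavitt_relations E"
  shows "Op r f y = 0"
proof -
  have s: "(step (Edge e) y = None) \<longleftrightarrow> \<not> (\<exists>z. valid e z \<and> y = cons e z)" for e y
    by (simp add: step.simps(2))
  from assms consider
    (pp) v w where "r = gen_p v * gen_p w - (if v = w then gen_p v else 0)"
  | (ps) e where "e \<in> arcs E" "r = gen_p (tail E e) * gen_s e - gen_s e"
  | (sp) e where "e \<in> arcs E" "r = gen_s e * gen_p (head E e) - gen_s e"
  | (pt) e where "e \<in> arcs E" "r = gen_p (head E e) * gen_s_star e - gen_s_star e"
  | (tp) e where "e \<in> arcs E" "r = gen_s_star e * gen_p (tail E e) - gen_s_star e"
  | (ts) e f where "e \<in> arcs E" "f \<in> arcs E"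
      "r = gen_s_star e * gen_s f - (if e = f then gen_p (head E e) else 0)"
  | (ck) v where "regular_vertex E v" "r = gen_p v - (\<Sum>e \<in> out_arcs E v. gen_s e * gen_s_star e)"
    unfolding leavitt_relations_def by blast
  then show ?thesis
  proof cases
    case pp
    then show ?thesis by (simp add: Op_diff Op_mult Op_gen_p)
  next
    case ps
    then show ?thesis
      by (auto simp: Op_diff Op_mult Op_gen_p Op_gen_s step_Edge_iff src_cons cons_closed valid_def split: option.split)
  next
    case sp
    have "(case step (Edge e) y of None \<Rightarrow> 0 | Some z \<Rightarrow> Op (gen_p (head E e)) f z) =
        (case step (Edge e) y of None \<Rightarrow> 0 | Some z \<Rightarrow> f z)"
    proof (cases "step (Edge e) y")
      case (Some z)
      then have "valid e z" by (simp only: step_Edge_iff)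
      then show ?thesis using Some by (simp add: valid_def Op_gen_p)
    qed simp
    then show ?thesis
      by (simp add: sp Op_diff Op_mult Op_gen_s)
  next
    case pt
    then show ?thesis
      by (auto simp: Op_diff Op_mult Op_gen_p Op_gen_s_star valid_def)
  next
    case tp
    then show ?thesis
      by (auto simp: Op_diff Op_mult Op_gen_p Op_gen_s_star valid_def src_cons cons_closed)
  next
    case ts
    then show ?thesis
      by (auto simp: Op_diff Op_mult Op_gen_p Op_gen_s_star Op_gen_s step_cons step_Edge_iff valid_inject
          split: option.split) (auto simp: valid_def)
  next
    case ck
    then have fin: "finite (out_arcs E v)" by (simp add: regular_vertex_def)
    have sum: "Op (\<Sum>e \<in> out_arcs E v. gen_s e * gen_s_star e) f y =
        (\<Sum>e \<in> out_arcs E v. if \<exists>z. valid e z \<and> y = cons e z then f y else 0)"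
      by (simp add: Op_sum Op_range_projection)
    show ?thesis
    proof (cases "y \<in> X \<and> src y = v")
      case True
      \<comment> \<open>The relation at a regular vertex asks exactly for \<open>cons_cases\<close>:
        the point lies in the range of some \<open>cons e0\<close>, by injectivity of only one, so a
        single summand survives.\<close>
      then obtain e0 z0 where e0: "valid e0 z0" "y = cons e0 z0"
        using cons_cases[of y] ck by (auto simp: valid_def)
      have "tail E e0 = v" using e0 True src_cons by (auto simp: valid_def)
      then have "e0 \<in> out_arcs E v" using e0 by (auto simp: valid_def)
      moreover have "(\<exists>z. valid e z \<and> y = cons e z) \<longleftrightarrow> e = e0" for e
        using e0 valid_inject by auto
      ultimately show ?thesis using True fin ck by (simp add: Op_diff sum Op_gen_p)
    next
      case False
      then have "\<not> (\<exists>z. valid e z \<and> y = cons e z)" if "e \<in> out_arcs E v" for e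
        using that src_cons cons_closed by (auto simp: valid_def)
      then show ?thesis using False ck by (simp add: Op_diff sum Op_gen_p if_not_P)
    qed
  qed
qed

lemma Op_leavitt_ideal:
  fixes r :: "('v, 'e, 'k::field) graph_free"
  assumes "r \<in> leavitt_ideal E"
  shows "Op r f y = 0"
proof -
  \<comment> \<open>By \<open>Op_mult\<close>, the elements that annihilate all functions form an
    ideal, and it contains the relations.\<close>
  let ?J = "{a \<in> carrier (free_algebra (graph_gens E)). \<forall>f y. Op a f y = 0} :: ('v, 'e, 'k) graph_free set"
  have Op0: "Op b (Op a f) y = 0" if "\<forall>f y. Op a f y = 0" for a b :: "('v, 'e, 'k) graph_free" and f y
  proof -
    have "Op a f = (\<lambda>_. 0)" using that by blast
    then show ?thesis by simp
  qed
  have "algebra_ideal (free_algebra (graph_gens E)) ?J"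
    unfolding algebra_ideal_free_algebra
  proof (intro conjI ballI allI)
    fix a x :: "('v, 'e, 'k) graph_free"
    assume "a \<in> carrier (free_algebra (graph_gens E))" and x: "x \<in> ?J"
    then show "a * x \<in> ?J" "x * a \<in> ?J"
      by (simp_all add: mult_in_carrier Op_mult Op0)
  qed (simp_all add: zero_in_carrier add_in_carrier scale_in_carrier Op_add Op_scale Collect_mono subset_eq)
  moreover have "leavitt_relations E \<subseteq> ?J"
    using leavitt_relations_in_carrier[OF wf] Op_leavitt_relations by auto
  ultimately have "leavitt_ideal E \<subseteq> ?J" by (rule ideal_generated_least)
  then show ?thesis using assms by blast
qed

text \<open>The entry in row \<open>y\<close> and column \<open>x\<close> with respect to the
  indicator functions of points; it makes sense for infinite \<open>X\<close> as well.\<close>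

definition mc :: "('v, 'e, 'k::field) graph_free \<Rightarrow> 'x \<Rightarrow> 'x \<Rightarrow> 'k" where
  "mc a y x = Op a (\<lambda>z. if z = x then 1 else 0) y"

lemma mc_lin_ext: "mc a y x = lin_ext (\<lambda>w. if run (letters w) y = Some x then 1 else 0) a"
  unfolding mc_def Op_def by (rule lin_ext_cong) (auto split: option.split)

lemma mc_add: "mc (a + b) y x = mc a y x + mc b y x"
  and mc_diff: "mc (a - b) y x = mc a y x - mc b y x"
  and mc_scale: "mc (Poly_Mapping.single 0 c * a) y x = c * mc a y x"
  and mc_sum: "mc (\<Sum>i\<in>S. g i) y x = (\<Sum>i\<in>S. mc (g i) y x)"
  and mc_leavitt_ideal: "r \<in> leavitt_ideal E \<Longrightarrow> mc r y x = 0"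
  by (simp_all add: mc_def Op_add Op_diff Op_scale Op_sum Op_leavitt_ideal)

lemma mc_single: "mc (Poly_Mapping.single w c) y x = (if run (letters w) y = Some x then c else 0)"
  by (simp add: mc_lin_ext)

text \<open>A word acts by the 0-1 matrix of a partial bijection, and the adjoint of that matrix
  belongs to the inverse bijection, that is, to the starred word.\<close>

lemma mc_star_free: "mc (star_free a) y x = cnj (mc a x y)"
proof -
  have "mc (star_free a) y x = cnj (lin_ext (\<lambda>w. cnj (if run (letters (star_word w)) y = Some x then 1 else 0)) a)"
    unfolding mc_lin_ext lin_ext_star_free ..
  also have "lin_ext (\<lambda>w. cnj (if run (letters (star_word w)) y = Some x then 1 else 0)) a =
      lin_ext (\<lambda>w. if run (letters w) x = Some y then 1 else 0) a"
    by (rule lin_ext_cong) (simp add: letters_star_word run_star)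
  finally show ?thesis by (simp only: mc_lin_ext)
qed

lemma Op_eq_sum_mc:
  assumes a: "a \<in> carrier (free_algebra G)" and S: "finite S" "\<And>x. x \<in> X \<Longrightarrow> f x \<noteq> 0 \<Longrightarrow> x \<in> S"
  shows "Op a f y = (\<Sum>x\<in>S. mc a y x * f x)"
proof -
  have "Op a f y = lin_ext (\<lambda>w. \<Sum>x\<in>S. f x * (if run (letters w) y = Some x then 1 else 0)) a"
    unfolding Op_def
  proof (rule lin_ext_cong)
    fix w assume "w \<in> Poly_Mapping.keys a"
    \<comment> \<open>The empty word would act as the identity even outside \<open>X\<close>; a
      nonempty word ends at points of \<open>X\<close>, where \<open>S\<close> contains the support
      of \<open>f\<close>.\<close>
    then have w: "letters w \<noteq> []" using a by (auto simp: in_carrier_free_algebra)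
    show "(case run (letters w) y of None \<Rightarrow> 0 | Some x \<Rightarrow> f x) =
        (\<Sum>x\<in>S. f x * (if run (letters w) y = Some x then 1 else 0))"
    proof (cases "run (letters w) y")
      case (Some x)
      then have "x \<in> X" using run_in w by blast
      moreover have "(\<Sum>x'\<in>S. f x' * (if x = x' then 1 else 0)) = (\<Sum>x'\<in>S. if x = x' then f x' else 0)"
        by (rule sum.cong) auto
      ultimately show ?thesis using Some S by (cases "f x = 0") auto
    qed simp
  qed
  also have "\<dots> = (\<Sum>x\<in>S. f x * mc a y x)"
    by (simp add: lin_ext_fun_sum lin_ext_fun_mult mc_lin_ext)
  finally show ?thesis by (simp add: mult.commute)
qed

lemma mc_mult:
  assumes "finite X" and "a \<in> carrier (free_algebra G)"
  shows "mc (a * b) y x = (\<Sum>z\<in>X. mc a y z * mc b z x)"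
  unfolding mc_def[of "a * b"] Op_mult mc_def[of b]
  using assms by (simp add: Op_eq_sum_mc[where S = X])

definition matr :: "(nat \<Rightarrow> 'x) \<Rightarrow> nat \<Rightarrow> ('v, 'e, 'k::field) graph_free \<Rightarrow> 'k mat" where
  "matr h n a = mat n n (\<lambda>(i, j). mc a (h i) (h j))"

lemma matr_carrier [simp]: "matr h n a \<in> carrier_mat n n"
  by (simp add: matr_def)

lemma matr_mult:
  assumes h: "bij_betw h {0..<n} X" and a: "a \<in> carrier (free_algebra G)"
  shows "matr h n (a * b) = matr h n a * matr h n b"
proof (rule eq_matI)
  fix i j assume "i < dim_row (matr h n a * matr h n b)" "j < dim_col (matr h n a * matr h n b)"
  then have ij: "i < n" "j < n" by (simp_all add: matr_def)
  have fin: "finite X" using h bij_betw_finite by blast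
  show "matr h n (a * b) $$ (i, j) = (matr h n a * matr h n b) $$ (i, j)"
    using ij by (simp add: matr_def scalar_prod_def mc_mult[OF fin a] sum.reindex_bij_betw[OF h, symmetric])
qed (simp_all add: matr_def)

lemma fin_dim_rep_matr:
  assumes "bij_betw h {0..<n} X"
  shows "fin_dim_rep (free_algebra (graph_gens E)) n (matr h n)"
  unfolding fin_dim_rep_def
  by (auto simp: matr_mult[OF assms] mc_add mc_scale intro!: eq_matI) (auto simp: matr_def mc_add mc_scale)

lemma matr_eq_zero_iff:
  assumes "bij_betw h {0..<n} X"
  shows "matr h n a = 0\<^sub>m n n \<longleftrightarrow> (\<forall>x\<in>X. \<forall>y\<in>X. mc a y x = 0)"
proof -
  have "matr h n a = 0\<^sub>m n n \<longleftrightarrow> (\<forall>i<n. \<forall>j<n. mc a (h i) (h j) = 0)"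
    by (auto simp: matr_def mat_eq_iff)
  also have "\<dots> \<longleftrightarrow> (\<forall>x\<in>h ` {0..<n}. \<forall>y\<in>h ` {0..<n}. mc a y x = 0)"
    by auto
  also have "h ` {0..<n} = X"
    using assms by (simp add: bij_betw_def)
  finally show ?thesis .
qed

end

section \<open>Finitely supported functions as a pre-Hilbert space\<close>

definition fin_supp :: "('x \<Rightarrow> complex) \<Rightarrow> bool" where
  "fin_supp f \<longleftrightarrow> finite {x. f x \<noteq> 0}"

text \<open>For infinite support the value is the default 0 of a sum over an infinite set, hence the
  \<open>fin_supp\<close> hypotheses in what follows.\<close>

definition l2norm :: "('x \<Rightarrow> complex) \<Rightarrow> real" where
  "l2norm f = L2_set (\<lambda>x. cmod (f x)) {x. f x \<noteq> 0}"

definition l2inner :: "('x \<Rightarrow> complex) \<Rightarrow> ('x \<Rightarrow> complex) \<Rightarrow> complex" where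
  "l2inner f g = (\<Sum>x | f x \<noteq> 0. f x * cnj (g x))"

lemma l2norm_nonneg [simp]: "0 \<le> l2norm f"
  by (simp add: l2norm_def)

lemma l2norm_zero [simp]: "l2norm (\<lambda>_. 0) = 0"
  by (simp add: l2norm_def)

lemma l2norm_superset:
  assumes "finite S" "\<And>x. f x \<noteq> 0 \<Longrightarrow> x \<in> S"
  shows "l2norm f = L2_set (\<lambda>x. cmod (f x)) S"
proof -
  have "(\<Sum>x | f x \<noteq> 0. (cmod (f x))\<^sup>2) = (\<Sum>x\<in>S. (cmod (f x))\<^sup>2)"
    using assms by (intro sum.mono_neutral_left) auto
  then show ?thesis by (simp add: l2norm_def L2_set_def)
qed

lemma l2inner_eq_sum:
  assumes "fin_supp f" "finite S" "\<And>x. f x \<noteq> 0 \<Longrightarrow> g x \<noteq> 0 \<Longrightarrow> x \<in> S"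
  shows "l2inner f g = (\<Sum>x\<in>S. f x * cnj (g x))"
proof -
  let ?T = "{x. f x \<noteq> 0} \<union> S"
  have "l2inner f g = (\<Sum>x\<in>?T. f x * cnj (g x))"
    unfolding l2inner_def using assms by (intro sum.mono_neutral_left) (auto simp: fin_supp_def)
  also have "\<dots> = (\<Sum>x\<in>S. f x * cnj (g x))"
    using assms by (intro sum.mono_neutral_right) (auto simp: fin_supp_def)
  finally show ?thesis .
qed

lemma l2norm_add:
  assumes "fin_supp f" "fin_supp g"
  shows "l2norm (\<lambda>x. f x + g x) \<le> l2norm f + l2norm g"
proof -
  let ?S = "{x. f x \<noteq> 0} \<union> {x. g x \<noteq> 0}"
  have fin: "finite ?S" using assms by (simp add: fin_supp_def)
  have "l2norm (\<lambda>x. f x + g x) = L2_set (\<lambda>x. cmod (f x + g x)) ?S"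
    by (rule l2norm_superset[OF fin]) auto
  also have "\<dots> \<le> L2_set (\<lambda>x. cmod (f x) + cmod (g x)) ?S"
    by (intro L2_set_mono norm_triangle_ineq) auto
  also have "\<dots> \<le> L2_set (\<lambda>x. cmod (f x)) ?S + L2_set (\<lambda>x. cmod (g x)) ?S"
    by (rule L2_set_triangle_ineq)
  also have "\<dots> = l2norm f + l2norm g"
    using l2norm_superset[OF fin, of f] l2norm_superset[OF fin, of g] by simp
  finally show ?thesis .
qed

lemma l2norm_scale: "l2norm (\<lambda>x. c * f x) = cmod c * l2norm f"
  by (cases "c = 0") (simp_all add: l2norm_def L2_set_right_distrib norm_mult)

lemma fin_supp_zero [simp]: "fin_supp (\<lambda>_. 0)"
  by (simp add: fin_supp_def)

lemma fin_supp_scale: "fin_supp f \<Longrightarrow> fin_supp (\<lambda>x. c * f x)"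
  unfolding fin_supp_def by (rule finite_subset) auto

lemma cmod_l2inner_le:
  assumes "fin_supp f" "fin_supp g"
  shows "cmod (l2inner f g) \<le> l2norm f * l2norm g"
proof -
  let ?S = "{x. f x \<noteq> 0} \<union> {x. g x \<noteq> 0}"
  have fin: "finite ?S" using assms by (simp add: fin_supp_def)
  have "cmod (l2inner f g) \<le> (\<Sum>x\<in>?S. \<bar>cmod (f x)\<bar> * \<bar>cmod (g x)\<bar>)"
    using l2inner_eq_sum[OF assms(1) fin, of g] norm_sum[of "\<lambda>x. f x * cnj (g x)" ?S]
    by (simp add: norm_mult)
  also have "\<dots> \<le> L2_set (\<lambda>x. cmod (f x)) ?S * L2_set (\<lambda>x. cmod (g x)) ?S"
    by (rule L2_set_mult_ineq)
  also have "\<dots> = l2norm f * l2norm g"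
    using l2norm_superset[OF fin, of f] l2norm_superset[OF fin, of g] by simp
  finally show ?thesis .
qed

lemma l2inner_self: "l2inner f f = complex_of_real ((l2norm f)\<^sup>2)"
  by (simp add: l2inner_def l2norm_def L2_set_def sum_nonneg complex_norm_square[symmetric])

lemma l2norm_eq_0: "fin_supp f \<Longrightarrow> l2norm f = 0 \<Longrightarrow> f = (\<lambda>_. 0)"
  by (auto simp: l2norm_def fin_supp_def L2_set_eq_0_iff)

lemma cmod_le_l2norm:
  assumes "fin_supp f"
  shows "cmod (f x) \<le> l2norm f"
proof (cases "f x = 0")
  case False
  then show ?thesis
    unfolding l2norm_def using assms
    by (intro member_le_L2_set[where f = "\<lambda>x. cmod (f x)"]) (auto simp: fin_supp_def)
qed simp

section \<open>The operator norm of a branching system\<close>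

context branching
begin

lemma finite_run_vimage: "finite {y. run ls y = Some x}"
proof -
  have "{y. run ls y = Some x} \<subseteq> {the (run (rev (map star_gen ls)) x)}"
    by (auto simp flip: run_star[of ls x])
  then show ?thesis by (rule finite_subset) simp
qed

lemma fin_supp_Op:
  assumes "fin_supp f"
  shows "fin_supp (Op a f)"
proof -
  have "{y. Op a f y \<noteq> 0} \<subseteq>
      (\<Union>w\<in>Poly_Mapping.keys a. \<Union>x\<in>{x. f x \<noteq> 0}. {y. run (letters w) y = Some x})"
  proof
    fix y assume "y \<in> {y. Op a f y \<noteq> 0}"
    then obtain w where "w \<in> Poly_Mapping.keys a"
      "(case run (letters w) y of None \<Rightarrow> 0 | Some x \<Rightarrow> f x) \<noteq> 0"
      unfolding Op_def lin_ext_def by (force intro: sum.neutral)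
    then show "y \<in> (\<Union>w\<in>Poly_Mapping.keys a. \<Union>x\<in>{x. f x \<noteq> 0}. {y. run (letters w) y = Some x})"
      by (auto split: option.splits)
  qed
  then show ?thesis
    using assms finite_run_vimage unfolding fin_supp_def by (meson finite_UN finite_keys finite_subset)
qed

text \<open>Values are transported along a partial injection, which can drop squared moduli from the
  sum but never repeat one.\<close>

lemma l2norm_Op_single:
  assumes "fin_supp f"
  shows "l2norm (Op (Poly_Mapping.single w c) f) \<le> cmod c * l2norm f"
proof -
  let ?F = "{x. f x \<noteq> 0}"
  let ?g = "\<lambda>y. case run (letters w) y of None \<Rightarrow> 0 | Some x \<Rightarrow> f x"
  let ?T = "{y. ?g y \<noteq> 0}" and ?r = "\<lambda>y. the (run (letters w) y)"
  have finF: "finite ?F" using assms by (simp add: fin_supp_def)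
  have inj: "inj_on ?r ?T"
  proof (rule inj_onI)
    fix y y' assume y: "y \<in> ?T" "y' \<in> ?T" and eq: "?r y = ?r y'"
    then obtain x where x: "run (letters w) y = Some x" "run (letters w) y' = Some x"
      by (auto split: option.splits)
    then have "run (rev (map star_gen (letters w))) x = Some y" "run (rev (map star_gen (letters w))) x = Some y'"
      by (simp_all add: run_star)
    then show "y = y'" by simp
  qed
  have "(\<Sum>y\<in>?T. (cmod (?g y))\<^sup>2) = (\<Sum>y\<in>?T. (cmod (f (?r y)))\<^sup>2)"
    by (rule sum.cong) (auto split: option.splits)
  also have "\<dots> = (\<Sum>x\<in>?r ` ?T. (cmod (f x))\<^sup>2)"
    by (simp add: sum.reindex[OF inj])
  also have "\<dots> \<le> (\<Sum>x\<in>?F. (cmod (f x))\<^sup>2)"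
    by (rule sum_mono2[OF finF]) (auto split: option.splits)
  finally have "l2norm ?g \<le> l2norm f"
    by (simp add: l2norm_def L2_set_def)
  moreover have "Op (Poly_Mapping.single w c) f = (\<lambda>y. c * ?g y)"
    by (rule ext) (simp add: Op_single)
  ultimately show ?thesis
    by (simp add: l2norm_scale mult_left_mono)
qed

text \<open>Needed for the supremum in \<open>opnorm\<close> to be a genuine one; the constant built
  up by the induction is a sum of moduli of coefficients.\<close>

lemma Op_bounded: "\<exists>C\<ge>0. \<forall>f. fin_supp f \<longrightarrow> l2norm (Op a f) \<le> C * l2norm f"
proof (induction a rule: poly_mapping_single_induct)
  case (single w c)
  show ?case using l2norm_Op_single by (intro exI[of _ "cmod c"]) simp
next
  case (add a b)
  then obtain C D where C: "C \<ge> 0" "\<And>f. fin_supp f \<Longrightarrow> l2norm (Op a f) \<le> C * l2norm f"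
    and D: "D \<ge> 0" "\<And>f. fin_supp f \<Longrightarrow> l2norm (Op b f) \<le> D * l2norm f"
    by blast
  have "l2norm (Op (a + b) f) \<le> (C + D) * l2norm f" if f: "fin_supp f" for f
  proof -
    have "Op (a + b) f = (\<lambda>y. Op a f y + Op b f y)" by (rule ext) (simp add: Op_add)
    then have "l2norm (Op (a + b) f) \<le> l2norm (Op a f) + l2norm (Op b f)"
      by (simp add: l2norm_add fin_supp_Op f)
    also have "\<dots> \<le> (C + D) * l2norm f"
      using C(2)[OF f] D(2)[OF f] by (simp add: algebra_simps)
    finally show ?thesis .
  qed
  then show ?case using C(1) D(1) by (intro exI[of _ "C + D"]) simp
qed

text \<open>Finitely supported functions are dense in l2, so this is the norm of the bounded
  extension to the Hilbert space, obtained without constructing the completion.\<close>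

definition opnorm :: "('v, 'e, complex) graph_free \<Rightarrow> real" where
  "opnorm a = (SUP f \<in> {f. fin_supp f \<and> l2norm f \<le> 1}. l2norm (Op a f))"

lemma opnorm_least:
  assumes "\<And>f. fin_supp f \<Longrightarrow> l2norm f \<le> 1 \<Longrightarrow> l2norm (Op a f) \<le> c"
  shows "opnorm a \<le> c"
proof -
  have "{f :: 'x \<Rightarrow> complex. fin_supp f \<and> l2norm f \<le> 1} \<noteq> {}"
    by (auto intro!: exI[of _ "\<lambda>_. 0"])
  then show ?thesis
    unfolding opnorm_def using assms by (intro cSUP_least) auto
qed

lemma opnorm_upper:
  assumes "fin_supp f" "l2norm f \<le> 1"
  shows "l2norm (Op a f) \<le> opnorm a"
proof -
  obtain C where C: "C \<ge> 0" "\<And>f. fin_supp f \<Longrightarrow> l2norm (Op a f) \<le> C * l2norm f"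
    using Op_bounded by blast
  have "bdd_above ((\<lambda>f. l2norm (Op a f)) ` {f. fin_supp f \<and> l2norm f \<le> 1})"
    using C(1) order_trans[OF C(2) mult_left_le] by (intro bdd_aboveI2[where M = C]) auto
  then show ?thesis
    unfolding opnorm_def using assms by (intro cSUP_upper) auto
qed

lemma opnorm_nonneg: "0 \<le> opnorm a"
  using opnorm_upper[of "\<lambda>_. 0" a] order_trans[OF l2norm_nonneg] by simp

lemma l2norm_Op_le:
  assumes "fin_supp f"
  shows "l2norm (Op a f) \<le> opnorm a * l2norm f"
proof (cases "l2norm f = 0")
  case True
  then have "Op a f = (\<lambda>_. 0)" using l2norm_eq_0[OF assms] by auto
  then show ?thesis by (simp add: True)
next
  case False
  let ?c = "complex_of_real (inverse (l2norm f))"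
  have "Op a (\<lambda>x. ?c * f x) = (\<lambda>y. ?c * Op a f y)"
    by (rule ext) (rule Op_fun_scale)
  moreover have "l2norm (Op a (\<lambda>x. ?c * f x)) \<le> opnorm a"
    using assms False
    by (intro opnorm_upper fin_supp_scale) (simp_all add: l2norm_scale norm_inverse)
  ultimately have "inverse (l2norm f) * l2norm (Op a f) \<le> opnorm a"
    by (simp add: l2norm_scale norm_inverse)
  moreover have "l2norm f > 0" using False by (simp add: less_le)
  ultimately show ?thesis by (simp add: field_simps)
qed

lemma opnorm_mult: "opnorm (a * b) \<le> opnorm a * opnorm b"
proof (rule opnorm_least)
  fix f :: "'x \<Rightarrow> complex" assume f: "fin_supp f" "l2norm f \<le> 1"
  have "Op (a * b) f = Op a (Op b f)" by (rule ext) (rule Op_mult)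
  then have "l2norm (Op (a * b) f) \<le> opnorm a * l2norm (Op b f)"
    by (simp add: l2norm_Op_le fin_supp_Op f)
  also have "\<dots> \<le> opnorm a * opnorm b"
    by (intro mult_left_mono opnorm_upper f opnorm_nonneg)
  finally show "l2norm (Op (a * b) f) \<le> opnorm a * opnorm b" .
qed

lemma opnorm_add: "opnorm (a + b) \<le> opnorm a + opnorm b"
proof (rule opnorm_least)
  fix f :: "'x \<Rightarrow> complex" assume f: "fin_supp f" "l2norm f \<le> 1"
  have "Op (a + b) f = (\<lambda>y. Op a f y + Op b f y)" by (rule ext) (rule Op_add)
  then have "l2norm (Op (a + b) f) \<le> l2norm (Op a f) + l2norm (Op b f)"
    by (simp add: l2norm_add fin_supp_Op f)
  then show "l2norm (Op (a + b) f) \<le> opnorm a + opnorm b"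
    using opnorm_upper[OF f, of a] opnorm_upper[OF f, of b] by linarith
qed

lemma opnorm_zeroI: "(\<And>f y. Op a f y = 0) \<Longrightarrow> opnorm a = 0"
proof -
  assume "\<And>f y. Op a f y = 0"
  then have "Op a f = (\<lambda>_. 0)" for f :: "'x \<Rightarrow> complex" by blast
  then have "opnorm a \<le> 0" by (intro opnorm_least) simp
  then show ?thesis using opnorm_nonneg[of a] by simp
qed

lemma opnorm_scale: "opnorm (Poly_Mapping.single 0 c * a) = cmod c * opnorm a"
proof -
  have le: "opnorm (Poly_Mapping.single 0 c * a) \<le> cmod c * opnorm a" for c a
  proof (rule opnorm_least)
    fix f :: "'x \<Rightarrow> complex" assume f: "fin_supp f" "l2norm f \<le> 1"
    have "Op (Poly_Mapping.single 0 c * a) f = (\<lambda>y. c * Op a f y)" by (rule ext) (rule Op_scale)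
    then show "l2norm (Op (Poly_Mapping.single 0 c * a) f) \<le> cmod c * opnorm a"
      by (simp add: l2norm_scale mult_left_mono opnorm_upper f)
  qed
  show ?thesis
  proof (cases "c = 0")
    case True
    then show ?thesis by (simp add: opnorm_zeroI)
  next
    case False
    have "Poly_Mapping.single 0 (inverse c) * (Poly_Mapping.single 0 c * a) = a"
      using False by (simp add: mult.assoc[symmetric] Poly_Mapping.mult_single)
    then have "cmod c * opnorm a \<le> opnorm (Poly_Mapping.single 0 c * a)"
      using le[of "inverse c" "Poly_Mapping.single 0 c * a"] False by (simp add: norm_divide field_simps)
    then show ?thesis using le[of c a] by simp
  qed
qed

lemma l2inner_Op:
  assumes a: "a \<in> carrier (free_algebra G)" "star_free a \<in> carrier (free_algebra G)"
    and f: "fin_supp f" and g: "fin_supp g"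
  shows "l2inner (Op a f) g = l2inner f (Op (star_free a) g)"
proof -
  let ?F = "{x. f x \<noteq> 0}" and ?G = "{x. g x \<noteq> 0}"
  have fin: "finite ?F" "finite ?G" using f g by (simp_all add: fin_supp_def)
  have "l2inner (Op a f) g = (\<Sum>y\<in>?G. (\<Sum>x\<in>?F. mc a y x * f x) * cnj (g y))"
    using l2inner_eq_sum[OF fin_supp_Op[OF f] fin(2), where g = g] Op_eq_sum_mc[OF a(1) fin(1), where f = f] by simp
  also have "\<dots> = (\<Sum>x\<in>?F. f x * cnj (\<Sum>y\<in>?G. mc (star_free a) x y * g y))"
    by (simp add: mc_star_free sum_distrib_left sum_distrib_right) (subst sum.swap, simp add: mult_ac)
  also have "\<dots> = l2inner f (Op (star_free a) g)"
    using Op_eq_sum_mc[OF a(2) fin(2), where f = g] by (simp add: l2inner_def)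
  finally show ?thesis .
qed

lemma opnorm_sqr_le:
  assumes "a \<in> carrier (free_algebra (graph_gens E))"
  shows "(opnorm a)\<^sup>2 \<le> opnorm (star_free a * a)"
proof -
  have "opnorm a \<le> sqrt (opnorm (star_free a * a))"
  proof (rule opnorm_least)
    fix f :: "'x \<Rightarrow> complex" assume f: "fin_supp f" "l2norm f \<le> 1"
    have "Op (star_free a * a) f = Op (star_free a) (Op a f)" by (rule ext) (rule Op_mult)
    \<comment> \<open>Since \<open>star_free a\<close> acts as the formal adjoint, |a f|^2 is the
      inner product of f with a* a f, and Cauchy-Schwarz bounds it by the norm of a* a.\<close>
    then have "complex_of_real ((l2norm (Op a f))\<^sup>2) = l2inner f (Op (star_free a * a) f)"
      using l2inner_Op[OF assms star_free_in_carrier[OF assms] f(1) fin_supp_Op[OF f(1), of a]]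
      by (simp only: l2inner_self)
    then have "(l2norm (Op a f))\<^sup>2 \<le> l2norm f * l2norm (Op (star_free a * a) f)"
      using cmod_l2inner_le[OF f(1) fin_supp_Op[OF f(1)]]
      by (metis abs_of_nonneg norm_of_real zero_le_power2)
    also have "\<dots> \<le> 1 * opnorm (star_free a * a)"
      by (intro mult_mono opnorm_upper f) auto
    finally show "l2norm (Op a f) \<le> sqrt (opnorm (star_free a * a))"
      by (simp add: real_le_rsqrt)
  qed
  then show ?thesis
    using opnorm_nonneg power_mono[of "opnorm a" _ 2] by fastforce
qed

lemma opnorm_star_free_le:
  assumes "a \<in> carrier (free_algebra (graph_gens E))"
  shows "opnorm a \<le> opnorm (star_free a)"
proof (cases "opnorm a = 0")
  case False
  then have "opnorm a > 0" using opnorm_nonneg[of a] by simp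
  moreover have "opnorm a * opnorm a \<le> opnorm (star_free a) * opnorm a"
    using opnorm_sqr_le[OF assms] opnorm_mult[of "star_free a" a] by (simp add: power2_eq_square)
  ultimately show ?thesis by simp
qed (simp add: opnorm_nonneg)

lemma opnorm_cstar:
  assumes "a \<in> carrier (free_algebra (graph_gens E))"
  shows "opnorm (star_free a * a) = (opnorm a)\<^sup>2"
proof (rule antisym)
  have "opnorm (star_free a) = opnorm a"
    using opnorm_star_free_le[OF assms] opnorm_star_free_le[OF star_free_in_carrier[OF assms]] by simp
  then show "opnorm (star_free a * a) \<le> (opnorm a)\<^sup>2"
    using opnorm_mult[of "star_free a" a] by (simp add: power2_eq_square)
qed (rule opnorm_sqr_le[OF assms])

lemma Op_cuntz_krieger_relations:
  assumes "r \<in> cuntz_krieger_relations E"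
  shows "Op r f y = 0"
proof -
  from assms consider
    (lp) "r \<in> leavitt_relations E"
  | (sts) e where "e \<in> arcs E" "r = gen_s e * gen_s_star e * gen_s e - gen_s e"
  | (orth) e e' where "e \<in> arcs E" "e' \<in> arcs E" "e \<noteq> e'"
      "r = (gen_s e * gen_s_star e) * (gen_s e' * gen_s_star e')"
  | (ts) e where "e \<in> arcs E" "r = gen_s_star e * gen_s e - gen_p (head E e)"
  | (pst) e where "e \<in> arcs E" "r = gen_p (tail E e) * (gen_s e * gen_s_star e) - gen_s e * gen_s_star e"
    unfolding cuntz_krieger_relations_def leavitt_relations_def by blast
  then show ?thesis
  proof cases
    case lp
    then show ?thesis by (rule Op_leavitt_relations)
  next
    case sts
    have "Op (gen_s e) f y = 0" if "\<nexists>z. valid e z \<and> y = cons e z"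
      using that by (auto simp: Op_gen_s step_Edge_iff split: option.split)
    then show ?thesis
      by (auto simp: sts Op_diff Op_mult[of "gen_s e * gen_s_star e"] Op_range_projection)
  next
    case orth
    then show ?thesis
      by (auto simp: Op_mult[of "gen_s e * gen_s_star e"] Op_range_projection valid_inject)
  next
    case ts
    then have "gen_s_star e * gen_s e - (if e = e then gen_p (head E e) else 0) \<in> leavitt_relations E"
      unfolding leavitt_relations_def by blast
    then have "r \<in> leavitt_relations E" by (simp add: ts)
    then show ?thesis by (rule Op_leavitt_relations)
  next
    case pst
    then show ?thesis
      by (auto simp: Op_diff Op_mult[of "gen_p v" for v] Op_range_projection Op_gen_p valid_def cons_closed src_cons)
  qed
qed

text \<open>Hence every branching system bounds the universal seminorm from below; all nontrivial
  lower bounds for it arise in this way.\<close>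

theorem opnorm_in_cuntz_krieger_seminorms: "opnorm \<in> cuntz_krieger_seminorms E"
  by (simp add: cuntz_krieger_seminorms_def cstar_seminorm_def opnorm_nonneg opnorm_add opnorm_scale
      opnorm_mult opnorm_cstar opnorm_zeroI Op_cuntz_krieger_relations)

lemma cmod_mc_le_opnorm: "cmod (mc a y x) \<le> opnorm a"
proof -
  let ?f = "\<lambda>z. if z = x then 1 else 0 :: complex"
  have S: "{z. ?f z \<noteq> 0} = {x}" by auto
  have f: "fin_supp ?f" "l2norm ?f = 1"
    by (simp_all add: fin_supp_def l2norm_def S)
  have "cmod (mc a y x) \<le> l2norm (Op a ?f)"
    unfolding mc_def by (rule cmod_le_l2norm[OF fin_supp_Op[OF f(1)]])
  also have "\<dots> \<le> opnorm a" using opnorm_upper[OF f(1)] f(2) by simp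
  finally show ?thesis .
qed

text \<open>A crude estimate, but on a finite set it suffices to conclude that the norms tend to
  zero when all entries do.\<close>

lemma opnorm_le_sum_mc:
  assumes "finite X" "a \<in> carrier (free_algebra G)"
  shows "opnorm a \<le> (\<Sum>y\<in>X. \<Sum>x\<in>X. cmod (mc a y x))"
proof (rule opnorm_least)
  fix f :: "'x \<Rightarrow> complex" assume f: "fin_supp f" "l2norm f \<le> 1"
  have Op: "Op a f y = (\<Sum>x\<in>X. mc a y x * f x)" for y
    using Op_eq_sum_mc[OF assms(2,1)] by simp
  have "Op a f y = 0" if "y \<notin> X" for y
  proof -
    have "run (letters w) y = None" if "w \<in> Poly_Mapping.keys a" for w
      using run_in[of "letters w" y] that \<open>y \<notin> X\<close> assms(2)
      by (cases "run (letters w) y") (auto simp: in_carrier_free_algebra)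
    then show ?thesis by (simp add: Op_def lin_ext_def)
  qed
  then have "l2norm (Op a f) = L2_set (\<lambda>y. cmod (Op a f y)) X"
    by (intro l2norm_superset assms) auto
  also have "\<dots> \<le> (\<Sum>y\<in>X. cmod (Op a f y))"
    by (rule L2_set_le_sum) simp
  also have "\<dots> \<le> (\<Sum>y\<in>X. \<Sum>x\<in>X. cmod (mc a y x))"
  proof (rule sum_mono)
    fix y
    have "cmod (Op a f y) \<le> (\<Sum>x\<in>X. cmod (mc a y x * f x))"
      unfolding Op by (rule norm_sum)
    also have "\<dots> \<le> (\<Sum>x\<in>X. cmod (mc a y x))"
      using order_trans[OF cmod_le_l2norm[OF f(1)] f(2)]
      by (intro sum_mono) (simp add: norm_mult mult_left_le)
    finally show "cmod (Op a f y) \<le> (\<Sum>x\<in>X. cmod (mc a y x))" .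
  qed
  finally show "l2norm (Op a f) \<le> (\<Sum>y\<in>X. \<Sum>x\<in>X. cmod (mc a y x))" .
qed

end

section \<open>Paths with a given range\<close>

text \<open>The empty list stands for the trivial path at \<open>w\<close>, whose source a list
  cannot record; therefore the range is carried along as a parameter.\<close>

definition path_src :: "('v, 'e) pre_digraph \<Rightarrow> 'v \<Rightarrow> 'e list \<Rightarrow> 'v" where
  "path_src E w \<mu> = (case \<mu> of [] \<Rightarrow> w | e # _ \<Rightarrow> tail E e)"

primrec path_to :: "('v, 'e) pre_digraph \<Rightarrow> 'v \<Rightarrow> 'e list \<Rightarrow> bool" where
  "path_to E w [] \<longleftrightarrow> w \<in> verts E"
| "path_to E w (e # \<mu>) \<longleftrightarrow> e \<in> arcs E \<and> head E e = path_src E w \<mu> \<and> path_to E w \<mu>"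

lemma path_src_simps [simp]: "path_src E w [] = w" "path_src E w (e # \<mu>) = tail E e"
  by (simp_all add: path_src_def)

lemma path_src_append: "path_src E w (\<mu> @ \<nu>) = path_src E (path_src E w \<nu>) \<mu>"
  by (cases \<mu>) simp_all

lemma path_to_arcs: "path_to E w \<mu> \<Longrightarrow> set \<mu> \<subseteq> arcs E"
  by (induction \<mu>) auto

context wf_digraph
begin

lemma path_src_in_verts: "path_to G w \<mu> \<Longrightarrow> path_src G w \<mu> \<in> verts G"
  by (cases \<mu>) auto

lemma path_to_range: "path_to G w \<mu> \<Longrightarrow> w \<in> verts G"
  by (induction \<mu>) auto

lemma path_to_append:
  "path_to G w (\<mu> @ \<nu>) \<longleftrightarrow> path_to G w \<nu> \<and> path_to G (path_src G w \<nu>) \<mu>"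
  by (induction \<mu>) (auto simp: path_src_append path_src_in_verts)

lemma path_to_iff_awalk: "path_to G w \<mu> \<and> path_src G w \<mu> = v \<longleftrightarrow> awalk v \<mu> w"
proof (induction \<mu> arbitrary: v)
  case Nil
  then show ?case by (auto simp: awalk_Nil_iff)
next
  case (Cons e \<mu>)
  have "path_to G w (e # \<mu>) \<and> path_src G w (e # \<mu>) = v \<longleftrightarrow>
      e \<in> arcs G \<and> v = tail G e \<and> path_to G w \<mu> \<and> path_src G w \<mu> = head G e"
    unfolding path_to.simps path_src_simps by metis
  also have "\<dots> \<longleftrightarrow> awalk v (e # \<mu>) w"
    unfolding awalk_Cons_iff Cons.IH ..
  finally show ?case .
qed

lemma reachable1_iff_path: "v \<rightarrow>\<^sup>+ w \<longleftrightarrow> (\<exists>\<mu>. path_to G w \<mu> \<and> path_src G w \<mu> = v \<and> \<mu> \<noteq> [])"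
proof -
  have "path_to G w \<mu> \<and> path_src G w \<mu> = v \<and> \<mu> \<noteq> [] \<longleftrightarrow> awalk v \<mu> w \<and> \<mu> \<noteq> []" for \<mu>
    using path_to_iff_awalk[of w \<mu> v] by blast
  then show ?thesis by (simp add: reachable1_awalk)
qed

lemma reachable_iff_path: "v \<rightarrow>\<^sup>* w \<longleftrightarrow> (\<exists>\<mu>. path_to G w \<mu> \<and> path_src G w \<mu> = v)"
  by (simp add: reachable_awalk path_to_iff_awalk)

text \<open>A closed walk of least length repeats no vertex, since the part between two visits could
  be cut out.\<close>

lemma shortest_closed_walk_is_cycle:
  assumes "x \<rightarrow>\<^sup>+ x"
  obtains p where "cycle p" "awalk x p x" "p \<noteq> []"
proof -
  have ex: "\<exists>p. awalk x p x \<and> p \<noteq> []" using assms by (simp add: reachable1_awalk)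
  define p where "p = (ARG_MIN length p. awalk x p x \<and> p \<noteq> [])"
  have p: "awalk x p x" "p \<noteq> []"
    using arg_min_natI[of "\<lambda>p. awalk x p x \<and> p \<noteq> []"] ex by (auto simp: p_def)
  have min: "length p \<le> length q" if "awalk x q x" "q \<noteq> []" for q
    using that unfolding p_def by (intro arg_min_nat_le) simp
  obtain e es where es: "p = e # es" using p by (cases p) auto
  have "distinct (tl (awalk_verts x p))"
  proof (rule ccontr)
    assume "\<not> distinct (tl (awalk_verts x p))"
    then have nd: "\<not> distinct (awalk_verts (head G e) es)" by (simp add: es)
    have aw: "awalk (head G e) es x" using p by (auto simp: es awalk_Cons_iff)
    \<comment> \<open>The cut is made behind the first edge \<open>e\<close>, so that the shortened
      walk is still nonempty and based at \<open>x\<close>.\<close>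
    obtain q r s w where q: "es = q @ r @ s" "0 < length r" "awalk (head G e) q w" "awalk w s x"
      using awalk_not_distinct_decomp[OF aw nd] by auto
    have "awalk x (e # q @ s) x"
      using p q by (auto simp: es awalk_Cons_iff)
    then have "length p \<le> length (e # q @ s)" by (rule min) simp
    then show False using q by (simp add: es)
  qed
  then have "cycle p" using p unfolding cycle_def by blast
  then show ?thesis using p that by blast
qed

text \<open>Replaces cycles by recurrence of a vertex, a property that is easier to propagate along
  paths.\<close>

lemma on_cycle_iff: "on_cycle G x \<longleftrightarrow> x \<rightarrow>\<^sup>+ x"
proof
  assume "x \<rightarrow>\<^sup>+ x"
  then obtain p where p: "cycle p" "awalk x p x" "p \<noteq> []" by (rule shortest_closed_walk_is_cycle)
  then have "tail G (hd p) = x" by (cases p) (auto simp: awalk_Cons_iff)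
  then show "on_cycle G x" using p unfolding on_cycle_def by (metis image_eqI list.set_sel(1))
next
  assume "on_cycle G x"
  then obtain p e u where p: "awalk u p u" "e \<in> set p" "tail G e = x"
    by (auto simp: on_cycle_def cycle_def)
  then obtain q r where qr: "p = q @ e # r" by (auto simp: in_set_conv_decomp)
  have "awalk u q x" "awalk x (e # r) u" using p by (auto simp: qr awalk_Cons_iff)
  then have "awalk x ((e # r) @ q) x" unfolding awalk_append_iff by blast
  then show "x \<rightarrow>\<^sup>+ x" unfolding reachable1_awalk by blast
qed

end

section \<open>Words modulo the Leavitt relations\<close>

abbreviation word :: "('v, 'e) graph_gen list \<Rightarrow> ('v, 'e, 'k::field) graph_free" where
  "word xs \<equiv> Poly_Mapping.single (Word xs) 1"

lemma word_append: "word (xs @ ys) = word xs * word ys"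
  by (simp add: Poly_Mapping.mult_single plus_free_monoid_def)

lemma word_Nil: "word [] = 1"
  by (simp flip: zero_free_monoid_def)

lemma word_in_carrier: "xs \<noteq> [] \<Longrightarrow> set xs \<subseteq> X \<Longrightarrow> word xs \<in> carrier (free_algebra X)"
  by (auto simp: zero_free_monoid_def intro!: single_in_carrier)

text \<open>The \<open>itself\<close> argument fixes the scalar field, which a list of letters does
  not determine.\<close>

definition word_null :: "('v, 'e) pre_digraph \<Rightarrow> 'k::field itself \<Rightarrow> ('v, 'e) graph_gen list \<Rightarrow> bool" where
  "word_null E _ xs \<longleftrightarrow> (word xs :: ('v, 'e, 'k) graph_free) \<in> leavitt_ideal E"

definition word_cong ::
    "('v, 'e) pre_digraph \<Rightarrow> 'k::field itself \<Rightarrow> ('v, 'e) graph_gen list \<Rightarrow> ('v, 'e) graph_gen list \<Rightarrow> bool" where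
  "word_cong E _ xs ys \<longleftrightarrow> word xs - (word ys :: ('v, 'e, 'k) graph_free) \<in> leavitt_ideal E"

context wf_digraph
begin

text \<open>The ideal absorbs elements of the algebra without unit, so empty contexts, whose
  \<open>word\<close> is 1, are treated separately.\<close>

lemma word_sandwich:
  assumes x: "x \<in> leavitt_ideal G" and l: "set l \<subseteq> graph_gens G" and r: "set r \<subseteq> graph_gens G"
  shows "word l * x * word r \<in> leavitt_ideal G"
proof -
  interpret quotient_alg "free_algebra (graph_gens G)" "leavitt_ideal G"
    by (rule quotient_alg_leavitt[OF wf_digraph])
  have *: "word l * x \<in> leavitt_ideal G"
  proof (cases "l = []")
    case False
    then show ?thesis by (rule I_mult_left[OF word_in_carrier[OF _ l] x])
  qed (simp add: word_Nil x)
  show ?thesis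
  proof (cases "r = []")
    case False
    then show ?thesis by (rule I_mult_right[OF word_in_carrier[OF _ r] *])
  qed (simp add: word_Nil *)
qed

context
  fixes K :: "'k::field itself"
begin

abbreviation word_eq (infix \<open>\<approx>\<close> 50) where "xs \<approx> ys \<equiv> word_cong G K xs ys"
abbreviation "null xs \<equiv> word_null G K xs"
abbreviation "lideal \<equiv> leavitt_ideal G :: ('a, 'b, 'k) graph_free set"

interpretation LI: quotient_alg "free_algebra (graph_gens G)" lideal
  by (rule quotient_alg_leavitt[OF wf_digraph])

lemma word_cong_refl [simp]: "xs \<approx> xs"
  by (simp add: word_cong_def LI.I_zero)

lemma word_cong_trans [trans]: "xs \<approx> ys \<Longrightarrow> ys \<approx> zs \<Longrightarrow> xs \<approx> zs"
  using LI.I_add[of "word xs - word ys" "word ys - word zs"] by (simp add: word_cong_def)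

lemma word_cong_sym: "xs \<approx> ys \<Longrightarrow> ys \<approx> xs"
  using LI.I_uminus[of "word xs - word ys"] by (simp add: word_cong_def)

lemma word_null_cong: "xs \<approx> ys \<Longrightarrow> null ys \<Longrightarrow> null xs"
  using LI.I_add[of "word xs - word ys" "word ys"] by (simp add: word_cong_def word_null_def)

lemma word_cong_ctxt:
  assumes "xs \<approx> ys" "set l \<subseteq> graph_gens G" "set r \<subseteq> graph_gens G"
  shows "l @ xs @ r \<approx> l @ ys @ r"
  using word_sandwich[OF assms(1)[unfolded word_cong_def] assms(2,3)]
  by (simp add: word_cong_def word_append algebra_simps)

lemma word_null_ctxt:
  assumes "null xs" "set l \<subseteq> graph_gens G" "set r \<subseteq> graph_gens G"
  shows "null (l @ xs @ r)"
  using word_sandwich[OF assms(1)[unfolded word_null_def] assms(2,3)]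
  by (simp add: word_null_def word_append algebra_simps)

lemma leavitt_rel_in_ideal: "r \<in> leavitt_relations G \<Longrightarrow> r \<in> lideal"
  by (rule subsetD[OF ideal_generated_superset])

lemma word_gens: "gen_p v * gen_p w = word [Vert v, Vert w]"
  "gen_p v * gen_s e = word [Vert v, Edge e]" "gen_s e * gen_p v = word [Edge e, Vert v]"
  "gen_p v * gen_s_star e = word [Vert v, Ghost e]" "gen_s_star e * gen_p v = word [Ghost e, Vert v]"
  "gen_s_star e * gen_s f = word [Ghost e, Edge f]" "gen_s e * gen_s_star f = word [Edge e, Ghost f]"
  by (simp_all add: gen_p_def gen_s_def gen_s_star_def Poly_Mapping.mult_single plus_free_monoid_def)

lemma Vert_Vert: "v \<in> verts G \<Longrightarrow> [Vert v, Vert v] \<approx> [Vert v]"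
proof -
  assume "v \<in> verts G"
  then have "gen_p v * gen_p v - (if v = v then gen_p v else 0) \<in> lideal"
    by (intro leavitt_rel_in_ideal) (unfold leavitt_relations_def, blast)
  then show ?thesis by (simp add: word_cong_def word_gens) (simp add: gen_p_def)
qed

lemma Vert_Vert_null: "v \<in> verts G \<Longrightarrow> w \<in> verts G \<Longrightarrow> v \<noteq> w \<Longrightarrow> null [Vert v, Vert w]"
proof -
  assume "v \<in> verts G" "w \<in> verts G" and "v \<noteq> w"
  then have "gen_p v * gen_p w - (if v = w then gen_p v else 0) \<in> lideal"
    by (intro leavitt_rel_in_ideal) (unfold leavitt_relations_def, blast)
  then show ?thesis using \<open>v \<noteq> w\<close> by (simp add: word_null_def word_gens)
qed

lemma Vert_Edge: "e \<in> arcs G \<Longrightarrow> [Vert (tail G e), Edge e] \<approx> [Edge e]"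
proof -
  assume "e \<in> arcs G"
  then have "gen_p (tail G e) * gen_s e - gen_s e \<in> lideal"
    by (intro leavitt_rel_in_ideal) (unfold leavitt_relations_def, blast)
  then show ?thesis by (simp add: word_cong_def word_gens) (simp add: gen_s_def)
qed

lemma Edge_Vert: "e \<in> arcs G \<Longrightarrow> [Edge e, Vert (head G e)] \<approx> [Edge e]"
proof -
  assume "e \<in> arcs G"
  then have "gen_s e * gen_p (head G e) - gen_s e \<in> lideal"
    by (intro leavitt_rel_in_ideal) (unfold leavitt_relations_def, blast)
  then show ?thesis by (simp add: word_cong_def word_gens) (simp add: gen_s_def)
qed

lemma Vert_Ghost: "e \<in> arcs G \<Longrightarrow> [Vert (head G e), Ghost e] \<approx> [Ghost e]"
proof -
  assume "e \<in> arcs G"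
  then have "gen_p (head G e) * gen_s_star e - gen_s_star e \<in> lideal"
    by (intro leavitt_rel_in_ideal) (unfold leavitt_relations_def, blast)
  then show ?thesis by (simp add: word_cong_def word_gens) (simp add: gen_s_star_def)
qed

lemma Ghost_Vert: "e \<in> arcs G \<Longrightarrow> [Ghost e, Vert (tail G e)] \<approx> [Ghost e]"
proof -
  assume "e \<in> arcs G"
  then have "gen_s_star e * gen_p (tail G e) - gen_s_star e \<in> lideal"
    by (intro leavitt_rel_in_ideal) (unfold leavitt_relations_def, blast)
  then show ?thesis by (simp add: word_cong_def word_gens) (simp add: gen_s_star_def)
qed

lemma Ghost_Edge: "e \<in> arcs G \<Longrightarrow> [Ghost e, Edge e] \<approx> [Vert (head G e)]"
proof -
  assume "e \<in> arcs G"
  then have "gen_s_star e * gen_s e - (if e = e then gen_p (head G e) else 0) \<in> lideal"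
    by (intro leavitt_rel_in_ideal) (unfold leavitt_relations_def, blast)
  then show ?thesis by (simp add: word_cong_def word_gens) (simp add: gen_p_def)
qed

lemma Ghost_Edge_null: "e \<in> arcs G \<Longrightarrow> f \<in> arcs G \<Longrightarrow> e \<noteq> f \<Longrightarrow> null [Ghost e, Edge f]"
proof -
  assume "e \<in> arcs G" "f \<in> arcs G" and "e \<noteq> f"
  then have "gen_s_star e * gen_s f - (if e = f then gen_p (head G e) else 0) \<in> lideal"
    by (intro leavitt_rel_in_ideal) (unfold leavitt_relations_def, blast)
  then show ?thesis using \<open>e \<noteq> f\<close> by (simp add: word_null_def word_gens)
qed

lemma gens_Vert: "v \<in> verts G \<Longrightarrow> Vert v \<in> graph_gens G"
  and gens_Edge: "e \<in> arcs G \<Longrightarrow> Edge e \<in> graph_gens G"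
  and gens_Ghost: "e \<in> arcs G \<Longrightarrow> Ghost e \<in> graph_gens G"
  by (simp_all add: graph_gens_def)

lemma path_gens:
  assumes "path_to G w \<mu>"
  shows "set (map Edge \<mu>) \<subseteq> graph_gens G" "set (map Ghost \<mu>) \<subseteq> graph_gens G" "Vert w \<in> graph_gens G"
    "Vert (path_src G w \<mu>) \<in> graph_gens G"
  using path_to_arcs[OF assms] path_to_range[OF assms] path_src_in_verts[OF assms] by (auto simp: graph_gens_def)

text \<open>The letter \<open>Vert w\<close> makes the trivial path uniform with the others: for
  empty \<open>\<nu>\<close> the congruence is idempotence of p_w.\<close>

lemma path_absorb_src:
  assumes "path_to G w \<nu>" and r: "set r \<subseteq> graph_gens G"
  shows "Vert (path_src G w \<nu>) # map Edge \<nu> @ Vert w # r \<approx> map Edge \<nu> @ Vert w # r"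
proof (cases \<nu>)
  case Nil
  then show ?thesis
    using assms word_cong_ctxt[OF Vert_Vert, of w "[]" r] by simp
next
  case (Cons f \<nu>')
  then show ?thesis
    using assms word_cong_ctxt[OF Vert_Edge, of f "[]" "map Edge \<nu>' @ Vert w # r"] path_gens[of w \<nu>'] by simp
qed

lemma path_kill_src:
  assumes "path_to G w \<nu>" and r: "set r \<subseteq> graph_gens G" and v: "v \<in> verts G" "v \<noteq> path_src G w \<nu>"
  shows "null (Vert v # map Edge \<nu> @ Vert w # r)"
proof -
  let ?u = "path_src G w \<nu>" and ?r = "map Edge \<nu> @ Vert w # r"
  note g = path_gens[OF assms(1)]
  have "Vert v # Vert ?u # ?r \<approx> Vert v # ?r"
    using word_cong_ctxt[OF path_absorb_src[OF assms(1,2)], of "[Vert v]" "[]"] v gens_Vert by simp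
  moreover have "null (Vert v # Vert ?u # ?r)"
    using word_null_ctxt[OF Vert_Vert_null, of v ?u "[]" ?r] v path_src_in_verts[OF assms(1)] g r by simp
  ultimately show ?thesis by (metis word_cong_sym word_null_cong)
qed

text \<open>The first edge of \<open>\<mu>\<close> and its ghost meet in the middle of the word;
  they collapse to a vertex that the rest of the path absorbs.\<close>

lemma Ghost_path_cancel:
  assumes "path_to G w \<mu>" "set r \<subseteq> graph_gens G"
  shows "map Ghost (rev \<mu>) @ map Edge \<mu> @ Vert w # r \<approx> Vert w # r"
  using assms
proof (induction \<mu>)
  case Nil
  then show ?case by simp
next
  case (Cons e \<mu>)
  let ?r = "map Edge \<mu> @ Vert w # r" and ?l = "map Ghost (rev \<mu>)"
  have p: "path_to G w \<mu>" "e \<in> arcs G" "head G e = path_src G w \<mu>" using Cons.prems by auto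
  have gr: "set ?r \<subseteq> graph_gens G" and gl: "set ?l \<subseteq> graph_gens G"
    using path_gens[OF p(1)] Cons.prems by auto
  have "?l @ [Ghost e, Edge e] @ ?r \<approx> ?l @ [Vert (path_src G w \<mu>)] @ ?r"
    using word_cong_ctxt[OF Ghost_Edge[OF p(2)] gl gr] by (simp add: p(3))
  also have "?l @ [Vert (path_src G w \<mu>)] @ ?r \<approx> ?l @ ?r"
    using word_cong_ctxt[OF path_absorb_src[OF p(1), of r] gl, of "[]"] Cons.prems by simp
  also have "?l @ ?r \<approx> Vert w # r" by (rule Cons.IH) (use p Cons.prems in auto)
  finally show ?case by simp
qed

text \<open>Cancelling the common prefix of two incomparable paths leaves a factor s_e^* s_f with
  different edges.\<close>

lemma Ghost_path_null:
  assumes "path_to G v \<mu>" "path_to G w \<nu>" "set r \<subseteq> graph_gens G" "\<not> prefix \<mu> \<nu>" "\<not> prefix \<nu> \<mu>"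
  shows "null (map Ghost (rev \<mu>) @ map Edge \<nu> @ Vert w # r)"
  using assms
proof (induction \<mu> arbitrary: \<nu>)
  case Nil
  then show ?case by simp
next
  case (Cons e \<mu>)
  obtain f \<nu>' where \<nu>: "\<nu> = f # \<nu>'" using Cons.prems by (cases \<nu>) auto
  let ?r = "map Edge \<nu>' @ Vert w # r" and ?l = "map Ghost (rev \<mu>)"
  have p: "path_to G v \<mu>" "e \<in> arcs G" "path_to G w \<nu>'" "f \<in> arcs G" "head G f = path_src G w \<nu>'"
    using Cons.prems by (auto simp: \<nu>)
  have gr: "set ?r \<subseteq> graph_gens G" and gl: "set ?l \<subseteq> graph_gens G"
    using path_gens[OF p(1)] path_gens[OF p(3)] Cons.prems by auto
  show ?case
  proof (cases "e = f")
    case False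
    then show ?thesis using word_null_ctxt[OF Ghost_Edge_null gl gr] p by (simp add: \<nu>)
  next
    case True
    have "?l @ [Ghost e, Edge e] @ ?r \<approx> ?l @ [Vert (path_src G w \<nu>')] @ ?r"
      using word_cong_ctxt[OF Ghost_Edge[OF p(2)] gl gr] p True by simp
    also have "?l @ [Vert (path_src G w \<nu>')] @ ?r \<approx> ?l @ ?r"
      using word_cong_ctxt[OF path_absorb_src[OF p(3), of r] gl, of "[]"] Cons.prems by simp
    finally have "?l @ [Ghost e, Edge e] @ ?r \<approx> ?l @ ?r" .
    moreover have "null (?l @ ?r)"
      by (rule Cons.IH) (use p Cons.prems True in \<open>auto simp: \<nu>\<close>)
    ultimately show ?thesis using word_null_cong by (simp add: \<nu> True)
  qed
qed

end

end

section \<open>Necessity of the graph conditions\<close>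

text \<open>If every A_i B_i had a nonzero entry (r_i, c_i), then column c_j of B_j, for j = 0, ...,
  n, would give n + 1 linearly independent vectors of K^n, because row r_i of A_i annihilates all of
  them except the i-th.\<close>

lemma biorthogonal_matrices:
  fixes A B :: "nat \<Rightarrow> 'k::field mat"
  assumes A: "\<And>i. i \<le> n \<Longrightarrow> A i \<in> carrier_mat n n" and B: "\<And>i. i \<le> n \<Longrightarrow> B i \<in> carrier_mat n n"
    and ortho: "\<And>i j. i \<le> n \<Longrightarrow> j \<le> n \<Longrightarrow> i \<noteq> j \<Longrightarrow> A i * B j = 0\<^sub>m n n"
  shows "\<exists>i\<le>n. A i * B i = 0\<^sub>m n n"
proof (rule ccontr)
  assume *: "\<not> ?thesis"
  have "\<exists>r c. r < n \<and> c < n \<and> (A i * B i) $$ (r, c) \<noteq> 0" if "i \<le> n" for i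
    using * A[OF that] B[OF that] that by (force simp: mat_eq_iff)
  then obtain r c where rc: "\<And>i. i \<le> n \<Longrightarrow> r i < n \<and> c i < n \<and> (A i * B i) $$ (r i, c i) \<noteq> 0"
    by metis
  \<comment> \<open>A zero row completes the n + 1 columns to a square matrix, so that the linear
    dependence comes from a vanishing determinant.\<close>
  define U where "U = mat (Suc n) (Suc n) (\<lambda>(k, j). if k < n then B j $$ (k, c j) else 0)"
  have U: "U \<in> carrier_mat (Suc n) (Suc n)" by (simp add: U_def)
  have "det U = 0"
  proof -
    have "U = mat\<^sub>r (Suc n) (Suc n) (\<lambda>i. if i = n then 0\<^sub>v (Suc n) else row U i)"
      by (rule eq_matI) (auto simp: U_def)
    moreover have "row U \<in> {0..<Suc n} \<rightarrow> carrier_vec (Suc n)" using U by (auto simp: row_def)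
    ultimately show ?thesis using det_row_0[of n "Suc n" "row U"] by simp
  qed
  then obtain v where v: "v \<in> carrier_vec (Suc n)" "v \<noteq> 0\<^sub>v (Suc n)" "U *\<^sub>v v = 0\<^sub>v (Suc n)"
    using det_0_iff_vec_prod_zero_field[OF U] by auto
  have Uv: "(\<Sum>j\<le>n. B j $$ (k, c j) * v $ j) = 0" if "k < n" for k
  proof -
    have "(U *\<^sub>v v) $ k = (\<Sum>j\<in>{0..<Suc n}. U $$ (k, j) * v $ j)"
      using U v(1) that by (simp add: scalar_prod_def)
    also have "\<dots> = (\<Sum>j\<in>{0..<Suc n}. B j $$ (k, c j) * v $ j)"
      using that by (intro sum.cong) (auto simp: U_def)
    finally show ?thesis using v(3) that by (simp add: atLeast0LessThan lessThan_Suc_atMost)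
  qed
  have "v $ i = 0" if i: "i \<le> n" for i
  proof -
    have AB: "(A i * B j) $$ (r i, c j) = (\<Sum>k\<in>{0..<n}. A i $$ (r i, k) * B j $$ (k, c j))" if "j \<le> n" for j
      using A[OF i] B[OF that] rc[OF i] rc[OF that] by (simp add: scalar_prod_def)
    have "0 = (\<Sum>k\<in>{0..<n}. A i $$ (r i, k) * (\<Sum>j\<le>n. B j $$ (k, c j) * v $ j))"
      using Uv by simp
    also have "\<dots> = (\<Sum>j\<le>n. (\<Sum>k\<in>{0..<n}. A i $$ (r i, k) * B j $$ (k, c j)) * v $ j)"
      by (simp add: sum_distrib_left sum_distrib_right mult.assoc) (rule sum.swap)
    also have "\<dots> = (\<Sum>j\<le>n. (A i * B j) $$ (r i, c j) * v $ j)"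
      using AB by (intro sum.cong) auto
    also have "\<dots> = (\<Sum>j\<le>n. if j = i then (A i * B i) $$ (r i, c i) * v $ i else 0)"
      using ortho[OF i] rc i by (intro sum.cong) auto
    also have "\<dots> = (A i * B i) $$ (r i, c i) * v $ i"
      using i by simp
    finally show "v $ i = 0" using rc[OF i] by simp
  qed
  then have "v = 0\<^sub>v (Suc n)" using v(1) by (intro eq_vecI) auto
  then show False using v by simp
qed

text \<open>Stated on the free algebra, so that representations of the Leavitt path algebra and of
  the graph C*-algebra both provide one by pullback.\<close>

definition leavitt_rep :: "('v, 'e) pre_digraph \<Rightarrow> nat \<Rightarrow> (('v, 'e, 'k::field) graph_free \<Rightarrow> 'k mat) \<Rightarrow> bool" where
  "leavitt_rep E n \<phi> \<longleftrightarrow> fin_dim_rep (free_algebra (graph_gens E)) n \<phi> \<and> (\<forall>x\<in>leavitt_ideal E. \<phi> x = 0\<^sub>m n n)"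

context wf_digraph
begin

context
  fixes n and \<phi> :: "('a, 'b, 'k::field) graph_free \<Rightarrow> 'k mat"
  assumes rep: "leavitt_rep G n \<phi>"
begin

interpretation LI: quotient_alg "free_algebra (graph_gens G)" "leavitt_ideal G :: ('a, 'b, 'k) graph_free set"
  by (rule quotient_alg_leavitt[OF wf_digraph])

lemma rep_carrier: "a \<in> carrier (free_algebra (graph_gens G)) \<Longrightarrow> \<phi> a \<in> carrier_mat n n"
  and rep_add: "a \<in> carrier (free_algebra (graph_gens G)) \<Longrightarrow> b \<in> carrier (free_algebra (graph_gens G)) \<Longrightarrow>
    \<phi> (a + b) = \<phi> a + \<phi> b"
  and rep_mult: "a \<in> carrier (free_algebra (graph_gens G)) \<Longrightarrow> b \<in> carrier (free_algebra (graph_gens G)) \<Longrightarrow>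
    \<phi> (a * b) = \<phi> a * \<phi> b"
  and rep_ideal: "x \<in> leavitt_ideal G \<Longrightarrow> \<phi> x = 0\<^sub>m n n"
  using rep unfolding leavitt_rep_def fin_dim_rep_def by simp_all

lemma rep_eq:
  assumes "x - y \<in> leavitt_ideal G" "x \<in> carrier (free_algebra (graph_gens G))" "y \<in> carrier (free_algebra (graph_gens G))"
  shows "\<phi> x = \<phi> y"
  using LI.fin_dim_rep_diff[of n \<phi> x y] rep assms by (simp add: leavitt_rep_def)

lemma rep_word_append:
  assumes "xs \<noteq> []" "ys \<noteq> []" "set xs \<subseteq> graph_gens G" "set ys \<subseteq> graph_gens G"
  shows "\<phi> (word xs) * \<phi> (word ys) = \<phi> (word (xs @ ys))"
  using assms by (simp add: word_append rep_mult word_in_carrier)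

text \<open>The matrices of p_w s_\<mu>^* and s_\<mu> p_w, for n + 1 of the paths, are biorthogonal,
  and all diagonal products equal the matrix of p_w.\<close>

lemma rep_incomparable_paths:
  assumes paths: "\<And>i::nat. path_to G w (\<mu> i)" and incomp: "\<And>i j. i \<noteq> j \<Longrightarrow> \<not> prefix (\<mu> i) (\<mu> j)"
  shows "\<phi> (gen_p w) = 0\<^sub>m n n"
proof -
  define A where "A i = \<phi> (word (Vert w # map Ghost (rev (\<mu> i))))" for i
  define B where "B i = \<phi> (word (map Edge (\<mu> i) @ [Vert w]))" for i
  have gA: "set (Vert w # map Ghost (rev (\<mu> i))) \<subseteq> graph_gens G" for i
    using path_gens[OF paths[of i]] by simp
  have gB: "set (map Edge (\<mu> i) @ [Vert w]) \<subseteq> graph_gens G" for i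
    using path_gens[OF paths[of i]] by simp
  have AB: "A i * B j = \<phi> (word (Vert w # map Ghost (rev (\<mu> i)) @ map Edge (\<mu> j) @ [Vert w]))" for i j
    unfolding A_def B_def using gA gB by (subst rep_word_append) auto
  have carrier: "A i \<in> carrier_mat n n" "B i \<in> carrier_mat n n" for i
    unfolding A_def B_def by (intro rep_carrier word_in_carrier gA gB; simp)+
  have "A i * B j = 0\<^sub>m n n" if "i \<noteq> j" for i j
  proof -
    have "word_null G TYPE('k) (map Ghost (rev (\<mu> i)) @ map Edge (\<mu> j) @ [Vert w])"
      using that incomp by (intro Ghost_path_null[OF paths[of i] paths[of j]]) auto
    then have "word_null G TYPE('k) (Vert w # map Ghost (rev (\<mu> i)) @ map Edge (\<mu> j) @ [Vert w])"
      using word_null_ctxt[where K = "TYPE('k)" and l = "[Vert w]" and r = "[]"] path_gens[OF paths[of i]] by fastforce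
    then show ?thesis unfolding AB by (simp add: word_null_def rep_ideal)
  qed
  then obtain i where "A i * B i = 0\<^sub>m n n"
    using biorthogonal_matrices[of n A B] carrier by blast
  moreover have "A i * B i = \<phi> (gen_p w)"
  proof -
    have "word_cong G TYPE('k) (map Ghost (rev (\<mu> i)) @ map Edge (\<mu> i) @ [Vert w]) [Vert w]"
      by (rule Ghost_path_cancel[OF paths]) simp
    then have "word_cong G TYPE('k) (Vert w # map Ghost (rev (\<mu> i)) @ map Edge (\<mu> i) @ [Vert w]) [Vert w, Vert w]"
      using word_cong_ctxt[where K = "TYPE('k)" and l = "[Vert w]" and r = "[]"] path_gens[OF paths[of i]] by fastforce
    also have "word_cong G TYPE('k) [Vert w, Vert w] [Vert w]"
      by (rule Vert_Vert[OF path_to_range[OF paths]])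
    finally show ?thesis
      unfolding AB gen_p_def word_cong_def using path_gens[OF paths[of i]]
      by (intro rep_eq word_in_carrier) auto
  qed
  ultimately show ?thesis by simp
qed

lemma rep_sum_zero:
  assumes "\<And>i. i \<in> S \<Longrightarrow> \<phi> (f i) = 0\<^sub>m n n \<and> f i \<in> carrier (free_algebra (graph_gens G))"
  shows "\<phi> (sum f S) = 0\<^sub>m n n"
  using assms
proof (induction S rule: infinite_finite_induct)
  case (insert x F)
  then have "\<phi> (f x + sum f F) = \<phi> (f x) + \<phi> (sum f F)"
    by (intro rep_add sum_in_carrier) auto
  then show ?case using insert by simp
qed (simp_all add: rep_ideal LI.I_zero)

text \<open>As s_e = s_e p_{r(e)}, vanishing at all successors would make every summand of p_v
  vanish.\<close>

lemma rep_regular_successor: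
  assumes v: "regular_vertex G v" and nz: "\<phi> (gen_p v) \<noteq> 0\<^sub>m n n"
  shows "\<exists>e\<in>out_arcs G v. \<phi> (gen_p (head G e)) \<noteq> 0\<^sub>m n n"
proof (rule ccontr)
  assume *: "\<not> ?thesis"
  have "\<phi> (gen_s e * gen_s_star e) = 0\<^sub>m n n \<and> (gen_s e * gen_s_star e :: ('a, 'b, 'k) graph_free) \<in> carrier (free_algebra (graph_gens G))"
    if e: "e \<in> out_arcs G v" for e
  proof -
    have c: "(gen_s e :: ('a, 'b, 'k) graph_free) \<in> carrier (free_algebra (graph_gens G))"
      "(gen_s_star e :: ('a, 'b, 'k) graph_free) \<in> carrier (free_algebra (graph_gens G))"
      "(gen_p (head G e) :: ('a, 'b, 'k) graph_free) \<in> carrier (free_algebra (graph_gens G))"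
      using e by (auto intro: gen_in_carrier)
    have "\<phi> (gen_s e) = \<phi> (gen_s e * gen_p (head G e))"
      using e c by (intro rep_eq[symmetric] subsetD[OF ideal_generated_superset] mult_in_carrier)
        (auto simp: leavitt_relations_def)
    also have "\<dots> = 0\<^sub>m n n" using * e c right_mult_zero_mat[OF rep_carrier[OF c(1)]] by (simp add: rep_mult)
    finally show ?thesis using c left_mult_zero_mat[OF rep_carrier[OF c(2)]] by (simp add: rep_mult mult_in_carrier[OF c(1,2)])
  qed
  then have "\<phi> (\<Sum>e\<in>out_arcs G v. gen_s e * gen_s_star e) = 0\<^sub>m n n"
    by (rule rep_sum_zero)
  moreover have "\<phi> (gen_p v) = \<phi> (\<Sum>e\<in>out_arcs G v. gen_s e * gen_s_star e)"
  proof (rule rep_eq)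
    have "gen_p v - (\<Sum>e\<in>out_arcs G v. gen_s e * gen_s_star e) \<in> leavitt_relations G"
      using v unfolding leavitt_relations_def by blast
    then show "gen_p v - (\<Sum>e\<in>out_arcs G v. gen_s e * gen_s_star e) \<in> leavitt_ideal G"
      by (rule subsetD[OF ideal_generated_superset])
    show "gen_p v \<in> carrier (free_algebra (graph_gens G))"
      using v by (intro gen_in_carrier) (simp add: regular_vertex_def)
    show "(\<Sum>e\<in>out_arcs G v. gen_s e * gen_s_star e) \<in> carrier (free_algebra (graph_gens G))"
      by (intro sum_in_carrier mult_in_carrier gen_in_carrier) auto
  qed
  ultimately show False using nz by simp
qed

text \<open>A matrix algebra of size n has no room for n + 1 nonzero pairwise orthogonal
  idempotents.\<close>

lemma rep_distinct_vertices:
  assumes "inj v" "\<And>i::nat. v i \<in> verts G" "\<And>i. \<phi> (gen_p (v i)) \<noteq> 0\<^sub>m n n"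
  shows False
proof -
  have c: "(gen_p (v i) :: ('a, 'b, 'k) graph_free) \<in> carrier (free_algebra (graph_gens G))" for i
    using assms by (intro gen_in_carrier)
  have "\<exists>i\<le>n. \<phi> (gen_p (v i)) * \<phi> (gen_p (v i)) = 0\<^sub>m n n"
  proof (rule biorthogonal_matrices)
    fix i j :: nat assume "i \<noteq> j"
    then have "v i \<noteq> v j" using assms(1) by (auto dest: injD)
    then have "word_null G TYPE('k) [Vert (v i), Vert (v j)]"
      using assms(2) by (intro Vert_Vert_null) auto
    then show "\<phi> (gen_p (v i)) * \<phi> (gen_p (v j)) = 0\<^sub>m n n"
      using c by (simp add: word_null_def rep_ideal flip: rep_mult word_gens)
  qed (auto intro: rep_carrier c)
  then obtain i where i: "\<phi> (gen_p (v i)) * \<phi> (gen_p (v i)) = 0\<^sub>m n n" by blast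
  have "\<phi> (gen_p (v i) * gen_p (v i)) = \<phi> (gen_p (v i))"
    unfolding word_gens using Vert_Vert[OF assms(2)[of i], where K = "TYPE('k)"] c[of i] assms(2)[of i]
    by (intro rep_eq word_in_carrier) (auto simp: word_cong_def gen_p_def graph_gens_def)
  then show False using i assms(3)[of i] c by (simp add: rep_mult)
qed

end

theorem bellier_necessary:
  assumes reps: "\<And>v. v \<in> verts G \<Longrightarrow>
    \<exists>n. \<exists>\<phi> :: ('a, 'b, 'k::field) graph_free \<Rightarrow> 'k mat. leavitt_rep G n \<phi> \<and> \<phi> (gen_p v) \<noteq> 0\<^sub>m n n"
  shows "bellier_conditions G"
proof -
  have no_family: False
    if "\<And>i::nat. path_to G w (\<mu> i)" "\<And>i j. i \<noteq> j \<Longrightarrow> \<not> prefix (\<mu> i) (\<mu> j)" for w \<mu>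
    using reps[OF path_to_range[OF that(1)]] rep_incomparable_paths[of _ _ w \<mu>] that by blast
  have "\<not> infinite_receiver G v" for v
  proof
    assume "infinite_receiver G v"
    then obtain e :: "nat \<Rightarrow> 'b" where e: "inj e" "range e \<subseteq> in_arcs G v"
      unfolding infinite_receiver_def using infinite_countable_subset by blast
    have v: "v \<in> verts G" using \<open>infinite_receiver G v\<close> by (simp add: infinite_receiver_def)
    show False
    proof (rule no_family[of v "\<lambda>i. [e i]"])
      show "path_to G v [e i]" for i using e v by (auto simp: subset_eq)
      show "\<not> prefix [e i] [e j]" if "i \<noteq> j" for i j using e that by (auto dest: injD)
    qed
  qed
  moreover have "\<not> infinite_backward_chain G e" for e
  proof
    assume "infinite_backward_chain G e"
    then have e: "\<And>i. e i \<in> arcs G" "inj e" "\<And>i. tail G (e i) = head G (e (Suc i))"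
      by (auto simp: infinite_backward_chain_def)
    \<comment> \<open>The paths e_i ... e_0 have the range of e_0 in common, and their first edges
      are pairwise distinct.\<close>
    define \<mu> where "\<mu> i = rev (map e [0..<Suc i])" for i
    have \<mu>: "\<mu> 0 = [e 0]" "\<mu> (Suc i) = e (Suc i) # \<mu> i" for i
      by (simp_all add: \<mu>_def)
    have hd: "hd (\<mu> i) = e i \<and> \<mu> i \<noteq> []" for i
      by (cases i) (simp_all add: \<mu>)
    have "path_to G (head G (e 0)) (\<mu> i) \<and> path_src G (head G (e 0)) (\<mu> i) = tail G (e i)" for i
      by (induction i) (simp_all add: \<mu> e)
    moreover have "\<not> prefix (\<mu> i) (\<mu> j)" if "i \<noteq> j" for i j
      using hd[of i] hd[of j] e(2) that by (metis hd_append2 injD prefix_def)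
    ultimately show False using no_family by blast
  qed
  moreover have "\<not> cycle_exit G p f" if cyc: "cycle p" for p f
  proof
    assume exit: "cycle_exit G p f"
    then obtain i where f: "f \<in> arcs G" and i: "i < length p" "tail G f = head G (p ! i)"
      "f \<noteq> p ! (Suc i mod length p)"
      by (auto simp: cycle_exit_def)
    obtain u where u: "awalk u p u" "p \<noteq> []" using cyc by (auto simp: cycle_def)
    define q r where "q = take (Suc i) p" and "r = drop (Suc i) p"
    have p: "p = q @ r" by (simp add: q_def r_def)
    have q: "q \<noteq> []" "last q = p ! i" using i by (auto simp: q_def take_Suc_conv_app_nth)
    obtain x where x: "awalk u q x" "awalk x r u" using u by (auto simp: p)
    have x_eq: "x = tail G f" using x(1) q i
      by (metis awalk_verts_conv awalk_conv awlast_if_cas last_snoc)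
    \<comment> \<open>The cycle is rotated so that it starts at the source of the exit
      \<open>f\<close>. Its first edge then differs from \<open>f\<close>, which makes the paths c^k
      f pairwise incomparable.\<close>
    define c where "c = r @ q"
    have c: "path_to G x c" "path_src G x c = x" "c \<noteq> []"
      using x q path_to_iff_awalk[of x c x] by (auto simp: c_def)
    have "hd c = p ! (Suc i mod length p)"
    proof (cases "Suc i = length p")
      case True
      then show ?thesis using u by (simp add: c_def q_def r_def hd_conv_nth)
    next
      case False
      then show ?thesis using i by (simp add: c_def r_def hd_append hd_drop_conv_nth)
    qed
    then have hd: "hd c \<noteq> f" using i by simp
    define \<mu> where "\<mu> k = concat (replicate k c) @ [f]" for k
    have "path_to G (head G f) (\<mu> k) \<and> path_src G (head G f) (\<mu> k) = x" for k
      using c f by (induction k) (auto simp: \<mu>_def path_to_append path_src_append x_eq)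
    moreover have "\<not> prefix (\<mu> i) (\<mu> j)" if ij: "i \<noteq> j" for i j
    proof -
      \<comment> \<open>After cancellation of the common powers of \<open>c\<close>, only f itself
        remains to be compared with c^(k+1) f.\<close>
      have *: "\<not> prefix [f] (concat (replicate (Suc k) c) @ [f])" "\<not> prefix (concat (replicate (Suc k) c) @ [f]) [f]" for k
        using hd c(3) by (cases c; simp)+
      show ?thesis
      proof (cases "i < j")
        case True
        then obtain k where "j = i + Suc k" using less_imp_Suc_add by auto
        then have "\<mu> j = concat (replicate i c) @ concat (replicate (Suc k) c) @ [f]"
          by (simp only: \<mu>_def replicate_add concat_append append_assoc)
        then show ?thesis using *(1)[of k] by (simp add: \<mu>_def)
      next
        case False
        then obtain k where "i = j + Suc k" using ij less_imp_Suc_add[of j i] by auto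
        then have "\<mu> i = concat (replicate j c) @ concat (replicate (Suc k) c) @ [f]"
          by (simp only: \<mu>_def replicate_add concat_append append_assoc)
        then show ?thesis using *(2)[of k] c(3) by (simp add: \<mu>_def)
      qed
    qed
    ultimately show False using no_family by blast
  qed
  moreover have "\<exists>w. v \<rightarrow>\<^sup>* w \<and> (sink G w \<or> on_cycle G w \<or> infinite_emitter G w)" if v: "v \<in> verts G" for v
  proof (rule ccontr)
    assume *: "\<not> ?thesis"
    obtain n and \<phi> :: "('a, 'b, 'k) graph_free \<Rightarrow> 'k mat" where rep: "leavitt_rep G n \<phi>" "\<phi> (gen_p v) \<noteq> 0\<^sub>m n n"
      using reps[OF v] by blast
    define P where "P (i::nat) x \<longleftrightarrow> v \<rightarrow>\<^sup>* x \<and> \<phi> (gen_p x) \<noteq> 0\<^sub>m n n" for i x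
    have "\<exists>y. P (Suc i) y \<and> x \<rightarrow>\<^bsub>G\<^esub> y" if "P i x" for i x
    proof -
      have x: "v \<rightarrow>\<^sup>* x" "\<phi> (gen_p x) \<noteq> 0\<^sub>m n n" using that by (auto simp: P_def)
      then have "regular_vertex G x"
        using * reachable_in_verts by (auto simp: regular_vertex_def sink_def infinite_emitter_def)
      then obtain e where "e \<in> out_arcs G x" "\<phi> (gen_p (head G e)) \<noteq> 0\<^sub>m n n"
        using rep_regular_successor[OF rep(1)] x by blast
      moreover then have "x \<rightarrow>\<^bsub>G\<^esub> head G e" by (auto simp: arcs_ends_conv)
      ultimately show ?thesis using x(1) by (auto simp: P_def intro: reachable_adj_trans)
    qed
    moreover have "P 0 v" using rep v by (simp add: P_def)
    ultimately obtain x where x: "x 0 = v" "\<And>i. P i (x i)" "\<And>i. x i \<rightarrow>\<^bsub>G\<^esub> x (Suc i)"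
      using dependent_nat_choice[of "\<lambda>i x. P i x \<and> (i = 0 \<longrightarrow> x = v)" "\<lambda>_ a b. a \<rightarrow>\<^bsub>G\<^esub> b"]
      by (metis Zero_not_Suc)
    have step: "x i \<rightarrow>\<^sup>+ x j" if "i < j" for i j
      using that by (induction j) (auto simp: less_Suc_eq intro: x(3) trancl_into_trancl)
    \<comment> \<open>A repetition would put a vertex reached from \<open>v\<close> on a cycle. So
      the chain consists of infinitely many distinct vertices with nonzero idempotents, too many for
      dimension \<open>n\<close>.\<close>
    have "x i \<noteq> x j" if "i < j" for i j
    proof
      assume "x i = x j"
      then have "on_cycle G (x i)" using step[OF that] by (simp add: on_cycle_iff)
      then show False using * x(2)[of i] by (auto simp: P_def)
    qed
    then have "inj x" by (metis injI linorder_neqE_nat)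
    moreover have "x i \<in> verts G" for i using x(2)[of i] reachable_in_verts(2) by (auto simp: P_def)
    ultimately show False
      using rep_distinct_vertices[OF rep(1), of x] x(2) by (auto simp: P_def)
  qed
  ultimately show ?thesis unfolding bellier_conditions_def by blast
qed

end

section \<open>Branching systems of paths\<close>

text \<open>
  For \<open>d = []\<close> these are all paths ending at the non-regular vertex \<open>w\<close>. For a closed path \<open>d\<close>
  at \<open>w\<close> they are the paths ending at \<open>w\<close> modulo \<open>\<mu> d \<sim> \<mu>\<close>; each class contains exactly
  one path without the suffix \<open>d\<close>.
\<close>

definition path_space :: "('v, 'e) pre_digraph \<Rightarrow> 'v \<Rightarrow> 'e list \<Rightarrow> 'e list set" where
  "path_space E w d = {\<mu>. path_to E w \<mu> \<and> (d \<noteq> [] \<longrightarrow> \<not> suffix d \<mu>)}"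

text \<open>Prepending the edge that completes \<open>d\<close> wraps around: the class of
  \<open>d\<close> is represented by the trivial path.\<close>

definition path_cons :: "'e list \<Rightarrow> 'e \<Rightarrow> 'e list \<Rightarrow> 'e list" where
  "path_cons d e \<mu> = (if e # \<mu> = d then [] else e # \<mu>)"

definition path_end :: "('v, 'e) pre_digraph \<Rightarrow> 'v \<Rightarrow> 'e list \<Rightarrow> bool" where
  "path_end E w d \<longleftrightarrow> (if d = [] then w \<in> verts E \<and> \<not> regular_vertex E w else path_to E w d \<and> path_src E w d = w)"

lemma branching_path_space:
  assumes wf: "wf_digraph E" and w: "path_end E w d"
  shows "branching E (path_space E w d) (path_src E w) (path_cons d)"
proof (rule branching.intro)
  interpret wf_digraph E by (rule wf)
  show "wf_digraph E" by (rule wf)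
  show "path_cons d e x \<in> path_space E w d"
    if "e \<in> arcs E" "x \<in> path_space E w d" "path_src E w x = head E e" for e x
    using that path_to_range by (auto simp: path_cons_def path_space_def suffix_Cons)
  show "path_src E w (path_cons d e x) = tail E e"
    if "e \<in> arcs E" "x \<in> path_space E w d" "path_src E w x = head E e" for e x
    using w by (auto simp: path_cons_def path_end_def split: if_splits)
  show "e = e' \<and> x = x'" if "e \<in> arcs E" "x \<in> path_space E w d" "path_src E w x = head E e"
    "e' \<in> arcs E" "x' \<in> path_space E w d" "path_src E w x' = head E e'"
    "path_cons d e x = path_cons d e' x'" for e x e' x'
    using that by (auto simp: path_cons_def split: if_splits)
  show "\<exists>e\<in>arcs E. \<exists>y\<in>path_space E w d. path_src E w y = head E e \<and> x = path_cons d e y"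
    if x: "x \<in> path_space E w d" and reg: "regular_vertex E (path_src E w x)" for x
  proof (cases x)
    case (Cons e y)
    then have "e \<in> arcs E \<and> y \<in> path_space E w d \<and> path_src E w y = head E e \<and> x = path_cons d e y"
      using x by (auto simp: path_space_def path_cons_def suffix_Cons)
    then show ?thesis by blast
  next
    case Nil
    \<comment> \<open>A trivial path at a regular \<open>w\<close> is possible only for a closed
      path \<open>d\<close>; it arises by wrapping around from \<open>d\<close> without its first
      edge.\<close>
    then have d: "d \<noteq> []" "path_to E w d" using reg w by (auto simp: path_end_def split: if_splits)
    then obtain e y where d_eq: "d = e # y" by (cases d) auto
    have "e \<in> arcs E \<and> y \<in> path_space E w d \<and> path_src E w y = head E e \<and> x = path_cons d e y"
      using d Nil suffix_length_le[of d y] by (auto simp: d_eq path_space_def path_cons_def)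
    then show ?thesis by blast
  qed
qed

lemma foldr_path_cons:
  "d = [] \<or> length \<mu> + length \<tau> < length d \<Longrightarrow> foldr (path_cons d) \<mu> \<tau> = \<mu> @ \<tau>"
  by (induction \<mu>) (auto simp: path_cons_def)

section \<open>Consequences of the graph conditions\<close>

context wf_digraph
begin

lemma path_to_replicate:
  assumes "path_to G w c" "path_src G w c = w"
  shows "path_to G w (concat (replicate k c)) \<and> path_src G w (concat (replicate k c)) = w"
  by (induction k) (use assms path_to_range in \<open>auto simp: path_to_append path_src_append\<close>)

lemma not_regular_iff: "v \<in> verts G \<Longrightarrow> \<not> regular_vertex G v \<longleftrightarrow> sink G v \<or> infinite_emitter G v"
  by (auto simp: regular_vertex_def sink_def infinite_emitter_def)

end

locale bellier_digraph = wf_digraph +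
  assumes bellier: "bellier_conditions G"
begin

text \<open>Any edge leaving \<open>x\<close> other than the first edge of a shortest closed walk at
  \<open>x\<close> would be an exit for that cycle.\<close>

lemma recurrent_unique_arc:
  assumes x: "x \<rightarrow>\<^sup>+ x" and e: "e \<in> arcs G" "tail G e = x" and f: "f \<in> arcs G" "tail G f = x"
  shows "e = f"
proof -
  obtain p where p: "cycle p" "awalk x p x" "p \<noteq> []" using x by (rule shortest_closed_walk_is_cycle)
  have "head G (last p) = x"
    using p by (metis awalk_verts_conv awalk_conv awlast_if_cas last_snoc)
  \<comment> \<open>The exit condition is used at the last position, whose cyclic successor is
    position 0.\<close>
  then have i: "length p - 1 < length p" "head G (p ! (length p - 1)) = x" "Suc (length p - 1) mod length p = 0"
    using p(3) by (simp_all add: last_conv_nth)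
  have "g = p ! 0" if "g \<in> arcs G" "tail G g = x" for g
  proof (rule ccontr)
    assume "g \<noteq> p ! 0"
    then have "cycle_exit G p g"
      using i that unfolding cycle_exit_def by (intro conjI exI[of _ "length p - 1"]) auto
    then show False using bellier p(1) unfolding bellier_conditions_def by blast
  qed
  then show ?thesis using e f by blast
qed

text \<open>The edge is the only one leaving its source, so a closed walk through the source has to
  pass along it.\<close>

lemma recurrent_step:
  assumes "tail G e \<rightarrow>\<^sup>+ tail G e" "e \<in> arcs G"
  shows "head G e \<rightarrow>\<^sup>+ head G e"
proof -
  obtain f where f: "f \<in> arcs G" "tail G f = tail G e" "head G f \<rightarrow>\<^sup>* tail G e"
  proof -
    obtain \<mu> where \<mu>: "path_to G (tail G e) \<mu>" "path_src G (tail G e) \<mu> = tail G e" "\<mu> \<noteq> []"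
      using assms(1) by (auto simp: reachable1_iff_path)
    then obtain f \<mu>' where "\<mu> = f # \<mu>'" by (cases \<mu>) auto
    then show ?thesis using \<mu> by (intro that[of f]) (auto simp: reachable_iff_path intro!: exI[of _ \<mu>'])
  qed
  have "f = e" by (rule recurrent_unique_arc[OF assms(1) f(1,2)]) (use assms in auto)
  moreover have "tail G e \<rightarrow>\<^bsub>G\<^esub> head G e" using assms(2) by (auto simp: arcs_ends_conv)
  ultimately show ?thesis using f(3) by (metis reachable_reachable1_trans r_into_trancl')
qed

lemma recurrent_path:
  assumes "path_to G w \<mu>" "path_src G w \<mu> = x" "x \<rightarrow>\<^sup>+ x"
  shows "w \<rightarrow>\<^sup>+ w"
  using assms
proof (induction \<mu> arbitrary: x)
  case (Cons e \<mu>)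
  then show ?case using recurrent_step[of e] by auto
qed simp

lemma recurrent_regular:
  assumes "x \<rightarrow>\<^sup>+ x"
  shows "regular_vertex G x"
proof -
  obtain \<mu> where \<mu>: "path_to G x \<mu>" "path_src G x \<mu> = x" "\<mu> \<noteq> []"
    using assms by (auto simp: reachable1_iff_path)
  then obtain f \<mu>' where f: "\<mu> = f # \<mu>'" by (cases \<mu>) auto
  then have "out_arcs G x = {f}" using \<mu> recurrent_unique_arc[OF assms] by auto
  then show ?thesis using \<mu> path_to_range by (auto simp: regular_vertex_def)
qed

text \<open>From a recurrent vertex each step is forced. This determinism underlies both the
  finiteness of the path spaces and the polynomial count of normal forms.\<close>

lemma recurrent_paths_eq:
  assumes "path_to G w \<mu>" "path_to G w' \<nu>" "path_src G w \<mu> = x" "path_src G w' \<nu> = x" "x \<rightarrow>\<^sup>+ x"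
    "length \<mu> = length \<nu>"
  shows "\<mu> = \<nu> \<and> w = w'"
  using assms
proof (induction \<mu> arbitrary: \<nu> x)
  case (Cons e \<mu>)
  obtain f \<nu>' where \<nu>: "\<nu> = f # \<nu>'" using Cons.prems by (cases \<nu>) auto
  have "e = f" using Cons.prems recurrent_unique_arc[of x e f] by (auto simp: \<nu>)
  moreover have "head G e \<rightarrow>\<^sup>+ head G e" using recurrent_step[of e] Cons.prems by auto
  ultimately have "\<mu> = \<nu>' \<and> w = w'"
    using Cons.prems by (intro Cons.IH[of \<nu>' "head G e"]) (simp_all add: \<nu>)
  then show ?case using \<open>e = f\<close> by (simp add: \<nu>)
qed auto

text \<open>Both \<open>P\<close> and \<open>d\<close> are suffixes of one common power of a closed
  path at \<open>w\<close>, so the shorter is a suffix of the longer.\<close>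

lemma recurrent_suffix:
  assumes P: "path_to G w P" "path_src G w P = x" and x: "x \<rightarrow>\<^sup>+ x"
    and d: "path_to G w d" "path_src G w d = w" "d \<noteq> []" and len: "length d \<le> length P"
  shows "suffix d P"
proof -
  have w: "w \<rightarrow>\<^sup>+ w" by (rule recurrent_path[OF P x])
  obtain C where C: "path_to G x C" "path_src G x C = x" "C \<noteq> []"
    using x by (auto simp: reachable1_iff_path)
  \<comment> \<open>A closed path at \<open>x\<close> at least as long as \<open>P\<close>: by
    determinism it begins with \<open>P\<close>, and the remainder \<open>\<sigma>\<close> leads
    from \<open>w\<close> back to \<open>x\<close>.\<close>
  define q where "q = concat (replicate (length P) C)"
  have q: "path_to G x q" "path_src G x q = x" using path_to_replicate[OF C(1,2)] by (simp_all add: q_def)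
  have "length P \<le> length P * length C" using C(3) by (cases C) auto
  then have lq: "length P \<le> length q" by (simp add: q_def length_concat sum_list_replicate)
  define \<sigma> where "\<sigma> = drop (length P) q"
  have split: "q = take (length P) q @ \<sigma>" by (simp add: \<sigma>_def)
  then have "path_to G x \<sigma>" "path_to G (path_src G x \<sigma>) (take (length P) q)"
    "path_src G (path_src G x \<sigma>) (take (length P) q) = x"
    using q by (metis path_to_append path_src_append)+
  then have \<sigma>: "path_to G x \<sigma>" "path_src G x \<sigma> = w"
    using recurrent_paths_eq[OF P(1), of "path_src G x \<sigma>" "take (length P) q" x] P(2) x lq by auto
  define Q where "Q = \<sigma> @ P"
  have Q: "path_to G w Q" "path_src G w Q = w" using P \<sigma> by (simp_all add: Q_def path_to_append path_src_append)
  \<comment> \<open>The closed paths \<open>Q\<close> and \<open>d\<close> at \<open>w\<close>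
    coincide once both are repeated up to the common length |Q| |d|.\<close>
  have eq: "concat (replicate (length d) Q) = concat (replicate (length Q) d)"
    using recurrent_paths_eq[of w _ w _ w] path_to_replicate[OF Q] path_to_replicate[OF d(1,2)] w
    by (simp add: length_concat sum_list_replicate mult.commute)
  obtain m where m: "length d = Suc m" using d(3) by (cases d) auto
  have "Q \<noteq> []" using len d(3) by (auto simp: Q_def)
  then obtain l where l: "length Q = Suc l" by (cases Q) auto
  have last: "concat (replicate (Suc k) xs) = concat (replicate k xs) @ xs" for k and xs :: "'b list"
    by (induction k) auto
  have "suffix P (concat (replicate (length d) Q))"
    unfolding m last by (simp add: Q_def suffix_appendI)
  moreover have "suffix d (concat (replicate (length d) Q))"
    unfolding eq l last by (simp add: suffix_appendI)
  ultimately show ?thesis using len suffix_length_suffix by blast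
qed

text \<open>An argument in the style of Koenig's lemma: since vertices receive finitely many edges,
  an infinite path space yields an endless extension to the left, ... f_1 f_0. Its edges cannot form
  a backward chain, so some vertex on it is recurrent; then either \<open>w\<close> is recurrent and
  hence regular, or the suffix \<open>d\<close> occurs.\<close>

lemma finite_path_space:
  assumes w: "path_end G w d"
  shows "finite (path_space G w d)"
proof (rule ccontr)
  assume inf: "infinite (path_space G w d)"
  let ?X = "path_space G w d"
  define P where "P (n::nat) \<mu> \<longleftrightarrow> infinite {x \<in> ?X. suffix \<mu> x}" for n \<mu>
  have X: "\<mu> \<in> ?X" if "P n \<mu>" for n \<mu>
  proof -
    have "{x \<in> ?X. suffix \<mu> x} \<noteq> {}" using that unfolding P_def by (metis finite.emptyI)
    then obtain \<rho> where "\<rho> @ \<mu> \<in> ?X" by (auto simp: suffix_def)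
    then show ?thesis by (auto simp: path_space_def path_to_append suffix_appendI)
  qed
  have "\<exists>\<nu>. P (Suc n) \<nu> \<and> (\<exists>e. \<nu> = e # \<mu>)" if P: "P n \<mu>" for n \<mu>
  proof (rule ccontr)
    assume *: "\<not> ?thesis"
    let ?A = "in_arcs G (path_src G w \<mu>)"
    have "path_src G w \<mu> \<in> verts G" using X[OF P] path_src_in_verts by (auto simp: path_space_def)
    then have fin: "finite ?A"
      using bellier by (auto simp: bellier_conditions_def infinite_receiver_def)
    have "{x \<in> ?X. suffix \<mu> x} \<subseteq> insert \<mu> (\<Union>e\<in>?A. {x \<in> ?X. suffix (e # \<mu>) x})"
    proof
      fix x assume "x \<in> {x \<in> ?X. suffix \<mu> x}"
      then obtain \<rho> where x: "x \<in> ?X" "x = \<rho> @ \<mu>" by (auto simp: suffix_def)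
      show "x \<in> insert \<mu> (\<Union>e\<in>?A. {x \<in> ?X. suffix (e # \<mu>) x})"
      proof (cases \<rho> rule: rev_cases)
        case (snoc \<rho>' e)
        then have "e \<in> ?A" using x by (auto simp: path_space_def path_to_append)
        then show ?thesis using x snoc by (auto simp: suffix_def)
      qed (use x in auto)
    qed
    moreover have "finite (insert \<mu> (\<Union>e\<in>?A. {x \<in> ?X. suffix (e # \<mu>) x}))"
      using fin * by (auto simp: P_def)
    ultimately show False using P finite_subset unfolding P_def by blast
  qed
  moreover have "P 0 []" using inf by (simp add: P_def)
  ultimately obtain \<mu> where \<mu>: "\<And>n. P n (\<mu> n)" "\<And>n. \<exists>e. \<mu> (Suc n) = e # \<mu> n" "\<mu> 0 = []"
    using dependent_nat_choice[of "\<lambda>n \<mu>. P n \<mu> \<and> (n = 0 \<longrightarrow> \<mu> = [])" "\<lambda>n \<mu> \<nu>. \<exists>e. \<nu> = e # \<mu>"]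
    by (metis Zero_not_Suc)
  obtain f where f: "\<And>n. \<mu> (Suc n) = f n # \<mu> n" using \<mu>(2) by metis
  have path: "path_to G w (\<mu> n)" for n using X[OF \<mu>(1)] by (simp add: path_space_def)
  have arc: "f n \<in> arcs G" for n using path[of "Suc n"] by (simp add: f)
  have src: "path_src G w (\<mu> (Suc n)) = tail G (f n)" for n by (simp add: f)
  have chain: "tail G (f n) = head G (f (Suc n))" for n using path[of "Suc (Suc n)"] by (simp add: f)
  have len: "length (\<mu> n) = n" for n by (induction n) (simp_all add: \<mu>(3) f)
  \<comment> \<open>The shift by the length of \<open>d\<close> ensures that the path up to the
    repeated edge is long enough to have \<open>d\<close> as a suffix.\<close>
  have "\<not> inj (\<lambda>n. f (length d + n))"
    using bellier arc chain
    by (auto simp: bellier_conditions_def infinite_backward_chain_def dest: spec[of _ "\<lambda>n. f (length d + n)"])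
  then obtain i j where ij: "i < j" "length d \<le> i" "f i = f j"
    unfolding inj_def by (metis add_less_cancel_left le_add1 linorder_neqE_nat)
  have reach: "tail G (f (i + Suc n)) \<rightarrow>\<^sup>+ tail G (f i)" for n
  proof (induction n)
    case 0
    have "tail G (f (Suc i)) \<rightarrow>\<^bsub>G\<^esub> tail G (f i)" using arc[of "Suc i"] chain[of i] by (auto simp: arcs_ends_conv)
    then show ?case by auto
  next
    case (Suc n)
    have "tail G (f (i + Suc (Suc n))) \<rightarrow>\<^bsub>G\<^esub> tail G (f (i + Suc n))"
      using arc[of "i + Suc (Suc n)"] chain[of "i + Suc n"] by (auto simp: arcs_ends_conv)
    then show ?case using Suc by (metis trancl_into_trancl2)
  qed
  have rec: "tail G (f i) \<rightarrow>\<^sup>+ tail G (f i)"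
    using reach[of "j - i - 1"] ij by simp
  show False
  proof (cases "d = []")
    case True
    have "w \<rightarrow>\<^sup>+ w" by (rule recurrent_path[OF path src rec])
    then show False using recurrent_regular[of w] w True by (simp add: path_end_def)
  next
    case False
    then have "suffix d (\<mu> (Suc i))"
      using recurrent_suffix[OF path src rec, of d] w ij len by (simp add: path_end_def)
    then show False using X[OF \<mu>(1)] False by (auto simp: path_space_def)
  qed
qed

text \<open>The parameter \<open>B\<close> is the room needed later: up to \<open>B\<close> edges
  can be prepended to \<open>\<tau>\<close> before wrapping around \<open>d\<close> sets in.\<close>

lemma path_space_vertex:
  assumes v: "v \<in> verts G"
  shows "\<exists>w d \<tau>. path_end G w d \<and> \<tau> \<in> path_space G w d \<and> path_src G w \<tau> = v \<and>
    (d = [] \<or> B + length \<tau> < length d)"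
proof -
  obtain w where w: "v \<rightarrow>\<^sup>* w" "sink G w \<or> on_cycle G w \<or> infinite_emitter G w"
    using bellier v by (auto simp: bellier_conditions_def)
  obtain \<tau> where \<tau>: "path_to G w \<tau>" "path_src G w \<tau> = v" using w(1) by (auto simp: reachable_iff_path)
  have wv: "w \<in> verts G" using \<tau>(1) path_to_range by blast
  show ?thesis
  proof (cases "regular_vertex G w")
    case False
    then show ?thesis using \<tau> wv
      by (intro exI[of _ w] exI[of _ "[]"] exI[of _ \<tau>]) (simp add: path_end_def path_space_def)
  next
    case True
    then have "w \<rightarrow>\<^sup>+ w" using w(2) wv not_regular_iff by (auto simp flip: on_cycle_iff)
    then obtain c where c: "path_to G w c" "path_src G w c = w" "c \<noteq> []"
      by (auto simp: reachable1_iff_path)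
    \<comment> \<open>The exponent exceeds B + |\<tau>|, and |c| is at least 1.\<close>
    define d where "d = concat (replicate (Suc (B + length \<tau>)) c)"
    have "Suc (B + length \<tau>) \<le> Suc (B + length \<tau>) * length c" using c(3) by (cases c) auto
    then have len: "B + length \<tau> < length d" by (simp add: d_def length_concat sum_list_replicate)
    then have "d \<noteq> []" by auto
    then have "path_end G w d"
      using path_to_replicate[OF c(1,2), of "Suc (B + length \<tau>)"] unfolding path_end_def d_def by simp
    moreover have "\<tau> \<in> path_space G w d" using \<tau> len suffix_length_le[of d \<tau>] by (auto simp: path_space_def)
    ultimately show ?thesis using \<tau> len by blast
  qed
qed

text \<open>Provides points fixed by p_v minus the sum of s_e s_e^* over the edges in
  \<open>F\<close> leaving \<open>v\<close>: no edge of \<open>F\<close> can be removed from their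
  front.\<close>

lemma path_space_gap:
  assumes v: "v \<in> verts G" and gap: "\<not> regular_vertex G v \<or> \<not> out_arcs G v \<subseteq> F"
  shows "\<exists>w d \<tau>. path_end G w d \<and> \<tau> \<in> path_space G w d \<and> path_src G w \<tau> = v \<and>
    (d = [] \<or> B + length \<tau> < length d) \<and>
    (\<tau> = [] \<and> d = [] \<or> (\<exists>f \<tau>'. \<tau> = f # \<tau>' \<and> f \<notin> F))"
proof (cases "regular_vertex G v")
  case False
  then show ?thesis using v
    by (intro exI[of _ v] exI[of _ "[]"]) (simp add: path_end_def path_space_def)
next
  case True
  then obtain f where "f \<in> out_arcs G v" "f \<notin> F" using gap by blast
  then have f: "f \<in> arcs G" "tail G f = v" "f \<notin> F" by auto
  \<comment> \<open>\<open>Suc B\<close> makes up for the edge \<open>f\<close> that is prepended to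
    \<open>\<tau>\<close> below.\<close>
  obtain w d \<tau> where w: "path_end G w d" "\<tau> \<in> path_space G w d" "path_src G w \<tau> = head G f"
    "d = [] \<or> Suc B + length \<tau> < length d"
    using path_space_vertex[of "head G f" "Suc B"] f by auto
  have "f # \<tau> \<in> path_space G w d"
    using w f suffix_length_le[of d "f # \<tau>"] by (auto simp: path_space_def)
  then show ?thesis using w f by (intro exI[of _ w] exI[of _ d] exI[of _ "f # \<tau>"]) auto
qed

text \<open>Among the first |F| + 1 edges of a longer path one is repeated; its source is recurrent,
  so the rest is determined by its length. Truncation to |F| + 1 edges is therefore injective on
  paths of a fixed length.\<close>

lemma bounded_number_of_paths:
  assumes F: "finite F"
  shows "card {\<mu>. (\<exists>w. path_to G w \<mu>) \<and> set \<mu> \<subseteq> F \<and> length \<mu> = L}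
    \<le> card {\<mu>. set \<mu> \<subseteq> F \<and> length \<mu> \<le> Suc (card F)}" (is "card ?A \<le> card ?B")
proof (rule card_inj_on_le)
  show "finite ?B" by (rule finite_lists_length_le[OF F])
  show "take (Suc (card F)) ` ?A \<subseteq> ?B" using set_take_subset by fastforce
  show "inj_on (take (Suc (card F))) ?A"
  proof (rule inj_onI)
    fix \<mu> \<nu> assume \<mu>: "\<mu> \<in> ?A" and \<nu>: "\<nu> \<in> ?A" and eq: "take (Suc (card F)) \<mu> = take (Suc (card F)) \<nu>"
    show "\<mu> = \<nu>"
    proof (cases "length \<mu> \<le> card F")
      case True
      then show ?thesis using \<mu> \<nu> eq by simp
    next
      case False
      let ?t = "take (Suc (card F)) \<mu>"
      have "set ?t \<subseteq> F" using \<mu> set_take_subset by fastforce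
      then have "card (set ?t) \<le> card F" by (rule card_mono[OF F])
      then have "\<not> distinct ?t" using False by (auto dest: distinct_card)
      then obtain xs y ys zs where t: "?t = xs @ [y] @ ys @ [y] @ zs" using not_distinct_decomp by blast
      obtain \<mu>' \<nu>' where ex: "\<mu> = xs @ y # ys @ y # zs @ \<mu>'" "\<nu> = xs @ y # ys @ y # zs @ \<nu>'"
        using append_take_drop_id[of "Suc (card F)" \<mu>] append_take_drop_id[of "Suc (card F)" \<nu>] eq t
        by (metis append.assoc append_Cons append_Nil)
      obtain w w' where w: "path_to G w \<mu>" "path_to G w' \<nu>" using \<mu> \<nu> by auto
      have p: "path_to G w (y # ys @ y # zs @ \<mu>')" "path_to G w' (y # ys @ y # zs @ \<nu>')"
        using w by (auto simp: ex path_to_append)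
      have "path_to G (tail G y) (y # ys)"
        using p(1) path_to_append[of w "y # ys" "y # zs @ \<mu>'"] by (simp only: append_Cons path_src_simps simp_thms)
      then have "tail G y \<rightarrow>\<^sup>+ tail G y" unfolding reachable1_iff_path by fastforce
      then have "y # ys @ y # zs @ \<mu>' = y # ys @ y # zs @ \<nu>'"
        using recurrent_paths_eq[OF p] \<mu> \<nu> by (auto simp: ex)
      then show ?thesis by (simp add: ex)
    qed
  qed
qed

end

section \<open>Normal forms\<close>

text \<open>The letter \<open>Vert w\<close> keeps the word nonempty when both paths are trivial and
  records their common range.\<close>

definition path_word :: "'e list \<Rightarrow> 'e list \<Rightarrow> 'v \<Rightarrow> ('v, 'e) graph_gen list" where
  "path_word \<mu> \<nu> w = map Edge \<mu> @ Vert w # map Ghost (rev \<nu>)"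

text \<open>
  Normal form relative to a finite set \<open>F\<close> of edges and a level \<open>M\<close>: $s_\mu s_\nu^*$ at level
  $|\nu| = M$, and $s_\mu (p_w - \sum_{e \in F, s(e) = w} s_e s_e^*) s_\nu^*$ below.
\<close>

definition normal_form ::
    "('v, 'e) pre_digraph \<Rightarrow> 'e set \<Rightarrow> nat \<Rightarrow> 'e list \<times> 'e list \<times> 'v \<Rightarrow> ('v, 'e, 'k::field) graph_free" where
  "normal_form E F M = (\<lambda>(\<mu>, \<nu>, w). word (path_word \<mu> \<nu> w) -
     (if length \<nu> = M then 0
      else (\<Sum>e | e \<in> F \<and> tail E e = w. word (path_word (\<mu> @ [e]) (\<nu> @ [e]) (head E e)))))"

text \<open>The bound \<open>2 * M\<close> arises because a word of length at most M reduces to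
  paths of length at most M, and lifting \<open>\<nu>\<close> to length M appends up to M edges to
  both. Below level M, indices at which the relation at a regular vertex kills the normal form are
  left out.\<close>

definition normal_index ::
    "('v, 'e) pre_digraph \<Rightarrow> 'e set \<Rightarrow> 'v set \<Rightarrow> nat \<Rightarrow> ('e list \<times> 'e list \<times> 'v) set" where
  "normal_index E F V M = {(\<mu>, \<nu>, w). w \<in> V \<and> path_to E w \<mu> \<and> path_to E w \<nu> \<and> set \<mu> \<subseteq> F \<and> set \<nu> \<subseteq> F \<and>
     length \<mu> \<le> 2 * M \<and> length \<nu> \<le> M \<and>
     (length \<nu> = M \<or> \<not> regular_vertex E w \<or> \<not> out_arcs E w \<subseteq> F)}"

definition gens_of :: "'e set \<Rightarrow> 'v set \<Rightarrow> ('v, 'e) graph_gen set" where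
  "gens_of F V = Vert ` V \<union> Edge ` F \<union> Ghost ` F"

subsection \<open>Detecting coefficients\<close>

context branching
begin

lemma run_map_Ghost: "run (map Ghost (rev \<nu>)) z = Some x \<longleftrightarrow> run (map Edge \<nu>) x = Some z"
  using run_star[of "map Edge \<nu>" z x] by (simp add: rev_map comp_def)

lemma run_path_word: "run (path_word \<mu> \<nu> w) y = Some x \<longleftrightarrow>
    (\<exists>z. run (map Edge \<mu>) y = Some z \<and> z \<in> X \<and> src z = w \<and> run (map Edge \<nu>) x = Some z)"
  by (auto simp: path_word_def run_append bind_eq_Some_conv run_map_Ghost split: if_splits)

lemma run_Edge_foldr: "run (map Edge \<mu>) y = Some z \<Longrightarrow> y = foldr cons \<mu> z"
  by (induction \<mu> arbitrary: y) (auto simp: bind_eq_Some_conv step_Edge_iff)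

lemma step_Edge_unique: "step (Edge e) y = Some z \<Longrightarrow> step (Edge f) y = Some z' \<Longrightarrow> e = f \<and> z = z'"
  using valid_inject by (auto simp: step_Edge_iff)

text \<open>At most one edge can be removed from the front of a point, so two successful removals
  follow the same path.\<close>

lemma run_Edge_comparable:
  assumes "run (map Edge \<mu>) x = Some z" "run (map Edge \<nu>) x = Some z'"
  shows "(\<exists>\<sigma>. \<nu> = \<mu> @ \<sigma> \<and> run (map Edge \<sigma>) z = Some z') \<or> (\<exists>\<sigma>. \<mu> = \<nu> @ \<sigma> \<and> run (map Edge \<sigma>) z' = Some z)"
  using assms
proof (induction \<mu> arbitrary: \<nu> x)
  case Nil
  then show ?case by auto
next
  case (Cons e \<mu>)
  show ?case
  proof (cases \<nu>)
    case Nil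
    then show ?thesis using Cons.prems by auto
  next
    case (Cons f \<nu>')
    obtain u where u: "step (Edge e) x = Some u" "run (map Edge \<mu>) u = Some z"
      using Cons.prems(1) by (auto simp: bind_eq_Some_conv)
    obtain u' where u': "step (Edge f) x = Some u'" "run (map Edge \<nu>') u' = Some z'"
      using Cons.prems(2) Cons by (auto simp: bind_eq_Some_conv)
    have "e = f" "u = u'" using step_Edge_unique[OF u(1) u'(1)] by auto
    then show ?thesis using Cons.IH[OF u(2), of \<nu>'] u'(2) Cons by auto
  qed
qed

lemma mc_path_word: "mc (word (path_word \<mu> \<nu> w)) y x = (if \<exists>z. run (map Edge \<mu>) y = Some z \<and> z \<in> X \<and>
    src z = w \<and> run (map Edge \<nu>) x = Some z then 1 else 0)"
  by (simp add: mc_single run_path_word)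

text \<open>Since a point has at most one first edge, at most one subtracted term is nonzero, and it
  cancels the leading one exactly when \<open>z\<close> starts with an edge of
  \<open>F\<close>.\<close>

lemma mc_normal_form:
  assumes F: "finite F"
  shows "mc (normal_form E F M (\<mu>, \<nu>, w)) y x =
    (if \<exists>z. run (map Edge \<mu>) y = Some z \<and> z \<in> X \<and> src z = w \<and> run (map Edge \<nu>) x = Some z \<and>
      (length \<nu> = M \<or> (\<forall>e\<in>F. step (Edge e) z = None)) then 1 else 0 :: 'k::field)"
    (is "_ = (if ?G then 1 else 0)")
proof (cases "length \<nu> = M")
  case True
  then show ?thesis by (simp add: normal_form_def mc_path_word)
next
  case False
  let ?S = "{e \<in> F. tail E e = w}"
  let ?R = "\<lambda>z. run (map Edge \<mu>) y = Some z \<and> z \<in> X \<and> src z = w \<and> run (map Edge \<nu>) x = Some z"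
  let ?c = "\<lambda>e. \<exists>z. ?R z \<and> step (Edge e) z \<noteq> None"
  have c: "mc (word (path_word (\<mu> @ [e]) (\<nu> @ [e]) (head E e))) y x = (if ?c e then 1 else 0)" if "e \<in> ?S" for e
  proof -
    have "(\<exists>z. run (map Edge (\<mu> @ [e])) y = Some z \<and> z \<in> X \<and> src z = head E e \<and> run (map Edge (\<nu> @ [e])) x = Some z)
        \<longleftrightarrow> ?c e" (is "?L \<longleftrightarrow> _")
    proof
      assume ?L
      then obtain z u u' where z: "z \<in> X" "src z = head E e" "run (map Edge \<mu>) y = Some u" "step (Edge e) u = Some z"
        "run (map Edge \<nu>) x = Some u'" "step (Edge e) u' = Some z"
        by (auto simp: run_append bind_eq_Some_conv)
      then have "u = u'" "u \<in> X" "src u = w"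
        using that step_in[of "Edge e" u z] by (auto simp: step_Edge_iff valid_def src_cons)
      then show "?c e" using z by auto
    next
      assume "?c e"
      then obtain z u where "?R z" "step (Edge e) z = Some u" by auto
      then show ?L
        by (intro exI[of _ u]) (auto simp: run_append bind_eq_Some_conv step_Edge_iff valid_def)
    qed
    then show ?thesis by (simp add: mc_path_word)
  qed
  have nf: "mc (normal_form E F M (\<mu>, \<nu>, w)) y x = (if \<exists>z. ?R z then 1 else 0) - (\<Sum>e\<in>?S. if ?c e then 1 else 0)"
  proof -
    have "(\<Sum>e\<in>?S. mc (word (path_word (\<mu> @ [e]) (\<nu> @ [e]) (head E e))) y x) = (\<Sum>e\<in>?S. if ?c e then 1 else 0)"
      by (rule sum.cong[OF refl c])
    then show ?thesis
      using False by (simp add: normal_form_def mc_diff mc_sum mc_path_word[of \<mu> \<nu> w])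
  qed
  show ?thesis
  proof (cases "\<exists>z. ?R z")
    case False
    then have "(\<Sum>e\<in>?S. if ?c e then 1 else 0) = (0::'k)" by (intro sum.neutral) auto
    moreover have "\<not> ?G" using False by blast
    ultimately show ?thesis using False by (simp only: nf if_False diff_0_right)
  next
    case True
    then obtain z where z: "?R z" by blast
    have z_unique: "?R z' \<longleftrightarrow> z' = z" for z' using z by auto
    show ?thesis
    proof (cases "\<exists>e\<in>F. step (Edge e) z \<noteq> None")
      case no: False
      then have "(\<Sum>e\<in>?S. if ?c e then 1 else 0) = (0::'k)" by (intro sum.neutral) (auto simp: z_unique)
      moreover have ?G using no z by auto
      ultimately show ?thesis using True by (simp only: nf if_True diff_0_right)
    next
      case yes: True
      then obtain e u where e: "e \<in> F" "step (Edge e) z = Some u" by auto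
      have eS: "e \<in> ?S" using e z src_cons by (auto simp: step_Edge_iff valid_def)
      have "(\<Sum>f\<in>?S. if ?c f then 1 else 0) = (\<Sum>f\<in>?S. if f = e then 1 else (0::'k))"
      proof (rule sum.cong[OF refl])
        fix f assume "f \<in> ?S"
        have "?c f \<longleftrightarrow> f = e" using e z step_Edge_unique[OF e(2), of f] by (auto simp: z_unique)
        then show "(if ?c f then 1 else 0) = (if f = e then 1 else (0::'k))" by simp
      qed
      also have "\<dots> = 1" using eS F by simp
      finally have "mc (normal_form E F M (\<mu>, \<nu>, w)) y x = (0::'k)" using True by (simp only: nf if_True diff_self)
      moreover have "\<not> ?G" using z e \<open>length \<nu> \<noteq> M\<close> by auto
      ultimately show ?thesis by (simp only: if_False)
    qed
  qed
qed

text \<open>Both \<open>\<nu>\<close> and \<open>\<nu>0\<close> can be removed from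
  \<open>x\<close>, so one is a prefix of the other. A proper prefix has length below M, and its gap
  condition excludes that the remaining point continues with an edge of \<open>F\<close>. Hence they
  agree, and \<open>inj\<close> settles \<open>\<mu>\<close>.\<close>

lemma mc_normal_form_detect:
  assumes F: "finite F"
    and i0: "(\<mu>0, \<nu>0, w0) \<in> normal_index E F V M" and i: "(\<mu>, \<nu>, w) \<in> normal_index E F V M"
    and l: "l \<in> X" "src l = w0" "run (map Edge \<mu>0) y = Some l" "run (map Edge \<nu>0) x = Some l"
    and inj: "\<And>\<mu>. length \<mu> \<le> 2 * M \<Longrightarrow> run (map Edge \<mu>) y = Some l \<Longrightarrow> \<mu> = \<mu>0"
    and gap: "length \<nu>0 < M \<Longrightarrow> (\<forall>e\<in>F. step (Edge e) l = None)"
  shows "mc (normal_form E F M (\<mu>, \<nu>, w)) y x = (if (\<mu>, \<nu>, w) = (\<mu>0, \<nu>0, w0) then 1 else 0)"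
proof -
  have iff: "(\<exists>z. run (map Edge \<mu>) y = Some z \<and> z \<in> X \<and> src z = w \<and> run (map Edge \<nu>) x = Some z \<and>
      (length \<nu> = M \<or> (\<forall>e\<in>F. step (Edge e) z = None))) \<longleftrightarrow> (\<mu>, \<nu>, w) = (\<mu>0, \<nu>0, w0)" (is "?L \<longleftrightarrow> ?R")
  proof
    assume ?L
    then obtain z where z: "run (map Edge \<mu>) y = Some z" "src z = w" "run (map Edge \<nu>) x = Some z"
      "length \<nu> = M \<or> (\<forall>e\<in>F. step (Edge e) z = None)" by blast
    have "\<nu> = \<nu>0 \<and> z = l"
      using run_Edge_comparable[OF z(3) l(4)]
    proof (elim disjE exE conjE)
      fix \<sigma> assume \<sigma>: "\<nu>0 = \<nu> @ \<sigma>" "run (map Edge \<sigma>) z = Some l"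
      show ?thesis
      proof (cases \<sigma>)
        case (Cons e \<sigma>')
        then have "step (Edge e) z \<noteq> None" "e \<in> F" using \<sigma> i0 by (auto simp: normal_index_def bind_eq_Some_conv)
        then have "length \<nu> = M" using z(4) by auto
        then show ?thesis using \<sigma> Cons i0 by (auto simp: normal_index_def)
      qed (use \<sigma> in auto)
    next
      fix \<sigma> assume \<sigma>: "\<nu> = \<nu>0 @ \<sigma>" "run (map Edge \<sigma>) l = Some z"
      show ?thesis
      proof (cases \<sigma>)
        case (Cons e \<sigma>')
        then have "step (Edge e) l \<noteq> None" "e \<in> F" using \<sigma> i by (auto simp: normal_index_def bind_eq_Some_conv)
        moreover have "length \<nu>0 < M" using \<sigma> Cons i by (auto simp: normal_index_def)
        ultimately show ?thesis using gap by auto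
      qed (use \<sigma> in auto)
    qed
    moreover have "\<mu> = \<mu>0" if "z = l" using inj z(1) i that by (auto simp: normal_index_def)
    ultimately show ?R using z(2) l(2) by auto
  next
    assume ?R
    then show ?L using l i0 gap by (auto simp: normal_index_def)
  qed
  show ?thesis unfolding mc_normal_form[OF F] iff ..
qed

end

lemma (in wf_digraph) run_path_space:
  assumes w: "path_end G w d" and \<tau>: "\<tau> \<in> path_space G w d"
    and \<mu>: "path_to G (path_src G w \<tau>) \<mu>" and len: "d = [] \<or> length \<mu> + length \<tau> < length d"
  shows "branching.run G (path_space G w d) (path_src G w) (path_cons d) (map Edge \<mu>) (\<mu> @ \<tau>) = Some \<tau>"
proof -
  interpret branching G "path_space G w d" "path_src G w" "path_cons d"
    by (rule branching_path_space[OF wf_digraph w])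
  show ?thesis
    using \<mu> len
  proof (induction \<mu>)
    case (Cons e \<mu>)
    have p: "path_to G w (\<mu> @ \<tau>)" using Cons.prems \<tau> by (auto simp: path_space_def path_to_append)
    have "valid e (\<mu> @ \<tau>)"
      unfolding valid_def using Cons.prems p suffix_length_le[of d "\<mu> @ \<tau>"]
      by (auto simp: path_space_def path_src_append)
    moreover have "path_cons d e (\<mu> @ \<tau>) = e # \<mu> @ \<tau>" using Cons.prems by (auto simp: path_cons_def)
    ultimately have "step (Edge e) (e # \<mu> @ \<tau>) = Some (\<mu> @ \<tau>)" by (simp add: step_Edge_iff)
    then show ?case using Cons by auto
  qed simp
qed

text \<open>The entry at (\<mu>0 \<tau>, \<nu>0 \<tau>), with an action and a point \<tau> adapted
  to \<open>i0\<close>, is the coordinate functional of \<open>i0\<close>. So normal forms are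
  independent modulo the ideal, and coefficients are bounded by norms in finite actions.\<close>

theorem (in bellier_digraph) coefficient_detection:
  fixes K :: "'k::field itself"
  assumes F: "finite F" and i0: "i0 \<in> normal_index G F V M"
  obtains w d y x where "path_end G w d" "y \<in> path_space G w d" "x \<in> path_space G w d"
    "\<And>i. i \<in> normal_index G F V M \<Longrightarrow>
      branching.mc G (path_space G w d) (path_src G w) (path_cons d) (normal_form G F M i) y x =
        (if i = i0 then 1 else 0 :: 'k)"
proof -
  obtain \<mu>0 \<nu>0 w0 where i0_eq: "i0 = (\<mu>0, \<nu>0, w0)" by (cases i0)
  have p: "path_to G w0 \<mu>0" "path_to G w0 \<nu>0" "length \<mu>0 \<le> 2 * M" "length \<nu>0 \<le> M"
    using i0 by (auto simp: i0_eq normal_index_def)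
  have w0: "w0 \<in> verts G" using p(1) path_to_range by blast
  \<comment> \<open>A nontrivial \<open>d\<close> is longer than 2 M + |\<tau>|, so none of the
    indexed paths wraps around when prepended to \<open>\<tau>\<close>.\<close>
  obtain w d \<tau> where w: "path_end G w d" and \<tau>: "\<tau> \<in> path_space G w d" "path_src G w \<tau> = w0"
    and len: "d = [] \<or> 2 * M + length \<tau> < length d"
    and gap: "length \<nu>0 < M \<Longrightarrow> \<tau> = [] \<and> d = [] \<or> (\<exists>f \<tau>'. \<tau> = f # \<tau>' \<and> f \<notin> F)"
  proof (cases "length \<nu>0 < M")
    case True
    then have "\<not> regular_vertex G w0 \<or> \<not> out_arcs G w0 \<subseteq> F" using i0 by (auto simp: i0_eq normal_index_def)
    then show ?thesis using path_space_gap[OF w0, of F "2 * M"] that by blast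
  next
    case False
    then show ?thesis using path_space_vertex[OF w0, of "2 * M"] that by blast
  qed
  interpret branching G "path_space G w d" "path_src G w" "path_cons d"
    by (rule branching_path_space[OF wf_digraph w])
  have r: "run (map Edge \<mu>0) (\<mu>0 @ \<tau>) = Some \<tau>" "run (map Edge \<nu>0) (\<nu>0 @ \<tau>) = Some \<tau>"
    using run_path_space[OF w \<tau>(1)] p \<tau>(2) len by auto
  have mem: "\<mu> @ \<tau> \<in> path_space G w d" if "path_to G w0 \<mu>" "length \<mu> \<le> 2 * M" for \<mu>
    using that \<tau> len suffix_length_le[of d "\<mu> @ \<tau>"] by (auto simp: path_space_def path_to_append)
  show ?thesis
  proof (rule that[OF w])
    show "\<mu>0 @ \<tau> \<in> path_space G w d" "\<nu>0 @ \<tau> \<in> path_space G w d" using mem p by auto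
    fix i assume i: "i \<in> normal_index G F V M"
    obtain \<mu> \<nu> v where i_eq: "i = (\<mu>, \<nu>, v)" by (cases i)
    show "mc (normal_form G F M i) (\<mu>0 @ \<tau>) (\<nu>0 @ \<tau>) = (if i = i0 then 1 else 0 :: 'k)"
      unfolding i_eq i0_eq
    proof (rule mc_normal_form_detect[OF F _ _ \<tau> r])
      show "\<mu> = \<mu>0" if "length \<mu> \<le> 2 * M" "run (map Edge \<mu>) (\<mu>0 @ \<tau>) = Some \<tau>" for \<mu>
        using run_Edge_foldr[OF that(2)] foldr_path_cons[of d \<mu> \<tau>] that(1) len by auto
      show "\<forall>e\<in>F. step (Edge e) \<tau> = None" if "length \<nu>0 < M"
      proof
        fix e assume "e \<in> F"
        then show "step (Edge e) \<tau> = None"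
          using gap[OF that] by (cases "step (Edge e) \<tau>") (auto simp: step_Edge_iff path_cons_def split: if_splits)
      qed
    qed (use i i0 in \<open>auto simp: i_eq i0_eq\<close>)
  qed
qed

lemma (in wf_digraph) finite_normal_index:
  assumes "finite F" "finite V"
  shows "finite (normal_index G F V M)"
proof (rule finite_subset)
  show "normal_index G F V M \<subseteq> {xs. set xs \<subseteq> F \<and> length xs \<le> 2 * M} \<times> {xs. set xs \<subseteq> F \<and> length xs \<le> M} \<times> V"
    by (auto simp: normal_index_def)
qed (use assms finite_lists_length_le[of F] in auto)

text \<open>Quadratic in \<open>M\<close>: there are 2 M + 1 possible lengths, and the number of
  paths of each is bounded independently of the length.\<close>

lemma (in bellier_digraph) card_normal_index:
  assumes F: "finite F" and V: "finite V"
  shows "card (normal_index G F V M) \<le>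
    card V * (card {\<mu>. set \<mu> \<subseteq> F \<and> length \<mu> \<le> Suc (card F)} * Suc (2 * M))\<^sup>2"
proof -
  let ?C = "card {\<mu>. set \<mu> \<subseteq> F \<and> length \<mu> \<le> Suc (card F)}"
  let ?P = "\<lambda>L. {\<mu>. (\<exists>w. path_to G w \<mu>) \<and> set \<mu> \<subseteq> F \<and> length \<mu> = L}"
  let ?A = "\<Union>L\<le>2 * M. ?P L"
  have "finite (?P L)" for L by (rule finite_subset[OF _ finite_lists_length_eq[OF F, of L]]) auto
  then have finA: "finite ?A" by blast
  have "card ?A \<le> (\<Sum>L\<le>2 * M. card (?P L))" by (rule card_UN_le) simp
  also have "\<dots> \<le> (\<Sum>L\<le>2 * M. ?C)" by (intro sum_mono bounded_number_of_paths F)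
  finally have cA: "card ?A \<le> ?C * Suc (2 * M)" by (simp add: mult.commute)
  have "normal_index G F V M \<subseteq> ?A \<times> ?A \<times> V" by (auto simp: normal_index_def)
  then have "card (normal_index G F V M) \<le> card (?A \<times> ?A \<times> V)"
    using finA V by (intro card_mono) auto
  also have "\<dots> = card V * (card ?A)\<^sup>2" by (simp add: card_cartesian_product power2_eq_square)
  also have "\<dots> \<le> card V * (?C * Suc (2 * M))\<^sup>2" using cA by (intro mult_le_mono2 power_mono) auto
  finally show ?thesis .
qed

subsection \<open>Reduction to normal form\<close>

context wf_digraph
begin

text \<open>Letters are multiplied on from the left, one at a time. The second path grows only when
  a ghost edge meets an exhausted first path; \<open>hV\<close> keeps the new range inside
  \<open>V\<close>.\<close>

lemma word_reduce:
  fixes K :: "'k::field itself"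
  assumes F: "F \<subseteq> arcs G" and V: "V \<subseteq> verts G" and hV: "head G ` F \<subseteq> V"
    and xs: "xs \<noteq> []" "set xs \<subseteq> gens_of F V"
  shows "word_null G K xs \<or> (\<exists>\<mu> \<nu> w. word_cong G K xs (path_word \<mu> \<nu> w) \<and> path_to G w \<mu> \<and> path_to G w \<nu> \<and>
    w \<in> V \<and> set \<mu> \<subseteq> F \<and> set \<nu> \<subseteq> F \<and> length \<mu> \<le> length xs \<and> length \<nu> \<le> length xs)"
  using xs
proof (induction xs rule: list_nonempty_induct)
  case (single x)
  then consider (V) v where "x = Vert v" "v \<in> V" | (E) e where "x = Edge e" "e \<in> F" | (G) e where "x = Ghost e" "e \<in> F"
    by (auto simp: gens_of_def)
  then show ?case
  proof cases
    case V
    then show ?thesis using assms(2)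
      by (intro disjI2 exI[of _ "[]"] exI[of _ v]) (auto simp: path_word_def)
  next
    case E
    then show ?thesis using F hV Edge_Vert[of e K]
      by (intro disjI2 exI[of _ "[e]"] exI[of _ "[]"] exI[of _ "head G e"]) (auto simp: path_word_def intro: word_cong_sym)
  next
    case G
    then show ?thesis using F hV Vert_Ghost[of e K]
      by (intro disjI2 exI[of _ "[]"] exI[of _ "[e]"] exI[of _ "head G e"]) (auto simp: path_word_def intro: word_cong_sym)
  qed
next
  case (cons x xs)
  then consider (V) v where "x = Vert v" "v \<in> V" | (E) e where "x = Edge e" "e \<in> F" | (G) e where "x = Ghost e" "e \<in> F"
    by (auto simp: gens_of_def)
  note x_cases = this
  have x: "set [x] \<subseteq> graph_gens G" using x_cases F V by cases (auto simp: graph_gens_def)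
  from cons consider (null) "word_null G K xs"
    | (nf) \<mu> \<nu> w where "word_cong G K xs (path_word \<mu> \<nu> w)" "path_to G w \<mu>" "path_to G w \<nu>"
      "w \<in> V" "set \<mu> \<subseteq> F" "set \<nu> \<subseteq> F" "length \<mu> \<le> length xs" "length \<nu> \<le> length xs"
    by auto
  then show ?case
  proof cases
    case null
    then show ?thesis using word_null_ctxt[OF null x, of "[]"] by simp
  next
    case nf
    let ?G = "map Ghost (rev \<nu>)"
    have cong: "word_cong G K (x # xs) (x # path_word \<mu> \<nu> w)"
      using word_cong_ctxt[OF nf(1) x, of "[]"] by simp
    have gG: "set ?G \<subseteq> graph_gens G" using path_gens[OF nf(3)] by simp
    have gE: "set (map Edge \<mu>) \<subseteq> graph_gens G" "Vert w \<in> graph_gens G" using path_gens[OF nf(2)] by simp_all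
    have gW: "set (path_word \<mu> \<nu> w) \<subseteq> graph_gens G" using gG gE by (auto simp: path_word_def)
    have ?thesis if "word_null G K (x # path_word \<mu> \<nu> w)"
      using word_null_cong[OF cong that] by simp
    moreover have ?thesis if "word_cong G K (x # path_word \<mu> \<nu> w) (path_word \<mu>' \<nu>' w')" "path_to G w' \<mu>'"
        "path_to G w' \<nu>'" "w' \<in> V" "set \<mu>' \<subseteq> F" "set \<nu>' \<subseteq> F" "length \<mu>' \<le> Suc (length xs)"
        "length \<nu>' \<le> Suc (length xs)" for \<mu>' \<nu>' w'
      using word_cong_trans[OF cong that(1)] that by auto
    moreover from x_cases have "word_null G K (x # path_word \<mu> \<nu> w) \<or>
      (\<exists>\<mu>' \<nu>' w'. word_cong G K (x # path_word \<mu> \<nu> w) (path_word \<mu>' \<nu>' w') \<and> path_to G w' \<mu>' \<and>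
        path_to G w' \<nu>' \<and> w' \<in> V \<and> set \<mu>' \<subseteq> F \<and> set \<nu>' \<subseteq> F \<and> length \<mu>' \<le> Suc (length xs) \<and>
        length \<nu>' \<le> Suc (length xs))" (is "?N \<or> ?Q")
    proof cases
      case V
      show ?thesis
      proof (cases "v = path_src G w \<mu>")
        case True
        then have "word_cong G K (x # path_word \<mu> \<nu> w) (path_word \<mu> \<nu> w)"
          using path_absorb_src[OF nf(2) gG] V by (simp add: path_word_def)
        then show ?thesis using nf
          by (intro disjI2 exI[of _ \<mu>] exI[of _ \<nu>] exI[of _ w]) auto
      next
        case False
        then have ?N using path_kill_src[OF nf(2) gG, of v] V \<open>V \<subseteq> verts G\<close> by (auto simp: path_word_def)
        then show ?thesis ..
      qed
    next
      case E
      show ?thesis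
      proof (cases "head G e = path_src G w \<mu>")
        case True
        have "x # path_word \<mu> \<nu> w = path_word (e # \<mu>) \<nu> w" using E by (simp add: path_word_def)
        then show ?thesis using nf True E F
          by (intro disjI2 exI[of _ "e # \<mu>"] exI[of _ \<nu>] exI[of _ w]) auto
      next
        case False
        have e: "e \<in> arcs G" using E F by auto
        have "word_null G K (Vert (head G e) # path_word \<mu> \<nu> w)"
          using path_kill_src[OF nf(2) gG, of "head G e"] False e by (simp add: path_word_def)
        then have "word_null G K ([Edge e, Vert (head G e)] @ path_word \<mu> \<nu> w)"
          using word_null_ctxt[of K _ "[Edge e]" "[]"] gens_Edge[OF e] by fastforce
        moreover have "word_cong G K (x # path_word \<mu> \<nu> w) ([Edge e, Vert (head G e)] @ path_word \<mu> \<nu> w)"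
          using word_cong_ctxt[OF word_cong_sym[OF Edge_Vert[OF e]] _ gW, of "[]" K] E by simp
        ultimately have ?N by (metis word_null_cong)
        then show ?thesis ..
      qed
    next
      case G
      have e: "e \<in> arcs G" using G F by auto
      show ?thesis
      proof (cases \<mu>)
        case (Cons f \<mu>')
        have f: "f \<in> arcs G" "head G f = path_src G w \<mu>'" "path_to G w \<mu>'" using nf(2) Cons by auto
        have gr: "set (map Edge \<mu>' @ Vert w # ?G) \<subseteq> graph_gens G" using gG gE Cons by auto
        show ?thesis
        proof (cases "e = f")
          case True
          have "word_cong G K (x # path_word \<mu> \<nu> w) (Vert (head G e) # map Edge \<mu>' @ Vert w # ?G)"
            using word_cong_ctxt[OF Ghost_Edge[OF e] _ gr, of "[]" K] True G Cons by (simp add: path_word_def)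
          also have "word_cong G K (Vert (head G e) # map Edge \<mu>' @ Vert w # ?G) (path_word \<mu>' \<nu> w)"
            using path_absorb_src[OF f(3) gG, of K] f(2) True by (simp add: path_word_def)
          finally show ?thesis using nf Cons f
            by (intro disjI2 exI[of _ \<mu>'] exI[of _ \<nu>] exI[of _ w]) auto
        next
          case False
          have ?N using word_null_ctxt[OF Ghost_Edge_null[OF e f(1) False] _ gr, of "[]" K] G Cons
            by (simp add: path_word_def)
          then show ?thesis ..
        qed
      next
        case Nil
        show ?thesis
        proof (cases "w = tail G e")
          case True
          have "word_cong G K (x # path_word \<mu> \<nu> w) (Ghost e # ?G)"
            using word_cong_ctxt[OF Ghost_Vert[OF e] _ gG, of "[]" K] True G Nil by (simp add: path_word_def)
          also have "word_cong G K (Ghost e # ?G) (path_word [] (\<nu> @ [e]) (head G e))"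
            using word_cong_ctxt[OF word_cong_sym[OF Vert_Ghost[OF e]] _ gG, of "[]" K] by (simp add: path_word_def)
          finally show ?thesis using nf G F hV e True
            by (intro disjI2 exI[of _ "[]"] exI[of _ "\<nu> @ [e]"] exI[of _ "head G e"]) (auto simp: path_to_append)
        next
          case False
          have null: "word_null G K [Vert (tail G e), Vert w]"
            using False nf(4) V e by (intro Vert_Vert_null) auto
          have "word_null G K ([Ghost e] @ [Vert (tail G e), Vert w] @ ?G)"
            using gens_Ghost[OF e] by (intro word_null_ctxt[OF null _ gG]) simp
          moreover have "word_cong G K (x # path_word \<mu> \<nu> w) ([Ghost e] @ [Vert (tail G e), Vert w] @ ?G)"
            using word_cong_ctxt[OF word_cong_sym[OF Ghost_Vert[OF e]] _ gW, of "[]" K] G Nil by (simp add: path_word_def)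
          ultimately have ?N by (metis word_null_cong)
          then show ?thesis ..
        qed
      qed
    qed
    ultimately show ?thesis by blast
  qed
qed

lemma cuntz_krieger_path_word:
  assumes w: "regular_vertex G w" and \<mu>: "path_to G w \<mu>" and \<nu>: "path_to G w \<nu>"
  shows "(word (path_word \<mu> \<nu> w) :: ('a, 'b, 'k::field) graph_free) -
    (\<Sum>e\<in>out_arcs G w. word (path_word (\<mu> @ [e]) (\<nu> @ [e]) (head G e))) \<in> leavitt_ideal G"
proof -
  interpret LI: quotient_alg "free_algebra (graph_gens G)" "leavitt_ideal G :: ('a, 'b, 'k) graph_free set"
    by (rule quotient_alg_leavitt[OF wf_digraph])
  let ?l = "map Edge \<mu>" and ?r = "map Ghost (rev \<nu>)"
  have g: "set ?l \<subseteq> graph_gens G" "set ?r \<subseteq> graph_gens G" using path_gens[OF \<mu>] path_gens[OF \<nu>] by auto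
  have "(gen_p w :: ('a, 'b, 'k) graph_free) - (\<Sum>e\<in>out_arcs G w. gen_s e * gen_s_star e) \<in> leavitt_relations G"
    using w unfolding leavitt_relations_def by blast
  from word_sandwich[OF subsetD[OF ideal_generated_superset this] g]
  have "word ?l * gen_p w * word ?r - (\<Sum>e\<in>out_arcs G w. word ?l * (gen_s e * gen_s_star e) * word ?r)
      \<in> (leavitt_ideal G :: ('a, 'b, 'k) graph_free set)"
    by (simp only: right_diff_distrib left_diff_distrib sum_distrib_left sum_distrib_right)
  moreover have "word ?l * gen_p w * word ?r = (word (path_word \<mu> \<nu> w) :: ('a, 'b, 'k) graph_free)"
    by (simp add: gen_p_def path_word_def Poly_Mapping.mult_single plus_free_monoid_def)
  moreover have "word ?l * (gen_s e * gen_s_star e) * word ?r =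
      (word (?l @ [Edge e, Ghost e] @ ?r) :: ('a, 'b, 'k) graph_free)" for e
    by (simp add: gen_s_def gen_s_star_def Poly_Mapping.mult_single plus_free_monoid_def)
  ultimately have 1: "(word (path_word \<mu> \<nu> w) :: ('a, 'b, 'k) graph_free) -
      (\<Sum>e\<in>out_arcs G w. word (?l @ [Edge e, Ghost e] @ ?r)) \<in> leavitt_ideal G"
    by (simp only:)
  have "word_cong G TYPE('k) (?l @ [Edge e, Ghost e] @ ?r) (path_word (\<mu> @ [e]) (\<nu> @ [e]) (head G e))"
    if "e \<in> out_arcs G w" for e
  proof -
    have e: "e \<in> arcs G" using that by auto
    have "word_cong G TYPE('k) (?l @ [Edge e] @ (Ghost e # ?r)) (?l @ [Edge e, Vert (head G e)] @ (Ghost e # ?r))"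
      using g e by (intro word_cong_ctxt word_cong_sym[OF Edge_Vert]) (auto simp: graph_gens_def)
    then show ?thesis by (simp add: path_word_def)
  qed
  then have 2: "(\<Sum>e\<in>out_arcs G w. word (?l @ [Edge e, Ghost e] @ ?r) -
      (word (path_word (\<mu> @ [e]) (\<nu> @ [e]) (head G e)) :: ('a, 'b, 'k) graph_free)) \<in> leavitt_ideal G"
    by (intro LI.I_sum) (simp add: word_cong_def)
  show ?thesis using LI.I_add[OF 1 2] by (simp add: sum_subtractf)
qed

end

definition normal_span ::
    "('v, 'e) pre_digraph \<Rightarrow> 'e set \<Rightarrow> 'v set \<Rightarrow> nat \<Rightarrow> ('v, 'e, 'k::field) graph_free set" where
  "normal_span E F V M = {a. \<exists>k. a - (\<Sum>i\<in>normal_index E F V M. Poly_Mapping.single 0 (k i) * normal_form E F M i)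
     \<in> leavitt_ideal E}"

context wf_digraph
begin

context
  fixes K :: "'k::field itself" and F V and M :: nat
  assumes F: "finite F" "F \<subseteq> arcs G" and V: "finite V" "V \<subseteq> verts G" and hV: "head G ` F \<subseteq> V"
begin

interpretation LI: quotient_alg "free_algebra (graph_gens G)" "leavitt_ideal G :: ('a, 'b, 'k) graph_free set"
  by (rule quotient_alg_leavitt[OF wf_digraph])

abbreviation "nspan \<equiv> normal_span G F V M :: ('a, 'b, 'k) graph_free set"

lemma span_ideal: "x \<in> leavitt_ideal G \<Longrightarrow> x \<in> nspan"
  by (auto simp: normal_span_def intro!: exI[of _ "\<lambda>_. 0"])

lemma span_add:
  assumes "x \<in> nspan" "y \<in> nspan"
  shows "x + y \<in> nspan"
proof -
  let ?s = "\<lambda>k. (\<Sum>i\<in>normal_index G F V M. Poly_Mapping.single 0 (k i) * normal_form G F M i) :: ('a, 'b, 'k) graph_free"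
  obtain k l where "x - ?s k \<in> leavitt_ideal G" "y - ?s l \<in> leavitt_ideal G"
    using assms by (auto simp: normal_span_def)
  then have "(x - ?s k) + (y - ?s l) \<in> leavitt_ideal G" by (rule LI.I_add)
  moreover have "?s (\<lambda>i. k i + l i) = ?s k + ?s l"
    by (simp add: single_add distrib_right sum.distrib)
  ultimately have "x + y - ?s (\<lambda>i. k i + l i) \<in> leavitt_ideal G" by (simp add: algebra_simps)
  then show ?thesis unfolding normal_span_def by (intro CollectI exI)
qed

lemma span_scale:
  assumes "x \<in> nspan"
  shows "Poly_Mapping.single 0 c * x \<in> nspan"
proof -
  let ?s = "\<lambda>k. (\<Sum>i\<in>normal_index G F V M. Poly_Mapping.single 0 (k i) * normal_form G F M i) :: ('a, 'b, 'k) graph_free"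
  obtain k where "x - ?s k \<in> leavitt_ideal G" using assms by (auto simp: normal_span_def)
  then have "Poly_Mapping.single 0 c * (x - ?s k) \<in> leavitt_ideal G" using LI.I_scale by simp
  moreover have "?s (\<lambda>i. c * k i) = Poly_Mapping.single 0 c * ?s k"
    by (simp add: sum_distrib_left mult.assoc[symmetric] Poly_Mapping.mult_single)
  ultimately have "Poly_Mapping.single 0 c * x - ?s (\<lambda>i. c * k i) \<in> leavitt_ideal G"
    by (simp add: right_diff_distrib)
  then show ?thesis unfolding normal_span_def by (intro CollectI exI)
qed

lemma span_sum: "(\<And>i. i \<in> S \<Longrightarrow> f i \<in> nspan) \<Longrightarrow> sum f S \<in> nspan"
  by (induction S rule: infinite_finite_induct) (auto simp: span_add intro: span_ideal LI.I_zero)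

lemma span_normal_form:
  assumes "i \<in> normal_index G F V M"
  shows "normal_form G F M i \<in> nspan"
proof -
  have "(\<Sum>j\<in>normal_index G F V M. Poly_Mapping.single 0 (if j = i then 1 else 0) * normal_form G F M j)
      = (\<Sum>j\<in>normal_index G F V M. if j = i then normal_form G F M i else (0 :: ('a, 'b, 'k) graph_free))"
    by (rule sum.cong) auto
  also have "\<dots> = normal_form G F M i"
    using assms finite_normal_index[OF F(1) V(1)] by simp
  finally show ?thesis
    by (auto simp: normal_span_def LI.I_zero intro!: exI[of _ "\<lambda>j. if j = i then 1 else 0"])
qed

text \<open>Below level M a word is its normal form plus words one level higher. The normal form is
  either indexed or, at a regular vertex with all its edges in \<open>F\<close>, in the ideal. The
  bound M + |\<nu>| on |\<mu>| survives each step, as both paths grow together, and becomes 2 M at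
  the top.\<close>

lemma path_word_in_span:
  assumes "path_to G w \<mu>" "path_to G w \<nu>" "w \<in> V" "set \<mu> \<subseteq> F" "set \<nu> \<subseteq> F"
    "length \<mu> \<le> M + length \<nu>" "length \<nu> \<le> M"
  shows "word (path_word \<mu> \<nu> w) \<in> nspan"
  using assms
proof (induction "M - length \<nu>" arbitrary: \<mu> \<nu> w)
  case 0
  then have len: "length \<nu> = M" by simp
  then have "(\<mu>, \<nu>, w) \<in> normal_index G F V M" using 0 by (auto simp: normal_index_def)
  then have "normal_form G F M (\<mu>, \<nu>, w) \<in> nspan" by (rule span_normal_form)
  then show ?case by (simp add: normal_form_def len)
next
  case (Suc n)
  let ?S = "{e \<in> F. tail G e = w}"
  let ?sum = "\<Sum>e\<in>?S. word (path_word (\<mu> @ [e]) (\<nu> @ [e]) (head G e)) :: ('a, 'b, 'k) graph_free"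
  have lt: "length \<nu> < M" using Suc.hyps(2) by simp
  have "word (path_word (\<mu> @ [e]) (\<nu> @ [e]) (head G e)) \<in> nspan" if "e \<in> ?S" for e
  proof (rule Suc.hyps(1))
    show "n = M - length (\<nu> @ [e])" using Suc.hyps(2) by simp
    show "path_to G (head G e) (\<mu> @ [e])" "path_to G (head G e) (\<nu> @ [e])"
      using that Suc.prems F by (auto simp: path_to_append)
  qed (use that Suc.prems hV lt in auto)
  then have sum: "?sum \<in> nspan" by (rule span_sum)
  have nf: "normal_form G F M (\<mu>, \<nu>, w) = word (path_word \<mu> \<nu> w) - ?sum"
    using lt by (simp add: normal_form_def)
  have "normal_form G F M (\<mu>, \<nu>, w) \<in> nspan"
  proof (cases "regular_vertex G w \<and> out_arcs G w \<subseteq> F")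
    case True
    then have "?S = out_arcs G w" using F by auto
    then show ?thesis
      unfolding nf using cuntz_krieger_path_word[of w \<mu> \<nu>] True Suc.prems by (intro span_ideal) simp
  next
    case False
    then have "(\<mu>, \<nu>, w) \<in> normal_index G F V M" using Suc.prems lt by (auto simp: normal_index_def)
    then show ?thesis by (rule span_normal_form)
  qed
  from span_add[OF this sum] show ?case by (simp add: nf)
qed

lemma word_in_span:
  assumes "xs \<noteq> []" "set xs \<subseteq> gens_of F V" "length xs \<le> M"
  shows "word xs \<in> nspan"
  using word_reduce[OF F(2) V(2) hV assms(1,2), of K]
proof (elim disjE exE conjE)
  assume "word_null G K xs"
  then show ?thesis by (intro span_ideal) (simp add: word_null_def)
next
  fix \<mu> \<nu> w
  assume *: "word_cong G K xs (path_word \<mu> \<nu> w)" "path_to G w \<mu>" "path_to G w \<nu>" "w \<in> V"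
    "set \<mu> \<subseteq> F" "set \<nu> \<subseteq> F" "length \<mu> \<le> length xs" "length \<nu> \<le> length xs"
  have "word xs - word (path_word \<mu> \<nu> w) \<in> nspan"
    using *(1) by (intro span_ideal) (simp add: word_cong_def)
  moreover have "word (path_word \<mu> \<nu> w) \<in> nspan"
    using * assms(3) by (intro path_word_in_span) auto
  ultimately show ?thesis using span_add by fastforce
qed

lemma in_normal_span:
  assumes "\<And>u. u \<in> Poly_Mapping.keys a \<Longrightarrow> u \<noteq> 0 \<and> set (letters u) \<subseteq> gens_of F V \<and> length (letters u) \<le> M"
  shows "a \<in> nspan"
proof -
  have "Poly_Mapping.single u (Poly_Mapping.lookup a u) \<in> nspan" if "u \<in> Poly_Mapping.keys a" for u
  proof -
    have "Poly_Mapping.single u 1 \<in> nspan"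
      using word_in_span[of "letters u"] assms[OF that] by (cases u) (simp add: zero_free_monoid_def)
    then have "Poly_Mapping.single 0 (Poly_Mapping.lookup a u) * Poly_Mapping.single u 1 \<in> nspan"
      by (rule span_scale)
    then show ?thesis by (simp add: Poly_Mapping.mult_single)
  qed
  then have "(\<Sum>u\<in>Poly_Mapping.keys a. Poly_Mapping.single u (Poly_Mapping.lookup a u)) \<in> nspan"
    by (rule span_sum)
  then show ?thesis by (simp add: poly_mapping_sum_single)
qed

end

lemma finitely_many_letters:
  assumes "a \<in> carrier (free_algebra (graph_gens G))"
  obtains F V M where "finite F" "F \<subseteq> arcs G" "finite V" "V \<subseteq> verts G" "head G ` F \<subseteq> V"
    "\<And>u. u \<in> Poly_Mapping.keys a \<Longrightarrow> set (letters u) \<subseteq> gens_of F V \<and> length (letters u) \<le> M"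
proof -
  define L where "L = (\<Union>u\<in>Poly_Mapping.keys a. set (letters u))"
  have L: "finite L" "L \<subseteq> graph_gens G" using assms by (auto simp: L_def in_carrier_free_algebra)
  define F where "F = {e. Edge e \<in> L \<or> Ghost e \<in> L}"
  define V where "V = {v. Vert v \<in> L} \<union> head G ` F"
  have "F = Edge -` L \<union> Ghost -` L" by (auto simp: F_def)
  then have F: "finite F" "F \<subseteq> arcs G"
    using L by (auto simp: graph_gens_def intro!: finite_vimageI injI)
  have "{v. Vert v \<in> L} = Vert -` L" by auto
  then have V: "finite V" "V \<subseteq> verts G"
    using L F by (auto simp: V_def graph_gens_def intro!: finite_vimageI injI)
  have "L \<subseteq> gens_of F V"
  proof
    fix x assume "x \<in> L"
    then show "x \<in> gens_of F V" by (cases x) (auto simp: gens_of_def F_def V_def)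
  qed
  moreover have "length (letters u) \<le> Max ((\<lambda>u. length (letters u)) ` Poly_Mapping.keys a)"
    if "u \<in> Poly_Mapping.keys a" for u using that by (intro Max_ge) auto
  ultimately show ?thesis
    using F V by (intro that[of F V "Max ((\<lambda>u. length (letters u)) ` Poly_Mapping.keys a)"])
      (auto simp: L_def V_def)
qed

end

section \<open>Boundary paths\<close>

codatatype 'e bpath = BNil | BCons 'e "'e bpath"

coinductive boundary_path :: "('v, 'e) pre_digraph \<Rightarrow> 'v \<Rightarrow> 'e bpath \<Rightarrow> bool" for E where
  Nil: "v \<in> verts E \<Longrightarrow> \<not> regular_vertex E v \<Longrightarrow> boundary_path E v BNil"
| Cons: "e \<in> arcs E \<Longrightarrow> tail E e = v \<Longrightarrow> boundary_path E (head E e) p \<Longrightarrow> boundary_path E v (BCons e p)"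

primcorec some_bpath :: "('v, 'e) pre_digraph \<Rightarrow> 'v \<Rightarrow> 'e bpath" where
  "some_bpath E v = (if regular_vertex E v
     then BCons (SOME e. e \<in> out_arcs E v) (some_bpath E (head E (SOME e. e \<in> out_arcs E v))) else BNil)"

context wf_digraph
begin

lemma boundary_path_some_bpath:
  assumes "v \<in> verts G"
  shows "boundary_path G v (some_bpath G v)"
  using assms
proof (coinduction arbitrary: v)
  case (boundary_path v)
  show ?case
  proof (cases "regular_vertex G v")
    case False
    then have "some_bpath G v = BNil" by (simp add: some_bpath.code)
    then show ?thesis using boundary_path False by blast
  next
    case True
    define e where "e = (SOME e. e \<in> out_arcs G v)"
    have "\<exists>e. e \<in> out_arcs G v" using True by (simp add: regular_vertex_def ex_in_conv del: in_out_arcs_conv)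
    then have "e \<in> out_arcs G v" unfolding e_def by (rule someI_ex)
    moreover have "some_bpath G v = BCons e (some_bpath G (head G e))"
      using True by (subst some_bpath.code) (simp add: e_def)
    ultimately show ?thesis by auto
  qed
qed

text \<open>Points carry their source vertex explicitly, since \<open>BNil\<close> does not
  determine it.\<close>

lemma branching_boundary_paths:
  "branching G {(v, p). boundary_path G v p} fst (\<lambda>e x. (tail G e, BCons e (snd x)))"
proof (rule branching.intro)
  show "wf_digraph G" by (rule wf_digraph)
  show "\<exists>e\<in>arcs G. \<exists>y\<in>{(v, p). boundary_path G v p}. fst y = head G e \<and> x = (tail G e, BCons e (snd y))"
    if "x \<in> {(v, p). boundary_path G v p}" "regular_vertex G (fst x)" for x
  proof -
    have b: "boundary_path G (fst x) (snd x)" using that(1) by auto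
    then show ?thesis
    proof cases
      case Nil
      then show ?thesis using that(2) by simp
    next
      case (Cons e p)
      then have "(head G e, p) \<in> {(v, p). boundary_path G v p} \<and> x = (tail G e, BCons e p)"
        by (cases x) auto
      then show ?thesis using Cons(2) by fastforce
    qed
  qed
qed (auto intro: boundary_path.Cons)

lemma gen_p_in_branching:
  assumes v: "v \<in> verts G"
  obtains X :: "('a \<times> 'b bpath) set" and src cons x where "branching G X src cons"
    "branching.mc G X src cons (gen_p v) x x = (1 :: 'k::field)"
proof -
  interpret branching G "{(v, p). boundary_path G v p}" fst "\<lambda>e x. (tail G e, BCons e (snd x))"
    by (rule branching_boundary_paths)
  have "mc (gen_p v) (v, some_bpath G v) (v, some_bpath G v) = (1 :: 'k)"
    using boundary_path_some_bpath[OF v] by (simp add: mc_def Op_gen_p)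
  then show ?thesis by (rule that[OF branching_boundary_paths])
qed

lemma gen_p_not_in_leavitt_ideal:
  assumes "v \<in> verts G"
  shows "(gen_p v :: ('a, 'b, 'k::field) graph_free) \<notin> leavitt_ideal G"
proof
  assume *: "(gen_p v :: ('a, 'b, 'k) graph_free) \<in> leavitt_ideal G"
  obtain X :: "('a \<times> 'b bpath) set" and src cons x where X: "branching G X src cons"
    "branching.mc G X src cons (gen_p v) x x = (1 :: 'k)"
    using gen_p_in_branching[OF assms] by blast
  then show False using branching.mc_leavitt_ideal[OF X(1) *] by simp
qed

section \<open>Leavitt path algebras\<close>

theorem rfd_leavitt_imp_bellier:
  assumes rfd: "rfd_algebra (leavitt_path_algebra G :: ('k::field, ('a, 'b, 'k) graph_free set) nu_algebra)"
  shows "bellier_conditions G"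
proof (rule bellier_necessary)
  interpret LI: quotient_alg "free_algebra (graph_gens G)" "leavitt_ideal G :: ('a, 'b, 'k) graph_free set"
    by (rule quotient_alg_leavitt[OF wf_digraph])
  fix v assume v: "v \<in> verts G"
  let ?p = "gen_p v :: ('a, 'b, 'k) graph_free"
  have p: "?p \<in> carrier (free_algebra (graph_gens G))" using v by (rule gen_in_carrier)
  have "LI.cs ?p \<noteq> LI.cs 0" using gen_p_not_in_leavitt_ideal[OF v, where 'k = 'k] by (simp add: LI.coset_eq_iff)
  then obtain n \<pi> where \<pi>: "fin_dim_rep LI.Q n \<pi>" "\<pi> (LI.cs ?p) \<noteq> 0\<^sub>m n n"
    using rfd p unfolding rfd_algebra_def leavitt_path_algebra_def LI.quotient_zero LI.carrier_quotient by blast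
  then show "\<exists>n. \<exists>\<phi> :: ('a, 'b, 'k) graph_free \<Rightarrow> 'k mat. leavitt_rep G n \<phi> \<and> \<phi> (gen_p v) \<noteq> 0\<^sub>m n n"
    using LI.fin_dim_rep_pullback[OF \<pi>(1)] unfolding leavitt_rep_def by blast
qed

end

section \<open>Sufficiency of the graph conditions for the Leavitt path algebra\<close>

context bellier_digraph
begin

lemma normal_coefficient:
  fixes a :: "('a, 'b, 'k::field) graph_free"
  assumes F: "finite F" and V: "finite V" and i0: "i0 \<in> normal_index G F V M"
    and k: "a - (\<Sum>i\<in>normal_index G F V M. Poly_Mapping.single 0 (k i) * normal_form G F M i) \<in> leavitt_ideal G"
  obtains w d y x where "path_end G w d" "y \<in> path_space G w d" "x \<in> path_space G w d"
    "branching.mc G (path_space G w d) (path_src G w) (path_cons d) a y x = k i0"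
proof -
  let ?T = "normal_index G F V M"
  obtain w d y x where w: "path_end G w d" "y \<in> path_space G w d" "x \<in> path_space G w d"
    and mc: "\<And>i. i \<in> ?T \<Longrightarrow> branching.mc G (path_space G w d) (path_src G w) (path_cons d)
        (normal_form G F M i) y x = (if i = i0 then 1 else 0 :: 'k)"
    using coefficient_detection[OF F i0] by blast
  interpret branching G "path_space G w d" "path_src G w" "path_cons d"
    by (rule branching_path_space[OF wf_digraph w(1)])
  have "mc a y x = mc (\<Sum>i\<in>?T. Poly_Mapping.single 0 (k i) * normal_form G F M i) y x"
    using mc_leavitt_ideal[OF k, of y x] by (simp add: mc_diff)
  also have "\<dots> = (\<Sum>i\<in>?T. if i = i0 then k i0 else 0)"
    unfolding mc_sum mc_scale using mc by (intro sum.cong) auto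
  also have "\<dots> = k i0"
    using i0 finite_normal_index[OF F V] by simp
  finally show ?thesis by (rule that[OF w])
qed

lemma not_in_leavitt_ideal_detect:
  fixes a :: "('a, 'b, 'k::field) graph_free"
  assumes a: "a \<in> carrier (free_algebra (graph_gens G))" and nz: "a \<notin> leavitt_ideal G"
  obtains w d y x where "path_end G w d" "y \<in> path_space G w d" "x \<in> path_space G w d"
    "branching.mc G (path_space G w d) (path_src G w) (path_cons d) a y x \<noteq> 0"
proof -
  obtain F V M where FV: "finite F" "F \<subseteq> arcs G" "finite V" "V \<subseteq> verts G" "head G ` F \<subseteq> V"
    "\<And>u. u \<in> Poly_Mapping.keys a \<Longrightarrow> set (letters u) \<subseteq> gens_of F V \<and> length (letters u) \<le> M"
    using finitely_many_letters[OF a] by blast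
  let ?T = "normal_index G F V M"
  have "a \<in> normal_span G F V M"
    using FV a by (intro in_normal_span) (auto simp: in_carrier_free_algebra)
  then obtain k where k: "a - (\<Sum>i\<in>?T. Poly_Mapping.single 0 (k i) * normal_form G F M i) \<in> leavitt_ideal G"
    by (auto simp: normal_span_def)
  have "\<exists>i0\<in>?T. k i0 \<noteq> 0"
  proof (rule ccontr)
    assume "\<not> (\<exists>i0\<in>?T. k i0 \<noteq> 0)"
    then have "(\<Sum>i\<in>?T. Poly_Mapping.single 0 (k i) * normal_form G F M i) = 0" by (intro sum.neutral) simp
    then show False using k nz by simp
  qed
  then obtain i0 where i0: "i0 \<in> ?T" "k i0 \<noteq> 0" by blast
  show ?thesis by (rule normal_coefficient[OF FV(1,3) i0(1) k]) (use that i0 in auto)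
qed

theorem rfd_leavitt: "rfd_algebra (leavitt_path_algebra G :: ('k::field, ('a, 'b, 'k) graph_free set) nu_algebra)"
  unfolding rfd_algebra_def leavitt_path_algebra_def
proof (intro ballI impI)
  interpret LI: quotient_alg "free_algebra (graph_gens G)" "leavitt_ideal G :: ('a, 'b, 'k) graph_free set"
    by (rule quotient_alg_leavitt[OF wf_digraph])
  fix A assume A: "A \<in> carrier LI.Q" "A \<noteq> alg_zero LI.Q"
  then obtain a where a: "a \<in> carrier (free_algebra (graph_gens G))" "A = LI.cs a"
    by (auto simp: LI.carrier_quotient)
  then have "a \<notin> leavitt_ideal G" using A LI.coset_eq_iff[of a 0] by (simp add: LI.quotient_zero)
  then obtain w d y x where w: "path_end G w d" "y \<in> path_space G w d" "x \<in> path_space G w d"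
    and nz: "branching.mc G (path_space G w d) (path_src G w) (path_cons d) a y x \<noteq> 0"
    using not_in_leavitt_ideal_detect[OF a(1)] by blast
  interpret branching G "path_space G w d" "path_src G w" "path_cons d"
    by (rule branching_path_space[OF wf_digraph w(1)])
  obtain h where h: "bij_betw h {0..<card (path_space G w d)} (path_space G w d)"
    using ex_bij_betw_nat_finite[OF finite_path_space[OF w(1)]] by blast
  let ?n = "card (path_space G w d)"
  have ker: "matr h ?n x = 0\<^sub>m ?n ?n" if "x \<in> leavitt_ideal G" for x :: "('a, 'b, 'k) graph_free"
    using that by (simp add: matr_eq_zero_iff[OF h] mc_leavitt_ideal)
  have D: "fin_dim_rep LI.Q ?n (\<lambda>X. matr h ?n (LI.coset_rep X))" "matr h ?n (LI.coset_rep (LI.cs a)) = matr h ?n a"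
    using LI.fin_dim_rep_descend[OF fin_dim_rep_matr[OF h]] ker a(1) by blast+
  have "matr h ?n (LI.coset_rep A) \<noteq> 0\<^sub>m ?n ?n"
    using D(2) nz w by (auto simp: a(2) matr_eq_zero_iff[OF h])
  then show "\<exists>n \<pi>. fin_dim_rep LI.Q n \<pi> \<and> \<pi> A \<noteq> 0\<^sub>m n n" using D(1) by blast
qed

end

section \<open>The universal seminorm\<close>

text \<open>With y the cube root of q / r, Bernoulli's linear bound for y^n becomes a cubic lower
  bound for (q / r)^n, which outgrows the quadratic factor along n = 2^k.\<close>

lemma exponential_growth_le:
  fixes q r A :: real
  assumes r: "r > 0" and q: "q \<ge> 0" and le: "\<And>k. q ^ (2 ^ k) \<le> A * (real (Suc (2 * (2 ^ k * M))))\<^sup>2 * r ^ (2 ^ k)"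
  shows "q \<le> r"
proof (rule ccontr)
  assume "\<not> q \<le> r"
  define y where "y = root 3 (q / r)"
  have y: "y > 1" using \<open>\<not> q \<le> r\<close> r by (simp add: y_def)
  have y3: "y ^ 3 = q / r" unfolding y_def using q r by (intro real_root_pow_pos2) auto
  have A: "A \<ge> 0"
    using le[of 0] q r by (smt (verit) mult_nonneg_nonneg mult_neg_pos power_one_right zero_less_power2 of_nat_0_less_iff
        power_0 zero_less_Suc of_nat_eq_0_iff nat.distinct(1))
  define s where "s = (y - 1) ^ 3"
  have s: "s > 0" using y by (simp add: s_def)
  define B where "B = A * (1 + 2 * real M)\<^sup>2"
  have bound: "real (2 ^ k) * s \<le> B" for k
  proof -
    define n :: nat where "n = 2 ^ k"
    have n: "n \<ge> 1" by (simp add: n_def)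
    have "real n * (y - 1) \<le> y ^ n"
      using Bernoulli_inequality[of "y - 1" n] y by simp
    then have "(real n * (y - 1)) ^ 3 \<le> (y ^ n) ^ 3"
      using y by (intro power_mono) auto
    also have "(y ^ n) ^ 3 = (y ^ 3) ^ n" by (simp flip: power_mult add: mult.commute)
    also have "\<dots> = q ^ n / r ^ n" by (simp add: y3 power_divide)
    also have "\<dots> \<le> A * (real (Suc (2 * (n * M))))\<^sup>2"
      using le[of k] r by (simp add: n_def field_simps)
    also have "\<dots> \<le> A * (real n * (1 + 2 * real M))\<^sup>2"
      using A n by (intro mult_left_mono power_mono) (auto simp: algebra_simps)
    also have "\<dots> = B * (real n)\<^sup>2" by (simp add: B_def power_mult_distrib)
    finally have "(real n * s) * (real n)\<^sup>2 \<le> B * (real n)\<^sup>2"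
      by (simp add: s_def power_mult_distrib power2_eq_square power3_eq_cube algebra_simps)
    then show ?thesis using n by (simp add: n_def)
  qed
  obtain k where "B / s < 2 ^ k" using real_arch_pow[of 2 "B / s"] by auto
  then show False using bound[of k] s by (simp add: field_simps)
qed

context wf_digraph
begin

abbreviation "FA \<equiv> carrier (free_algebra (graph_gens G)) :: ('a, 'b, complex) graph_free set"
abbreviation "N \<equiv> universal_seminorm G"

lemma
  shows N_nonneg: "a \<in> FA \<Longrightarrow> 0 \<le> N a"
    and N_add: "a \<in> FA \<Longrightarrow> b \<in> FA \<Longrightarrow> N (a + b) \<le> N a + N b"
    and N_scale: "a \<in> FA \<Longrightarrow> N (Poly_Mapping.single 0 c * a) = cmod c * N a"
    and N_mult: "a \<in> FA \<Longrightarrow> b \<in> FA \<Longrightarrow> N (a * b) \<le> N a * N b"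
    and N_cstar: "a \<in> FA \<Longrightarrow> N (star_free a * a) = (N a)\<^sup>2"
    and N_relation: "r \<in> cuntz_krieger_relations G \<Longrightarrow> N r = 0"
  using universal_seminorm_in_cuntz_krieger_seminorms[OF wf_digraph]
  by (auto simp: cuntz_krieger_seminorms_def cstar_seminorm_def)

lemma N_zero: "N 0 = 0"
  using N_scale[OF zero_in_carrier, of 0] by simp

lemma N_uminus: "a \<in> FA \<Longrightarrow> N (- a) = N a"
  using N_scale[of a "- 1"] by simp

lemma N_diff: "a \<in> FA \<Longrightarrow> b \<in> FA \<Longrightarrow> N (a - b) \<le> N a + N b"
  using N_add[of a "- b"] by (simp add: N_uminus uminus_in_carrier)

lemma N_sum: "(\<And>i. i \<in> S \<Longrightarrow> f i \<in> FA) \<Longrightarrow> N (sum f S) \<le> (\<Sum>i\<in>S. N (f i))"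
proof (induction S rule: infinite_finite_induct)
  case (insert x S)
  then have "N (f x + sum f S) \<le> N (f x) + N (sum f S)" by (intro N_add sum_in_carrier) auto
  then show ?case using insert by fastforce
qed (simp_all add: N_zero)

lemma N_star_free:
  assumes "a \<in> FA"
  shows "N (star_free a) = N a"
proof -
  have le: "N a \<le> N (star_free a)" if "a \<in> FA" for a
  proof (cases "N a = 0")
    case True
    then show ?thesis using N_nonneg[OF star_free_in_carrier[OF that]] by simp
  next
    case False
    have "N a * N a \<le> N (star_free a) * N a"
      using N_mult[OF star_free_in_carrier[OF that] that] N_cstar[OF that] by (simp add: power2_eq_square)
    moreover have "N a > 0" using False N_nonneg[OF that] by simp
    ultimately show ?thesis by simp
  qed
  show ?thesis using le[OF assms] le[OF star_free_in_carrier[OF assms]] by simp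
qed

section \<open>The kernel of the universal seminorm\<close>

definition "null_ideal = {a \<in> FA. N a = 0}"

lemma quotient_alg_null_ideal: "quotient_alg (free_algebra (graph_gens G)) null_ideal"
proof (rule quotient_alg.intro)
  show "algebra_ideal (free_algebra (graph_gens G)) null_ideal"
    unfolding algebra_ideal_free_algebra
  proof (intro conjI ballI allI)
    show "x + y \<in> null_ideal" if "x \<in> null_ideal" "y \<in> null_ideal" for x y
      using that N_add[of x y] N_nonneg[of "x + y"] by (auto simp: null_ideal_def add_in_carrier)
    show "a * x \<in> null_ideal" "x * a \<in> null_ideal" if "a \<in> FA" "x \<in> null_ideal" for a x
      using that N_mult[of a x] N_nonneg[of "a * x"] N_mult[of x a] N_nonneg[of "x * a"]
      by (auto simp: null_ideal_def mult_in_carrier)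
  qed (auto simp: null_ideal_def N_zero N_scale zero_in_carrier scale_in_carrier)
qed (simp_all add: zero_in_carrier add_in_carrier mult_in_carrier scale_in_carrier right_diff_distrib)

interpretation NI: quotient_alg "free_algebra (graph_gens G)" null_ideal
  by (rule quotient_alg_null_ideal)

lemma null_ideal_star: "x \<in> null_ideal \<Longrightarrow> star_free x \<in> null_ideal"
  by (simp add: null_ideal_def N_star_free star_free_in_carrier)

lemma null_ideal_cuntz_krieger: "x \<in> cuntz_krieger_relations G \<Longrightarrow> x \<in> null_ideal"
  using cuntz_krieger_relations_in_carrier[OF wf_digraph] N_relation by (auto simp: null_ideal_def)

text \<open>The Leavitt relations absent from the Cuntz-Krieger list are algebraic consequences of
  it; those about multiplying ghost edges by vertices follow by applying the involution.\<close>

lemma leavitt_relations_null: "leavitt_relations G \<subseteq> null_ideal"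
proof
  fix r :: "('a, 'b, complex) graph_free" assume "r \<in> leavitt_relations G"
  then consider
    (ck) "r \<in> cuntz_krieger_relations G"
  | (ps) e where "e \<in> arcs G" "r = gen_p (tail G e) * gen_s e - gen_s e"
  | (sp) e where "e \<in> arcs G" "r = gen_s e * gen_p (head G e) - gen_s e"
  | (pt) e where "e \<in> arcs G" "r = gen_p (head G e) * gen_s_star e - gen_s_star e"
  | (tp) e where "e \<in> arcs G" "r = gen_s_star e * gen_p (tail G e) - gen_s_star e"
  | (ts) e f where "e \<in> arcs G" "f \<in> arcs G"
      "r = gen_s_star e * gen_s f - (if e = f then gen_p (head G e) else 0)"
    unfolding leavitt_relations_def cuntz_krieger_relations_def by blast
  note cases = this
  let ?s = "gen_s :: 'b \<Rightarrow> ('a, 'b, complex) graph_free" and ?t = "gen_s_star :: 'b \<Rightarrow> ('a, 'b, complex) graph_free"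
    and ?p = "gen_p :: 'a \<Rightarrow> ('a, 'b, complex) graph_free"
  have c: "?s e \<in> FA" "?t e \<in> FA" "?p (tail G e) \<in> FA" "?p (head G e) \<in> FA" if "e \<in> arcs G" for e
    using that by (auto intro: gen_in_carrier)
  have sts: "?s e * ?t e * ?s e - ?s e \<in> null_ideal" if "e \<in> arcs G" for e
    using that by (intro null_ideal_cuntz_krieger) (unfold cuntz_krieger_relations_def, blast)
  have ts: "?t e * ?s e - ?p (head G e) \<in> null_ideal" if "e \<in> arcs G" for e
    using that by (intro null_ideal_cuntz_krieger) (unfold cuntz_krieger_relations_def, blast)
  have pst: "?p (tail G e) * (?s e * ?t e) - ?s e * ?t e \<in> null_ideal" if "e \<in> arcs G" for e
    using that by (intro null_ideal_cuntz_krieger) (unfold cuntz_krieger_relations_def, blast)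
  have orth: "(?s e * ?t e) * (?s f * ?t f) \<in> null_ideal" if "e \<in> arcs G" "f \<in> arcs G" "e \<noteq> f" for e f
    using that by (intro null_ideal_cuntz_krieger) (unfold cuntz_krieger_relations_def, blast)
  have star: "star_free (?s e) = ?t e" "star_free (?t e) = ?s e" "star_free (?p v) = ?p v" for e v
    by (simp_all add: gen_s_def gen_s_star_def gen_p_def star_free_single star_word_def)
  have sp: "?s e * ?p (head G e) - ?s e \<in> null_ideal" if e: "e \<in> arcs G" for e
  proof -
    have "(?s e * ?t e * ?s e - ?s e) - ?s e * (?t e * ?s e - ?p (head G e)) \<in> null_ideal"
      by (intro NI.I_diff NI.I_mult_left sts ts c e)
    then show ?thesis by (simp add: algebra_simps)
  qed
  have ps: "?p (tail G e) * ?s e - ?s e \<in> null_ideal" if e: "e \<in> arcs G" for e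
  proof -
    have "(?p (tail G e) * (?s e * ?t e) - ?s e * ?t e) * ?s e - ?p (tail G e) * (?s e * ?t e * ?s e - ?s e)
        + (?s e * ?t e * ?s e - ?s e) \<in> null_ideal"
      by (intro NI.I_diff NI.I_add NI.I_mult_left NI.I_mult_right sts pst c e)
    then show ?thesis by (simp add: algebra_simps)
  qed
  from cases show "r \<in> null_ideal"
  proof cases
    case ck
    then show ?thesis by (rule null_ideal_cuntz_krieger)
  next
    case (ps e)
    then show ?thesis using \<open>\<And>e. e \<in> arcs G \<Longrightarrow> ?p (tail G e) * ?s e - ?s e \<in> null_ideal\<close> by simp
  next
    case (sp e)
    then show ?thesis using \<open>\<And>e. e \<in> arcs G \<Longrightarrow> ?s e * ?p (head G e) - ?s e \<in> null_ideal\<close> by simp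
  next
    case (pt e)
    then show ?thesis using null_ideal_star[OF sp[of e]] by (simp add: star_free_diff star_free_mult star)
  next
    case (tp e)
    then show ?thesis using null_ideal_star[OF ps[of e]] by (simp add: star_free_diff star_free_mult star)
  next
    case (ts e f)
    show ?thesis
    proof (cases "e = f")
      case True
      then show ?thesis using ts \<open>\<And>e. e \<in> arcs G \<Longrightarrow> ?t e * ?s e - ?p (head G e) \<in> null_ideal\<close> by simp
    next
      case False
      have tst: "?t e * ?s e * ?t e - ?t e \<in> null_ideal"
        using null_ideal_star[OF sts[of e]] ts(1) by (simp add: star_free_diff star_free_mult star mult.assoc)
      \<comment> \<open>The combination equals t_e s_f: this product is expanded to t_e s_e t_e s_f
        t_f s_f, which contains two orthogonal range projections.\<close>
      have "?t e * ((?s e * ?t e) * (?s f * ?t f)) * ?s f - (?t e * ?s e * ?t e - ?t e) * (?s f * ?t f * ?s f)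
          - ?t e * (?s f * ?t f * ?s f - ?s f) \<in> null_ideal"
        using ts False
        by (intro NI.I_diff NI.I_mult_left NI.I_mult_right tst sts orth c mult_in_carrier)
      then show ?thesis using ts False by (simp add: algebra_simps)
    qed
  qed
qed

lemma leavitt_ideal_null: "x \<in> leavitt_ideal G \<Longrightarrow> x \<in> null_ideal"
  using ideal_generated_least[OF NI.ideal leavitt_relations_null] by blast

lemma N_gen_p: "v \<in> verts G \<Longrightarrow> N (gen_p v) \<ge> 1"
proof -
  assume v: "v \<in> verts G"
  obtain X :: "('a \<times> 'b bpath) set" and src cons x where X: "branching G X src cons"
    "branching.mc G X src cons (gen_p v) x x = (1 :: complex)"
    using gen_p_in_branching[OF v] by blast
  interpret branching G X src cons by (rule X(1))
  have "1 \<le> opnorm (gen_p v)" using cmod_mc_le_opnorm[of "gen_p v" x x] X(2) by simp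
  also have "\<dots> \<le> N (gen_p v)"
    by (rule universal_seminorm_upper[OF wf_digraph gen_in_carrier(1)[OF v] opnorm_in_cuntz_krieger_seminorms])
  finally show ?thesis .
qed

definition bounded_words :: "('a, 'b) graph_gen set \<Rightarrow> nat \<Rightarrow> ('a, 'b, complex) graph_free \<Rightarrow> bool" where
  "bounded_words L m a \<longleftrightarrow> (\<forall>u\<in>Poly_Mapping.keys a. u \<noteq> 0 \<and> set (letters u) \<subseteq> L \<and> length (letters u) \<le> m)"

lemma bounded_words_mult:
  assumes "bounded_words L m a" "bounded_words L n b"
  shows "bounded_words L (m + n) (a * b)"
  unfolding bounded_words_def
proof
  fix u assume "u \<in> Poly_Mapping.keys (a * b)"
  then obtain v w where u: "u = v + w" "v \<in> Poly_Mapping.keys a" "w \<in> Poly_Mapping.keys b"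
    using Poly_Mapping.keys_mult[of a b] by blast
  have v: "v \<noteq> 0" "set (letters v) \<subseteq> L" "length (letters v) \<le> m"
    and w: "set (letters w) \<subseteq> L" "length (letters w) \<le> n"
    using assms u by (auto simp: bounded_words_def)
  have "letters u = letters v @ letters w" using u(1) by simp
  moreover have "letters v \<noteq> []" using v(1) by simp
  ultimately show "u \<noteq> 0 \<and> set (letters u) \<subseteq> L \<and> length (letters u) \<le> m + n"
    using v w by (auto simp flip: letters_eq_Nil_iff)
qed

text \<open>A normal form is a signed sum of at most |F| + 1 words, each of seminorm at most 1; the
  bound is independent of the level.\<close>

lemma N_normal_form:
  assumes F: "finite F" "F \<subseteq> arcs G" and i: "i \<in> normal_index G F V M"
  shows "normal_form G F M i \<in> FA" "N (normal_form G F M i) \<le> 1 + real (card F)"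
proof -
  obtain \<mu> \<nu> w where i_eq: "i = (\<mu>, \<nu>, w)" by (cases i)
  have p: "path_to G w \<mu>" "path_to G w \<nu>" using i by (auto simp: i_eq normal_index_def)
  have word: "(word (path_word \<mu> \<nu> w) :: ('a, 'b, complex) graph_free) \<in> FA" "N (word (path_word \<mu> \<nu> w)) \<le> 1"
    if "path_to G w \<mu>" "path_to G w \<nu>" for \<mu> \<nu> w
  proof -
    have "set (path_word \<mu> \<nu> w) \<subseteq> graph_gens G" "path_word \<mu> \<nu> w \<noteq> []"
      using path_gens[OF that(1)] path_gens[OF that(2)] by (auto simp: path_word_def)
    then show "(word (path_word \<mu> \<nu> w) :: ('a, 'b, complex) graph_free) \<in> FA" "N (word (path_word \<mu> \<nu> w)) \<le> 1"
      using single_word_bounded[OF wf_digraph universal_seminorm_in_cuntz_krieger_seminorms[OF wf_digraph]]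
      by (auto intro: word_in_carrier)
  qed
  let ?S = "{e \<in> F. tail G e = w}"
  let ?g = "\<lambda>e. word (path_word (\<mu> @ [e]) (\<nu> @ [e]) (head G e)) :: ('a, 'b, complex) graph_free"
  have g: "?g e \<in> FA" "N (?g e) \<le> 1" if "e \<in> ?S" for e
    using that F p by (auto intro!: word simp: path_to_append)
  have sum: "sum ?g ?S \<in> FA" using g by (intro sum_in_carrier) auto
  have "N (sum ?g ?S) \<le> (\<Sum>e\<in>?S. N (?g e))" using g by (intro N_sum) auto
  also have "\<dots> \<le> (\<Sum>e\<in>?S. 1)" using g by (intro sum_mono) auto
  also have "\<dots> \<le> real (card F)" using F by (simp add: card_mono)
  finally have Ns: "N (sum ?g ?S) \<le> real (card F)" .
  show "normal_form G F M i \<in> FA"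
    using word(1)[OF p] sum by (auto simp: i_eq normal_form_def intro: diff_in_carrier)
  show "N (normal_form G F M i) \<le> 1 + real (card F)"
    using word[OF p] N_diff[OF word(1)[OF p] sum] Ns by (auto simp: i_eq normal_form_def)
qed

end

section \<open>Finite-dimensional representations compute the universal seminorm\<close>

context bellier_digraph
begin

abbreviation "rep_norm w d \<equiv> branching.opnorm G (path_space G w d) (path_src G w) (path_cons d)"
abbreviation "rep_mc w d \<equiv> branching.mc G (path_space G w d) (path_src G w) (path_cons d)"

lemma rep_norm_le_N: "path_end G w d \<Longrightarrow> a \<in> FA \<Longrightarrow> rep_norm w d a \<le> N a"
  by (rule universal_seminorm_upper[OF wf_digraph _
        branching.opnorm_in_cuntz_krieger_seminorms[OF branching_path_space[OF wf_digraph]]])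

text \<open>Modulo the ideal, on which \<open>N\<close> vanishes, \<open>b\<close> is a combination
  of normal forms, and each coefficient is a matrix entry in one of the finite actions, hence at
  most \<open>c\<close> in modulus.\<close>

lemma N_le_card_normal_index:
  assumes F: "finite F" "F \<subseteq> arcs G" and V: "finite V" "V \<subseteq> verts G" and hV: "head G ` F \<subseteq> V"
    and b: "b \<in> FA" "bounded_words (gens_of F V) M b"
    and c: "\<And>w d. path_end G w d \<Longrightarrow> rep_norm w d b \<le> c"
  shows "N b \<le> real (card (normal_index G F V M)) * (c * (1 + real (card F)))"
proof -
  let ?T = "normal_index G F V M"
  have "b \<in> normal_span G F V M"
    using b(2) by (intro in_normal_span F V hV) (auto simp: bounded_words_def)
  then obtain k where k: "b - (\<Sum>i\<in>?T. Poly_Mapping.single 0 (k i) * normal_form G F M i) \<in> leavitt_ideal G"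
    by (auto simp: normal_span_def)
  let ?s = "\<Sum>i\<in>?T. Poly_Mapping.single 0 (k i) * normal_form G F M i :: ('a, 'b, complex) graph_free"
  note nf = N_normal_form[OF F, of _ V M]
  have s: "?s \<in> FA" by (intro sum_in_carrier scale_in_carrier nf)
  have kc: "cmod (k i) * N (normal_form G F M i) \<le> c * (1 + real (card F))" if i: "i \<in> ?T" for i
  proof -
    obtain w d y x where w: "path_end G w d" "rep_mc w d b y x = k i"
      by (rule normal_coefficient[OF F(1) V(1) i k])
    interpret branching G "path_space G w d" "path_src G w" "path_cons d"
      by (rule branching_path_space[OF wf_digraph w(1)])
    have "cmod (k i) \<le> c" using cmod_mc_le_opnorm[of b y x] c[OF w(1)] w(2) by simp
    moreover have "0 \<le> c" using c[OF w(1)] opnorm_nonneg order_trans by blast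
    ultimately show ?thesis using nf[OF i] N_nonneg by (intro mult_mono) auto
  qed
  have "N b = N ((b - ?s) + ?s)" by simp
  also have "\<dots> \<le> N (b - ?s) + N ?s" by (intro N_add diff_in_carrier b s)
  also have "N (b - ?s) = 0" using leavitt_ideal_null[OF k] by (simp add: null_ideal_def)
  also have "N ?s \<le> (\<Sum>i\<in>?T. N (Poly_Mapping.single 0 (k i) * normal_form G F M i))"
    by (intro N_sum scale_in_carrier nf)
  also have "\<dots> = (\<Sum>i\<in>?T. cmod (k i) * N (normal_form G F M i))"
    by (intro sum.cong refl N_scale nf)
  also have "\<dots> \<le> (\<Sum>i\<in>?T. c * (1 + real (card F)))" by (intro sum_mono kc)
  finally show ?thesis by simp
qed

text \<open>
  A spectral radius argument: for self-adjoint \<open>h\<close> the numbers $N(h^{2^k})$ and $N(h)^{2^k}$ agree, while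
  $h^{2^k}$ has polynomially many coefficients, each dominated by a norm in a finite-dimensional
  representation. The polynomial factor disappears in the limit.
\<close>

theorem N_le_rep_norm:
  assumes a: "a \<in> FA" and R: "R > 0" and le: "\<And>w d. path_end G w d \<Longrightarrow> rep_norm w d a \<le> R"
  shows "N a \<le> R"
proof -
  \<comment> \<open>Self-adjointness lets the C*-identity be applied to each successive square, so
    exactly the exponents 2^k are accessible.\<close>
  define h where "h = star_free a * a"
  have h: "h \<in> FA" using a by (auto simp: h_def intro: mult_in_carrier star_free_in_carrier)
  obtain F V M where FV: "finite F" "F \<subseteq> arcs G" "finite V" "V \<subseteq> verts G" "head G ` F \<subseteq> V"
    "\<And>u. u \<in> Poly_Mapping.keys h \<Longrightarrow> set (letters u) \<subseteq> gens_of F V \<and> length (letters u) \<le> M"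
    using finitely_many_letters[OF h] by blast
  define p where "p k = ((\<lambda>x. x * x) ^^ k) h" for k
  have p: "p 0 = h" "p (Suc k) = p k * p k" for k by (simp_all add: p_def)
  have pF: "p k \<in> FA" for k by (induction k) (auto simp: p h mult_in_carrier)
  have star: "star_free (p k) = p k" for k
    by (induction k) (simp_all add: p h_def star_free_mult)
  \<comment> \<open>Squaring doubles the word length but introduces no new letters, so
    \<open>F\<close> and \<open>V\<close> stay fixed while the level grows.\<close>
  have words: "bounded_words (gens_of F V) (2 ^ k * M) (p k)" for k
  proof (induction k)
    case 0
    then show ?case using FV(6) h by (auto simp: p bounded_words_def in_carrier_free_algebra)
  next
    case (Suc k)
    then show ?case using bounded_words_mult[OF Suc Suc] by (simp add: p mult_2 distrib_right)
  qed
  have Np: "N (p k) = N h ^ (2 ^ k)" for k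
  proof (induction k)
    case (Suc k)
    have "N (p (Suc k)) = (N (p k))\<^sup>2" using N_cstar[OF pF[of k]] by (simp add: star p)
    then show ?case using Suc by (simp add: power_mult[symmetric] mult.commute)
  qed (simp add: p)
  have rep: "rep_norm w d (p k) \<le> (R\<^sup>2) ^ (2 ^ k)" if w: "path_end G w d" for w d k
  proof -
    interpret branching G "path_space G w d" "path_src G w" "path_cons d"
      by (rule branching_path_space[OF wf_digraph w])
    show ?thesis
    proof (induction k)
      case 0
      have "opnorm h = (opnorm a)\<^sup>2" unfolding h_def by (rule opnorm_cstar[OF a])
      also have "\<dots> \<le> R\<^sup>2" using le[OF w] by (intro power_mono opnorm_nonneg)
      finally show ?case by (simp add: p)
    next
      case (Suc k)
      have "opnorm (p (Suc k)) \<le> opnorm (p k) * opnorm (p k)" by (simp add: p opnorm_mult)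
      also have "\<dots> \<le> (R\<^sup>2) ^ (2 ^ k) * (R\<^sup>2) ^ (2 ^ k)" using Suc opnorm_nonneg by (intro mult_mono) auto
      also have "\<dots> = (R\<^sup>2) ^ (2 ^ Suc k)" by (simp add: power_add[symmetric] mult_2)
      finally show ?case .
    qed
  qed
  define C where "C = card {\<mu>. set \<mu> \<subseteq> F \<and> length \<mu> \<le> Suc (card F)}"
  \<comment> \<open>Everything in the estimate that does not depend on k.\<close>
  define A where "A = real (card V) * (real C)\<^sup>2 * (1 + real (card F))"
  have "N h \<le> R\<^sup>2"
  proof (rule exponential_growth_le)
    show "R\<^sup>2 > 0" "N h \<ge> 0" using R N_nonneg[OF h] by simp_all
    fix k
    let ?m = "2 ^ k * M"
    have "N h ^ (2 ^ k) \<le> real (card (normal_index G F V ?m)) * ((R\<^sup>2) ^ (2 ^ k) * (1 + real (card F)))"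
      unfolding Np[symmetric] by (rule N_le_card_normal_index[OF FV(1-5) pF words rep])
    also have "\<dots> \<le> real (card V * (C * Suc (2 * ?m))\<^sup>2) * ((R\<^sup>2) ^ (2 ^ k) * (1 + real (card F)))"
      using card_normal_index[OF FV(1,3), of ?m] unfolding C_def
      by (intro mult_right_mono of_nat_mono) auto
    also have "\<dots> = A * (real (Suc (2 * ?m)))\<^sup>2 * (R\<^sup>2) ^ (2 ^ k)"
      unfolding A_def of_nat_mult of_nat_power power_mult_distrib by (simp only: mult_ac)
    finally show "N h ^ (2 ^ k) \<le> A * (real (Suc (2 * ?m)))\<^sup>2 * (R\<^sup>2) ^ (2 ^ k)" .
  qed
  then have "(N a)\<^sup>2 \<le> R\<^sup>2" using N_cstar[OF a] by (simp add: h_def)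
  then show ?thesis using R by (simp add: power2_le_iff_abs_le)
qed

end

section \<open>The graph C*-algebra\<close>

context wf_digraph
begin

abbreviation "CA \<equiv> cauchy_algebra G"

lemma cauchy_algebra_simps:
  "alg_zero CA = 0" "alg_add CA = (+)" "alg_mult CA = (*)"
  "alg_scale CA c X = (\<lambda>n. Poly_Mapping.single 0 c * X n)" "alg_star CA X = (\<lambda>n. star_free (X n))"
  by (auto simp: cauchy_algebra_def Let_def fun_eq_iff)

lemma in_cauchy_algebra:
  "X \<in> carrier CA \<longleftrightarrow> (\<forall>n. X n \<in> FA) \<and> (\<forall>\<epsilon>>0. \<exists>n0. \<forall>m\<ge>n0. \<forall>n\<ge>n0. N (X m - X n) < \<epsilon>)"
  by (simp add: cauchy_algebra_def Let_def)

lemma cauchy_FA: "X \<in> carrier CA \<Longrightarrow> X n \<in> FA"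
  by (simp add: in_cauchy_algebra)

lemma cauchyD:
  assumes "X \<in> carrier CA" "\<epsilon> > 0"
  obtains n0 where "\<And>m n. m \<ge> n0 \<Longrightarrow> n \<ge> n0 \<Longrightarrow> N (X m - X n) < \<epsilon>"
  using assms unfolding in_cauchy_algebra by metis

lemma cauchy_bounded:
  assumes X: "X \<in> carrier CA"
  obtains B where "B > 0" "\<And>n. N (X n) \<le> B"
proof -
  obtain n0 where n0: "\<And>m n. m \<ge> n0 \<Longrightarrow> n \<ge> n0 \<Longrightarrow> N (X m - X n) < 1"
    using cauchyD[OF X, of 1] by auto
  let ?B = "(\<Sum>n\<le>n0. N (X n)) + 1"
  have nn: "0 \<le> N (X n)" for n using N_nonneg cauchy_FA[OF X] by blast
  have le: "N (X n) \<le> (\<Sum>n\<le>n0. N (X n))" if "n \<le> n0" for n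
    using that nn by (intro member_le_sum) auto
  have "N (X n) \<le> ?B" for n
  proof (cases "n \<le> n0")
    case True
    then show ?thesis using le by fastforce
  next
    case False
    have "N (X n) = N ((X n - X n0) + X n0)" by simp
    also have "\<dots> \<le> N (X n - X n0) + N (X n0)" by (intro N_add diff_in_carrier cauchy_FA[OF X])
    finally show ?thesis using n0[of n n0] le[of n0] False by simp
  qed
  moreover have "?B > 0" using sum_nonneg[of "{..n0}" "\<lambda>n. N (X n)"] nn by (simp add: add_nonneg_pos)
  ultimately show ?thesis using that by blast
qed

text \<open>One criterion for several operations: addition uses C = D = 1, multiplication uses
  bounds for the two sequences, and scaling uses |c| + 1, which is positive even for c = 0.\<close>

lemma cauchyI:
  assumes X: "X \<in> carrier CA" and Y: "Y \<in> carrier CA" and Z: "\<And>n. Z n \<in> FA" and CD: "C > 0" "D > 0"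
    and le: "\<And>m n. N (Z m - Z n) \<le> C * N (X m - X n) + D * N (Y m - Y n)"
  shows "Z \<in> carrier CA"
  unfolding in_cauchy_algebra
proof (intro conjI allI impI)
  fix \<epsilon> :: real assume "\<epsilon> > 0"
  obtain m0 where m0: "\<And>m n. m \<ge> m0 \<Longrightarrow> n \<ge> m0 \<Longrightarrow> N (X m - X n) < \<epsilon> / (2 * C)"
    using cauchyD[OF X, of "\<epsilon> / (2 * C)"] \<open>\<epsilon> > 0\<close> CD by auto
  obtain n0 where n0: "\<And>m n. m \<ge> n0 \<Longrightarrow> n \<ge> n0 \<Longrightarrow> N (Y m - Y n) < \<epsilon> / (2 * D)"
    using cauchyD[OF Y, of "\<epsilon> / (2 * D)"] \<open>\<epsilon> > 0\<close> CD by auto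
  have "N (Z m - Z n) < \<epsilon>" if "m \<ge> max m0 n0" "n \<ge> max m0 n0" for m n
  proof -
    have "C * N (X m - X n) < \<epsilon> / 2" "D * N (Y m - Y n) < \<epsilon> / 2"
      using m0[of m n] n0[of m n] that CD by (auto simp: field_simps)
    then show ?thesis using le[of m n] by linarith
  qed
  then show "\<exists>n0. \<forall>m\<ge>n0. \<forall>n\<ge>n0. N (Z m - Z n) < \<epsilon>" by blast
qed (rule Z)

lemma cauchy_algebra_add:
  assumes X: "X \<in> carrier CA" and Y: "Y \<in> carrier CA"
  shows "X + Y \<in> carrier CA"
proof (rule cauchyI[OF X Y, of _ 1 1])
  fix m n
  have eq: "(X + Y) m - (X + Y) n = (X m - X n) + (Y m - Y n)" by simp
  have "N ((X + Y) m - (X + Y) n) \<le> N (X m - X n) + N (Y m - Y n)"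
    unfolding eq by (intro N_add diff_in_carrier cauchy_FA[OF X] cauchy_FA[OF Y])
  then show "N ((X + Y) m - (X + Y) n) \<le> 1 * N (X m - X n) + 1 * N (Y m - Y n)" by simp
qed (simp_all add: add_in_carrier cauchy_FA[OF X] cauchy_FA[OF Y])

lemma cauchy_algebra_mult:
  assumes X: "X \<in> carrier CA" and Y: "Y \<in> carrier CA"
  shows "X * Y \<in> carrier CA"
proof -
  note XF = cauchy_FA[OF X] and YF = cauchy_FA[OF Y]
  obtain B where B: "B > 0" "\<And>n. N (X n) \<le> B" using cauchy_bounded[OF X] by blast
  obtain D where D: "D > 0" "\<And>n. N (Y n) \<le> D" using cauchy_bounded[OF Y] by blast
  show ?thesis
  proof (rule cauchyI[OF X Y _ D(1) B(1)])
    fix m n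
    have eq: "(X * Y) m - (X * Y) n = (X m - X n) * Y n + X m * (Y m - Y n)" by (simp add: algebra_simps)
    have "N ((X * Y) m - (X * Y) n) \<le> N ((X m - X n) * Y n) + N (X m * (Y m - Y n))"
      unfolding eq by (intro N_add mult_in_carrier diff_in_carrier XF YF)
    also have "\<dots> \<le> N (X m - X n) * N (Y n) + N (X m) * N (Y m - Y n)"
      by (intro add_mono N_mult XF YF diff_in_carrier)
    also have "\<dots> \<le> N (X m - X n) * D + B * N (Y m - Y n)"
      by (intro add_mono mult_right_mono mult_left_mono B D N_nonneg XF YF diff_in_carrier)
    finally show "N ((X * Y) m - (X * Y) n) \<le> D * N (X m - X n) + B * N (Y m - Y n)" by (simp add: mult.commute)
  qed (simp add: mult_in_carrier XF YF)
qed

lemma cauchy_algebra_scale: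
  assumes X: "X \<in> carrier CA"
  shows "(\<lambda>n. Poly_Mapping.single 0 c * X n) \<in> carrier CA"
proof (rule cauchyI[OF X X, of _ "cmod c + 1" 1])
  fix m n
  have d: "X m - X n \<in> FA" by (intro diff_in_carrier cauchy_FA[OF X])
  then show "N (Poly_Mapping.single 0 c * X m - Poly_Mapping.single 0 c * X n)
      \<le> (cmod c + 1) * N (X m - X n) + 1 * N (X m - X n)"
    using N_scale[OF d, of c] N_nonneg[OF d] by (simp add: right_diff_distrib[symmetric] distrib_right)
qed (simp_all add: scale_in_carrier cauchy_FA[OF X] add_nonneg_pos)

lemma cauchy_algebra_star:
  assumes X: "X \<in> carrier CA"
  shows "(\<lambda>n. star_free (X n)) \<in> carrier CA"
proof -
  have "N (star_free (X m) - star_free (X n)) = N (X m - X n)" for m n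
    using N_star_free[OF diff_in_carrier[OF cauchy_FA[OF X] cauchy_FA[OF X]]] by (simp add: star_free_diff)
  then show ?thesis using X unfolding in_cauchy_algebra by (simp add: star_free_in_carrier)
qed

lemma cauchy_algebra_const: "a \<in> FA \<Longrightarrow> (\<lambda>_. a) \<in> carrier CA"
  by (auto simp: in_cauchy_algebra N_zero)

lemma in_null_sequences: "X \<in> null_sequences G \<longleftrightarrow> X \<in> carrier CA \<and> (\<lambda>n. N (X n)) \<longlonglongrightarrow> 0"
  by (simp add: null_sequences_def)

lemma null_sequenceI:
  assumes "X \<in> carrier CA" "g \<longlonglongrightarrow> 0" "\<And>n. N (X n) \<le> g n"
  shows "X \<in> null_sequences G"
proof -
  have "0 \<le> N (X n)" for n using N_nonneg cauchy_FA[OF assms(1)] by blast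
  then have "(\<lambda>n. N (X n)) \<longlonglongrightarrow> 0"
    using assms(3) by (intro tendsto_0_le[OF assms(2), of _ 1] always_eventually allI) (auto intro: order_trans[OF _ abs_ge_self])
  then show ?thesis using assms(1) by (simp add: in_null_sequences)
qed

lemma quotient_alg_cauchy: "quotient_alg CA (null_sequences G)"
proof (rule quotient_alg.intro)
  have const0: "0 \<in> carrier CA" using cauchy_algebra_const[OF zero_in_carrier] by (simp add: zero_fun_def)
  show "algebra_ideal CA (null_sequences G)"
    unfolding algebra_ideal_def cauchy_algebra_simps
  proof (intro conjI ballI allI)
    show "null_sequences G \<subseteq> carrier CA" by (auto simp: in_null_sequences)
    show "0 \<in> null_sequences G" using const0 by (simp add: in_null_sequences N_zero)
  next
    fix X Y assume X: "X \<in> null_sequences G" and Y: "Y \<in> null_sequences G"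
    then have XC: "X \<in> carrier CA" and YC: "Y \<in> carrier CA" and lim: "(\<lambda>n. N (X n) + N (Y n)) \<longlonglongrightarrow> 0"
      by (auto simp: in_null_sequences intro: tendsto_add_zero)
    show "X + Y \<in> null_sequences G"
      by (rule null_sequenceI[OF cauchy_algebra_add[OF XC YC] lim])
        (simp add: N_add cauchy_FA[OF XC] cauchy_FA[OF YC])
  next
    fix c X assume X: "X \<in> null_sequences G"
    then have "(\<lambda>n. cmod c * N (X n)) \<longlonglongrightarrow> 0" by (auto simp: in_null_sequences intro: tendsto_mult_right_zero)
    moreover have "N (Poly_Mapping.single 0 c * X n) = cmod c * N (X n)" for n
      using X by (intro N_scale cauchy_FA) (simp add: in_null_sequences)
    ultimately show "(\<lambda>n. Poly_Mapping.single 0 c * X n) \<in> null_sequences G"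
      using X cauchy_algebra_scale by (simp add: in_null_sequences)
  next
    fix A X assume A: "A \<in> carrier CA" and X: "X \<in> null_sequences G"
    obtain B where B: "B > 0" "\<And>n. N (A n) \<le> B" using cauchy_bounded[OF A] by blast
    have XC: "X \<in> carrier CA" and lim: "(\<lambda>n. B * N (X n)) \<longlonglongrightarrow> 0"
      using X by (auto simp: in_null_sequences intro: tendsto_mult_right_zero)
    have "N (A n * X n) \<le> B * N (X n)" for n
      using N_mult[OF cauchy_FA[OF A] cauchy_FA[OF XC], of n n]
        mult_right_mono[OF B(2)[of n] N_nonneg[OF cauchy_FA[OF XC], of n]] by linarith
    then show "A * X \<in> null_sequences G"
      by (intro null_sequenceI[OF _ lim] cauchy_algebra_mult A XC) simp
    have "N (X n * A n) \<le> B * N (X n)" for n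
      using N_mult[OF cauchy_FA[OF XC] cauchy_FA[OF A], of n n]
        mult_right_mono[OF B(2)[of n] N_nonneg[OF cauchy_FA[OF XC], of n]] by (simp add: mult.commute)
    then show "X * A \<in> null_sequences G"
      by (intro null_sequenceI[OF _ lim] cauchy_algebra_mult A XC) simp
  qed
  show "0 \<in> carrier CA" by (rule const0)
qed (auto simp: cauchy_algebra_simps cauchy_algebra_add cauchy_algebra_mult cauchy_algebra_scale
    right_diff_distrib fun_eq_iff)

interpretation CQ: quotient_alg CA "null_sequences G"
  by (rule quotient_alg_cauchy)

lemma graph_cstar_algebra_simps:
  "carrier (graph_cstar_algebra G) = CQ.cs ` carrier CA"
  "fin_dim_rep (graph_cstar_algebra G) n \<pi> = fin_dim_rep CQ.Q n \<pi>"
  "alg_star (graph_cstar_algebra G) X = (\<Union>x\<in>X. CQ.cs (\<lambda>n. star_free (x n)))"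
  by (simp_all add: graph_cstar_algebra_def Let_def nu_algebra.defs fin_dim_rep_def CQ.carrier_quotient[symmetric]
      cauchy_algebra_simps)

lemma graph_cstar_algebra_star:
  assumes "X \<in> carrier CA"
  shows "alg_star (graph_cstar_algebra G) (CQ.cs X) = CQ.cs (\<lambda>n. star_free (X n))"
  unfolding graph_cstar_algebra_simps
proof (rule CQ.UN_coset)
  fix X' assume "X' \<in> CQ.cs X"
  then have *: "X' - X \<in> null_sequences G" by (simp add: CQ.in_coset_iff)
  then have D: "X' - X \<in> carrier CA" by (simp only: in_null_sequences)
  have "(\<lambda>n. star_free ((X' - X) n)) \<in> carrier CA" "\<And>n. N (star_free ((X' - X) n)) = N ((X' - X) n)"
    by (rule cauchy_algebra_star[OF D], rule N_star_free[OF cauchy_FA[OF D]])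
  moreover have "(\<lambda>n. star_free (X' n)) - (\<lambda>n. star_free (X n)) = (\<lambda>n. star_free ((X' - X) n))"
    by (simp add: fun_eq_iff star_free_diff)
  ultimately show "(\<lambda>n. star_free (X' n)) - (\<lambda>n. star_free (X n)) \<in> null_sequences G"
    using * by (simp only: in_null_sequences simp_thms)
qed

theorem rfd_cstar_imp_bellier:
  assumes rfd: "rfd_cstar_algebra (graph_cstar_algebra G)"
  shows "bellier_conditions G"
proof (rule bellier_necessary)
  fix v assume v: "v \<in> verts G"
  let ?c = "\<lambda>a :: ('a, 'b, complex) graph_free. CQ.cs (\<lambda>_. a)"
  have p: "(gen_p v :: ('a, 'b, complex) graph_free) \<in> FA" using v by (rule gen_in_carrier)
  have "(\<lambda>_. gen_p v) - (\<lambda>_. 0) \<notin> null_sequences G"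
  proof
    assume "(\<lambda>_. gen_p v) - (\<lambda>_. 0) \<in> null_sequences G"
    then have "(\<lambda>_. N (gen_p v)) \<longlonglongrightarrow> 0" by (simp add: in_null_sequences fun_diff_def)
    then show False using N_gen_p[OF v] by (simp add: LIMSEQ_const_iff)
  qed
  then have "?c (gen_p v) \<noteq> ?c 0" by (simp add: CQ.coset_eq_iff)
  then obtain n \<pi> where \<pi>: "fin_dim_rep CQ.Q n \<pi>" "\<pi> (?c (gen_p v)) \<noteq> \<pi> (?c 0)"
    using rfd cauchy_algebra_const[OF p] cauchy_algebra_const[OF zero_in_carrier]
    unfolding rfd_cstar_algebra_def fin_dim_star_rep_def graph_cstar_algebra_simps by blast
  note P = CQ.fin_dim_rep_pullback[OF \<pi>(1)]
  \<comment> \<open>Constant sequences map the free algebra into the completion; pulling back along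
    them yields a representation that kills the Leavitt ideal.\<close>
  have "fin_dim_rep (free_algebra (graph_gens G)) n (\<lambda>a. \<pi> (?c a))"
    unfolding fin_dim_rep_def
  proof (intro conjI ballI allI)
    fix a b :: "('a, 'b, complex) graph_free" and c assume a: "a \<in> FA" and b: "b \<in> FA"
    note ab = cauchy_algebra_const[OF a] cauchy_algebra_const[OF b]
    show "\<pi> (?c a) \<in> carrier_mat n n" using P(1) ab unfolding fin_dim_rep_def by blast
    have "\<pi> (CQ.cs (alg_add CA (\<lambda>_. a) (\<lambda>_. b))) = \<pi> (?c a) + \<pi> (?c b)"
      using P(1) ab unfolding fin_dim_rep_def by blast
    then show "\<pi> (?c (alg_add (free_algebra (graph_gens G)) a b)) = \<pi> (?c a) + \<pi> (?c b)"
      by (simp add: cauchy_algebra_simps plus_fun_def)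
    have "\<pi> (CQ.cs (alg_mult CA (\<lambda>_. a) (\<lambda>_. b))) = \<pi> (?c a) * \<pi> (?c b)"
      using P(1) ab unfolding fin_dim_rep_def by blast
    then show "\<pi> (?c (alg_mult (free_algebra (graph_gens G)) a b)) = \<pi> (?c a) * \<pi> (?c b)"
      by (simp add: cauchy_algebra_simps times_fun_def)
  next
    fix a :: "('a, 'b, complex) graph_free" and c assume a: "a \<in> FA"
    have "\<pi> (CQ.cs (alg_scale CA c (\<lambda>_. a))) = c \<cdot>\<^sub>m \<pi> (?c a)"
      using P(1) cauchy_algebra_const[OF a] unfolding fin_dim_rep_def by blast
    then show "\<pi> (?c (alg_scale (free_algebra (graph_gens G)) c a)) = c \<cdot>\<^sub>m \<pi> (?c a)"
      by (simp add: cauchy_algebra_simps)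
  qed
  moreover have "\<pi> (?c x) = 0\<^sub>m n n" if "x \<in> leavitt_ideal G" for x
    using leavitt_ideal_null[OF that]
    by (intro P(2)) (simp add: null_ideal_def in_null_sequences cauchy_algebra_const)
  moreover have "\<pi> (?c 0) = 0\<^sub>m n n"
    by (intro P(2)) (simp add: in_null_sequences cauchy_algebra_const zero_in_carrier N_zero)
  ultimately show "\<exists>n. \<exists>\<phi> :: ('a, 'b, complex) graph_free \<Rightarrow> complex mat. leavitt_rep G n \<phi> \<and> \<phi> (gen_p v) \<noteq> 0\<^sub>m n n"
    using \<pi>(2) unfolding leavitt_rep_def by (intro exI[of _ n] exI[of _ "\<lambda>a. \<pi> (?c a)"]) auto
qed

end

section \<open>Sufficiency of the graph conditions for the graph C*-algebra\<close>

context bellier_digraph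
begin

interpretation CQ: quotient_alg CA "null_sequences G"
  by (rule quotient_alg_cauchy)

text \<open>By \<open>N_le_rep_norm\<close> some finite action gives a late term norm above
  \<epsilon> / 2. Later terms differ from it by less than \<epsilon> / 4 in every action, so this
  one action keeps the whole tail away from zero.\<close>

lemma finite_rep_separates:
  assumes Z: "Z \<in> carrier CA" "Z \<notin> null_sequences G"
  obtains w d \<delta> n0 where "path_end G w d" "\<delta> > 0" "\<And>m. m \<ge> n0 \<Longrightarrow> rep_norm w d (Z m) \<ge> \<delta>"
proof -
  note ZF = cauchy_FA[OF Z(1)]
  have "\<not> (\<lambda>n. N (Z n)) \<longlonglongrightarrow> 0" using Z by (simp add: in_null_sequences)
  then obtain \<epsilon> where \<epsilon>: "\<epsilon> > 0" "\<And>n0. \<exists>n\<ge>n0. N (Z n) \<ge> \<epsilon>"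
    using N_nonneg[OF ZF] by (auto simp: LIMSEQ_iff not_less)
  obtain n0 where n0: "\<And>m n. m \<ge> n0 \<Longrightarrow> n \<ge> n0 \<Longrightarrow> N (Z m - Z n) < \<epsilon> / 4"
    using cauchyD[OF Z(1), of "\<epsilon> / 4"] \<epsilon>(1) by auto
  obtain m0 where m0: "m0 \<ge> n0" "N (Z m0) \<ge> \<epsilon>" using \<epsilon>(2) by blast
  have "\<not> N (Z m0) \<le> \<epsilon> / 2" using m0 \<epsilon>(1) by simp
  then obtain w d where w: "path_end G w d" "rep_norm w d (Z m0) > \<epsilon> / 2"
    using N_le_rep_norm[OF ZF[of m0], of "\<epsilon> / 2"] \<epsilon>(1) by (meson half_gt_zero not_le)
  interpret branching G "path_space G w d" "path_src G w" "path_cons d"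
    by (rule branching_path_space[OF wf_digraph w(1)])
  have "opnorm (Z m) \<ge> \<epsilon> / 4" if "m \<ge> n0" for m
  proof -
    have "opnorm ((Z m0 - Z m) + Z m) \<le> opnorm (Z m0 - Z m) + opnorm (Z m)" by (rule opnorm_add)
    moreover have "opnorm (Z m0 - Z m) \<le> N (Z m0 - Z m)"
      by (rule rep_norm_le_N[OF w(1) diff_in_carrier[OF ZF ZF]])
    ultimately show ?thesis using n0[OF m0(1) that] w(2) by simp
  qed
  then show ?thesis using that[OF w(1), of "\<epsilon> / 4" n0] \<epsilon>(1) by simp
qed

context
  fixes w d
  assumes w: "path_end G w d"
begin

interpretation branching G "path_space G w d" "path_src G w" "path_cons d"
  by (rule branching_path_space[OF wf_digraph w])

text \<open>The finite-dimensional representation is extended to the completion entry by entry; the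
  limit is meaningful for Cauchy sequences because entries are dominated by the universal
  seminorm.\<close>

definition lim_mc :: "(nat \<Rightarrow> ('a, 'b, complex) graph_free) \<Rightarrow> 'b list \<Rightarrow> 'b list \<Rightarrow> complex" where
  "lim_mc X y x = lim (\<lambda>n. rep_mc w d (X n) y x)"

lemma tendsto_mc:
  assumes X: "X \<in> carrier CA"
  shows "(\<lambda>n. mc (X n) y x) \<longlonglongrightarrow> lim_mc X y x"
proof -
  have "Cauchy (\<lambda>n. mc (X n) y x)"
  proof (rule CauchyI)
    fix \<epsilon> :: real assume "\<epsilon> > 0"
    then obtain n0 where n0: "\<And>m n. m \<ge> n0 \<Longrightarrow> n \<ge> n0 \<Longrightarrow> N (X m - X n) < \<epsilon>"
      using cauchyD[OF X] by metis
    have "cmod (mc (X m) y x - mc (X n) y x) < \<epsilon>" if "m \<ge> n0" "n \<ge> n0" for m n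
    proof -
      have "cmod (mc (X m - X n) y x) \<le> opnorm (X m - X n)" by (rule cmod_mc_le_opnorm)
      also have "\<dots> \<le> N (X m - X n)"
        by (rule rep_norm_le_N[OF w diff_in_carrier[OF cauchy_FA[OF X] cauchy_FA[OF X]]])
      finally show ?thesis using n0[OF that] by (simp add: mc_diff)
    qed
    then show "\<exists>M. \<forall>m\<ge>M. \<forall>n\<ge>M. cmod (mc (X m) y x - mc (X n) y x) < \<epsilon>" by blast
  qed
  then show ?thesis unfolding lim_mc_def by (intro convergent_LIMSEQ_iff[THEN iffD1] Cauchy_convergent)
qed

lemma lim_mc_eqI: "X \<in> carrier CA \<Longrightarrow> (\<lambda>n. mc (X n) y x) \<longlonglongrightarrow> l \<Longrightarrow> lim_mc X y x = l"
  using tendsto_mc LIMSEQ_unique by blast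

lemma lim_mc_null:
  assumes X: "X \<in> null_sequences G"
  shows "lim_mc X y x = 0"
proof -
  have XC: "X \<in> carrier CA" and lim: "(\<lambda>n. N (X n)) \<longlonglongrightarrow> 0" using X by (auto simp: in_null_sequences)
  have "cmod (mc (X n) y x) \<le> N (X n)" for n
    using cmod_mc_le_opnorm rep_norm_le_N[OF w cauchy_FA[OF XC]] by (rule order_trans)
  then have "(\<lambda>n. mc (X n) y x) \<longlonglongrightarrow> 0" by (intro tendsto_0_le[OF lim, of _ 1] always_eventually allI) (auto intro: order_trans[OF _ abs_ge_self])
  then show ?thesis by (rule lim_mc_eqI[OF XC])
qed

lemma lim_mc_add: "X \<in> carrier CA \<Longrightarrow> Y \<in> carrier CA \<Longrightarrow> lim_mc (X + Y) y x = lim_mc X y x + lim_mc Y y x"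
  by (intro lim_mc_eqI cauchy_algebra_add) (simp_all add: mc_add tendsto_add tendsto_mc)

lemma lim_mc_scale: "X \<in> carrier CA \<Longrightarrow> lim_mc (\<lambda>n. Poly_Mapping.single 0 c * X n) y x = c * lim_mc X y x"
  by (intro lim_mc_eqI cauchy_algebra_scale) (simp_all add: mc_scale tendsto_mult tendsto_mc)

lemma lim_mc_mult:
  assumes X: "X \<in> carrier CA" and Y: "Y \<in> carrier CA"
  shows "lim_mc (X * Y) y x = (\<Sum>z\<in>path_space G w d. lim_mc X y z * lim_mc Y z x)"
proof (rule lim_mc_eqI)
  show "X * Y \<in> carrier CA" by (rule cauchy_algebra_mult[OF X Y])
  show "(\<lambda>n. mc ((X * Y) n) y x) \<longlonglongrightarrow> (\<Sum>z\<in>path_space G w d. lim_mc X y z * lim_mc Y z x)"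
    using mc_mult[OF finite_path_space[OF w] cauchy_FA[OF X]]
    by (simp add: tendsto_sum tendsto_mult tendsto_mc X Y)
qed

lemma lim_mc_star:
  assumes X: "X \<in> carrier CA"
  shows "lim_mc (\<lambda>n. star_free (X n)) y x = cnj (lim_mc X x y)"
  by (intro lim_mc_eqI cauchy_algebra_star X) (simp add: mc_star_free tendsto_mc X tendsto_cnj)

definition lim_matr :: "(nat \<Rightarrow> 'b list) \<Rightarrow> nat \<Rightarrow> (nat \<Rightarrow> ('a, 'b, complex) graph_free) \<Rightarrow> complex mat" where
  "lim_matr h n X = mat n n (\<lambda>(i, j). lim_mc X (h i) (h j))"

lemma fin_dim_rep_lim_matr:
  assumes h: "bij_betw h {0..<n} (path_space G w d)"
  shows "fin_dim_rep CA n (lim_matr h n)"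
  unfolding fin_dim_rep_def cauchy_algebra_simps
proof (intro conjI ballI allI)
  fix X Y assume X: "X \<in> carrier CA" and Y: "Y \<in> carrier CA"
  show "lim_matr h n X \<in> carrier_mat n n" by (simp add: lim_matr_def)
  show "lim_matr h n (X + Y) = lim_matr h n X + lim_matr h n Y"
    by (rule eq_matI) (simp_all add: lim_matr_def lim_mc_add X Y)
  show "lim_matr h n (X * Y) = lim_matr h n X * lim_matr h n Y"
  proof (rule eq_matI)
    fix i j assume "i < dim_row (lim_matr h n X * lim_matr h n Y)" "j < dim_col (lim_matr h n X * lim_matr h n Y)"
    then have ij: "i < n" "j < n" by (simp_all add: lim_matr_def)
    then show "lim_matr h n (X * Y) $$ (i, j) = (lim_matr h n X * lim_matr h n Y) $$ (i, j)"
      by (simp add: lim_matr_def scalar_prod_def lim_mc_mult X Y sum.reindex_bij_betw[OF h, symmetric])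
  qed (simp_all add: lim_matr_def)
next
  fix c X assume X: "X \<in> carrier CA"
  show "lim_matr h n (\<lambda>m. Poly_Mapping.single 0 c * X m) = c \<cdot>\<^sub>m lim_matr h n X"
    by (rule eq_matI) (simp_all add: lim_matr_def lim_mc_scale X)
qed

lemma fin_dim_star_rep_lim_matr:
  assumes h: "bij_betw h {0..<n} (path_space G w d)"
  obtains \<pi> where "fin_dim_star_rep (graph_cstar_algebra G) n \<pi>" "\<And>X. X \<in> carrier CA \<Longrightarrow> \<pi> (CQ.cs X) = lim_matr h n X"
proof -
  have ker: "lim_matr h n X = 0\<^sub>m n n" if "X \<in> null_sequences G" for X
    by (rule eq_matI) (simp_all add: lim_matr_def lim_mc_null that)
  define \<pi> where "\<pi> A = lim_matr h n (CQ.coset_rep A)" for A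
  have \<pi>: "fin_dim_rep CQ.Q n \<pi>" "\<And>X. X \<in> carrier CA \<Longrightarrow> \<pi> (CQ.cs X) = lim_matr h n X"
    using CQ.fin_dim_rep_descend[OF fin_dim_rep_lim_matr[OF h]] ker unfolding \<pi>_def by blast+
  have "\<pi> (alg_star (graph_cstar_algebra G) A) = mat_adjoint (\<pi> A)" if A: "A \<in> CQ.cs ` carrier CA" for A
  proof -
    obtain X where X: "X \<in> carrier CA" "A = CQ.cs X" using A by blast
    have "lim_matr h n (\<lambda>m. star_free (X m)) = mat_adjoint (lim_matr h n X)"
      by (rule eq_matI) (simp_all add: mat_adjoint_def lim_matr_def lim_mc_star X mat_of_rows_index)
    then show ?thesis
      using X by (simp add: graph_cstar_algebra_star \<pi>(2) cauchy_algebra_star)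
  qed
  then have "fin_dim_star_rep (graph_cstar_algebra G) n \<pi>"
    using \<pi>(1) by (simp add: fin_dim_star_rep_def graph_cstar_algebra_simps(1,2))
  then show ?thesis using that \<pi>(2) by blast
qed

lemma lim_mc_nonzero:
  assumes Z: "Z \<in> carrier CA" and \<delta>: "\<delta> > 0" "\<And>m. m \<ge> n0 \<Longrightarrow> rep_norm w d (Z m) \<ge> \<delta>"
  shows "\<exists>y\<in>path_space G w d. \<exists>x\<in>path_space G w d. lim_mc Z y x \<noteq> 0"
proof (rule ccontr)
  assume "\<not> ?thesis"
  then have "(\<lambda>m. mc (Z m) y x) \<longlonglongrightarrow> 0" if "y \<in> path_space G w d" "x \<in> path_space G w d" for y x
    using tendsto_mc[OF Z, of y x] that by auto
  then have "(\<lambda>m. \<Sum>y\<in>path_space G w d. \<Sum>x\<in>path_space G w d. cmod (mc (Z m) y x)) \<longlonglongrightarrow> 0"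
    by (intro tendsto_null_sum tendsto_norm_zero) auto
  then have "eventually (\<lambda>m. (\<Sum>y\<in>path_space G w d. \<Sum>x\<in>path_space G w d. cmod (mc (Z m) y x)) < \<delta>) sequentially"
    using \<delta>(1) by (rule order_tendstoD(2))
  then obtain m where "m \<ge> n0" "(\<Sum>y\<in>path_space G w d. \<Sum>x\<in>path_space G w d. cmod (mc (Z m) y x)) < \<delta>"
    unfolding eventually_sequentially by (meson nat_le_linear)
  then show False
    using opnorm_le_sum_mc[OF finite_path_space[OF w] cauchy_FA[OF Z], of m] \<delta>(2)[of m] by simp
qed

end

theorem rfd_cstar: "rfd_cstar_algebra (graph_cstar_algebra G)"
  unfolding rfd_cstar_algebra_def graph_cstar_algebra_simps(1)
proof (intro ballI impI)
  fix A B assume "A \<in> CQ.cs ` carrier CA" "B \<in> CQ.cs ` carrier CA" and neq: "A \<noteq> B"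
  then obtain X Y where X: "X \<in> carrier CA" "A = CQ.cs X" and Y: "Y \<in> carrier CA" "B = CQ.cs Y" by blast
  have Z: "X - Y \<in> carrier CA" "X - Y \<notin> null_sequences G"
    using CQ.diff_closed[OF X(1) Y(1)] neq X Y by (simp_all add: CQ.coset_eq_iff)
  obtain w d \<delta> n0 where w: "path_end G w d" and \<delta>: "\<delta> > 0" "\<And>m. m \<ge> n0 \<Longrightarrow> rep_norm w d ((X - Y) m) \<ge> \<delta>"
    using finite_rep_separates[OF Z] by metis
  obtain y x where yx: "y \<in> path_space G w d" "x \<in> path_space G w d" "lim_mc w d (X - Y) y x \<noteq> 0"
    using lim_mc_nonzero[OF w Z(1) \<delta>] by blast
  let ?n = "card (path_space G w d)"
  obtain h where h: "bij_betw h {0..<?n} (path_space G w d)"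
    using ex_bij_betw_nat_finite[OF finite_path_space[OF w]] by blast
  obtain \<pi> where \<pi>: "fin_dim_star_rep (graph_cstar_algebra G) ?n \<pi>"
    "\<And>X. X \<in> carrier CA \<Longrightarrow> \<pi> (CQ.cs X) = lim_matr w d h ?n X"
    using fin_dim_star_rep_lim_matr[OF w h] by blast
  obtain i j where ij: "i < ?n" "j < ?n" "h i = y" "h j = x"
  proof -
    have "y \<in> h ` {0..<?n}" "x \<in> h ` {0..<?n}" using yx(1,2) h by (simp_all add: bij_betw_def)
    then show ?thesis using that by auto
  qed
  have "lim_mc w d X y x = lim_mc w d (X - Y) y x + lim_mc w d Y y x"
    using lim_mc_add[OF w Z(1) Y(1)] by simp
  then have "lim_mc w d X y x \<noteq> lim_mc w d Y y x" using yx(3) by simp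
  then have "lim_matr w d h ?n X $$ (i, j) \<noteq> lim_matr w d h ?n Y $$ (i, j)"
    using ij by (simp add: lim_matr_def[OF w])
  then have "\<pi> A \<noteq> \<pi> B" using \<pi>(2) X Y by auto
  then show "\<exists>n \<pi>. fin_dim_star_rep (graph_cstar_algebra G) n \<pi> \<and> \<pi> A \<noteq> \<pi> B" using \<pi>(1) by blast
qed

end

theorem corollary7p5:
  fixes E :: "('v, 'e) pre_digraph"
  assumes "wf_digraph E"
  shows "(rfd_cstar_algebra (graph_cstar_algebra E) \<longleftrightarrow>
            rfd_algebra (leavitt_path_algebra E :: ('k::field, ('v, 'e, 'k) graph_free set) nu_algebra)) \<and>
         (rfd_algebra (leavitt_path_algebra E :: ('k::field, ('v, 'e, 'k) graph_free set) nu_algebra) \<longleftrightarrow>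
            bellier_conditions E)"
proof -
  have sufficient: "rfd_cstar_algebra (graph_cstar_algebra E)"
    "rfd_algebra (leavitt_path_algebra E :: ('k::field, ('v, 'e, 'k) graph_free set) nu_algebra)"
    if "bellier_conditions E"
  proof -
    interpret bellier_digraph E
      using assms that by (simp add: bellier_digraph_def bellier_digraph_axioms_def)
    show "rfd_cstar_algebra (graph_cstar_algebra E)" by (rule rfd_cstar)
    show "rfd_algebra (leavitt_path_algebra E :: ('k::field, ('v, 'e, 'k) graph_free set) nu_algebra)"
      by (rule rfd_leavitt)
  qed
  \<comment> \<open>The two algebras meet only in the graph conditions, so no relation between the
    field of the Leavitt path algebra and the complex numbers is required.\<close>
  then show ?thesis
    using wf_digraph.rfd_cstar_imp_bellier[OF assms] wf_digraph.rfd_leavitt_imp_bellier[OF assms] by blast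
qed

end
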